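(* Let $k$ be a field of characteristic $0$ and let $\mathcal L$, $\mathcal L'$ be centreless Lie tori over $k$ of types $(\Delta,\Lambda)$ and $(\Delta',\Lambda')$ respectively, with $\mathfrak h=\mathcal L_0^0$ and $\mathfrak h'=\mathcal L'^{\,0}_0$. If $\varphi:\mathcal L\to\mathcal L'$ is an algebra isomorphism, then $\varphi$ is an isotopy if and only if $\varphi(\mathfrak h)=\mathfrak h'$.
   Context: An irreducible finite root system is a finite subset $\Delta$ of a finite-dimensional vector space with $0\in\Delta$ and $\Delta^\times:=\Delta\setminus\{0\}$ an irreducible (possibly non-reduced) root system in the usual sense; $Q=\mathrm{span}_{\mathbb Z}\Delta$, $\alpha^\vee$ coroots, $\Delta^\times_{\mathrm{ind}}=\Delta^\times\setminus2\Delta^\times$. Let $\Lambda$ be a finitely generated free abelian group. A Lie torus of type $(\Delta,\Lambda)$ is a Lie algebra $\mathcal L$ over $k$ with a $Q\times\Lambda$-grading $\mathcal L=\bigoplus\mathcal L_\alpha^\lambda$ ($\mathcal L_\alpha:=\bigoplus_\lambda\mathcal L_\alpha^\lambda$, $\mathcal L^\lambda:=\bigoplus_\alpha\mathcal L_\alpha^\lambda$) such that: (LT1) $\{\alpha:\mathcal L_\alpha\neq0\}=\Delta$; (LT2)(i) $\mathcal L_\alpha^0\neq0$ for $\alpha\in\Delta^\times_{\mathrm{ind}}$; (ii) whenever $\alpha\in\Delta^\times$ and $\mathcal L_\alpha^\lambda\ne0$ there are $e\in\mathcal L_\alpha^\lambda$, $f\in\mathcal L_{-\alpha}^{-\lambda}$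 with $\mathcal L_\alpha^\lambda=ke$, $\mathcal L_{-\alpha}^{-\lambda}=kf$, $[[e,f],x]=\langle\beta,\alpha^\vee\rangle x$ for $x\in\mathcal L_\beta$, $\beta\in Q$; (LT3) $\mathcal L$ is generated by the $\mathcal L_\alpha$, $\alpha\in\Delta^\times$; (LT4) $\Lambda$ is generated by $\{\lambda:\mathcal L^\lambda\ne0\}$. Centreless = zero centre. An isotopy from $\mathcal L$ onto $\mathcal L'$ is an algebra isomorphism $\varphi$ such that $\varphi(\mathcal L_\alpha^\lambda)=\mathcal L'^{\,\varphi_e(\lambda)+\varphi_s(\alpha)}_{\varphi_r(\alpha)}$ for all $\alpha\in Q$, $\lambda\in\Lambda$, for some group isomorphisms $\varphi_r:Q\to Q'=\mathrm{span}_{\mathbb Z}\Delta'$, $\varphi_e:\Lambda\to\Lambda'$ and a group homomorphism $\varphi_s:Q\to\Lambda'$. *)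

theory Defs
  imports "HOL-Analysis.Analysis"
begin

text \<open>Roots live in a real vector space; the ambient space of the root system
  Delta-minus-zero is taken to be its span (Bourbaki's definition, possibly non-reduced).\<close>

definition zspan :: "'r::real_vector set \<Rightarrow> 'r set" where
  "zspan S = {x. \<exists>F c. finite F \<and> F \<subseteq> S \<and> x = (\<Sum>a\<in>F. real_of_int (c a) *\<^sub>R a)}"

definition coroot_ok :: "'r::real_vector set \<Rightarrow> 'r \<Rightarrow> ('r \<Rightarrow> real) \<Rightarrow> bool" where
  "coroot_ok R \<alpha> c \<longleftrightarrow> linear c \<and> c \<alpha> = 2 \<and>
     (\<lambda>\<beta>. \<beta> - c \<beta> *\<^sub>R \<alpha>) ` R = R \<and> (\<forall>\<beta>\<in>R. c \<beta> \<in> \<int>)"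

definition is_root_system :: "'r::real_vector set \<Rightarrow> bool" where
  "is_root_system R \<longleftrightarrow> finite R \<and> 0 \<notin> R \<and> (\<forall>\<alpha>\<in>R. \<exists>c. coroot_ok R \<alpha> c)"

definition irreducible_root_system :: "'r::real_vector set \<Rightarrow> bool" where
  "irreducible_root_system R \<longleftrightarrow> is_root_system R \<and> R \<noteq> {} \<and>
     \<not> (\<exists>V1 V2. subspace V1 \<and> subspace V2 \<and> V1 \<noteq> {0} \<and> V2 \<noteq> {0} \<and> V1 \<inter> V2 = {0} \<and>
            {x + y | x y. x \<in> V1 \<and> y \<in> V2} = span R \<and> R \<subseteq> V1 \<union> V2)"

definition finite_root_system :: "'r::real_vector set \<Rightarrow> bool" where
  "finite_root_system \<Delta> \<longleftrightarrow> finite \<Delta> \<and> 0 \<in> \<Delta> \<and> irreducible_root_system (\<Delta> - {0})"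

text \<open>The coroot of alpha (unique on the span of the roots).\<close>
definition coroot :: "'r::real_vector set \<Rightarrow> 'r \<Rightarrow> 'r \<Rightarrow> real" where
  "coroot \<Delta> \<alpha> = (SOME c. coroot_ok (\<Delta> - {0}) \<alpha> c)"

text \<open>The integer pairing of beta with alpha-check (an integer for beta in Q).\<close>
definition pairing :: "'r::real_vector set \<Rightarrow> 'r \<Rightarrow> 'r \<Rightarrow> int" where
  "pairing \<Delta> \<beta> \<alpha> = \<lfloor>coroot \<Delta> \<alpha> \<beta>\<rfloor>"

definition ind_roots :: "'r::real_vector set \<Rightarrow> 'r set" where
  "ind_roots \<Delta> = (\<Delta> - {0}) - (\<lambda>\<alpha>. 2 *\<^sub>R \<alpha>) ` (\<Delta> - {0})"

definition zsc :: "int \<Rightarrow> 'a::ab_group_add \<Rightarrow> 'a" where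
  "zsc n x = (if 0 \<le> n then (\<Sum>i<nat n. x) else - (\<Sum>i<nat (- n). x))"

definition fg_free_abelian :: "'l::ab_group_add itself \<Rightarrow> bool" where
  "fg_free_abelian _ \<longleftrightarrow> (\<exists>(n::nat) (b::nat \<Rightarrow> 'l). \<forall>x::'l. \<exists>!c::nat \<Rightarrow> int.
      (\<forall>i\<ge>n. c i = 0) \<and> x = (\<Sum>i<n. zsc (c i) (b i)))"

definition gen_subgroup :: "'a::ab_group_add set \<Rightarrow> 'a set" where
  "gen_subgroup S = \<Inter>{H. S \<subseteq> H \<and> 0 \<in> H \<and> (\<forall>x\<in>H. \<forall>y\<in>H. x + y \<in> H \<and> - x \<in> H)}"

definition lie_algebra :: "('k::field \<Rightarrow> 'v::ab_group_add \<Rightarrow> 'v) \<Rightarrow> ('v \<Rightarrow> 'v \<Rightarrow> 'v) \<Rightarrow> bool" where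
  "lie_algebra sc br \<longleftrightarrow> module sc \<and>
     (\<forall>x y z. br (x + y) z = br x z + br y z) \<and>
     (\<forall>x y z. br x (y + z) = br x y + br x z) \<and>
     (\<forall>a x y. br (sc a x) y = sc a (br x y)) \<and>
     (\<forall>a x y. br x (sc a y) = sc a (br x y)) \<and>
     (\<forall>x. br x x = 0) \<and>
     (\<forall>x y z. br x (br y z) + br y (br z x) + br z (br x y) = 0)"

definition centreless :: "('v::ab_group_add \<Rightarrow> 'v \<Rightarrow> 'v) \<Rightarrow> bool" where
  "centreless br \<longleftrightarrow> (\<forall>z. (\<forall>x. br z x = 0) \<longrightarrow> z = 0)"

definition gen_subalg :: "('k::field \<Rightarrow> 'v::ab_group_add \<Rightarrow> 'v) \<Rightarrow> ('v \<Rightarrow> 'v \<Rightarrow> 'v) \<Rightarrow> 'v set \<Rightarrow> 'v set" where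
  "gen_subalg sc br S = \<Inter>{A. S \<subseteq> A \<and> 0 \<in> A \<and>
      (\<forall>x\<in>A. \<forall>y\<in>A. x + y \<in> A \<and> br x y \<in> A) \<and> (\<forall>a. \<forall>x\<in>A. sc a x \<in> A)}"

definition alg_iso :: "('k::field \<Rightarrow> 'v::ab_group_add \<Rightarrow> 'v) \<Rightarrow> ('v \<Rightarrow> 'v \<Rightarrow> 'v) \<Rightarrow>
    ('k \<Rightarrow> 'w::ab_group_add \<Rightarrow> 'w) \<Rightarrow> ('w \<Rightarrow> 'w \<Rightarrow> 'w) \<Rightarrow> ('v \<Rightarrow> 'w) \<Rightarrow> bool" where
  "alg_iso sc br sc' br' \<phi> \<longleftrightarrow> bij \<phi> \<and>
     (\<forall>x y. \<phi> (x + y) = \<phi> x + \<phi> y) \<and>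
     (\<forall>a x. \<phi> (sc a x) = sc' a (\<phi> x)) \<and>
     (\<forall>x y. \<phi> (br x y) = br' (\<phi> x) (\<phi> y))"

text \<open>A grading is a family Lg alpha lambda of subspaces indexed by Q x Lambda
  (Lg alpha lambda = 0 for alpha outside Q).\<close>

definition Lroot :: "('r \<Rightarrow> 'l \<Rightarrow> 'v::ab_group_add set) \<Rightarrow> 'r \<Rightarrow> 'v set" where
  "Lroot Lg \<alpha> = {\<Sum>lam\<in>F. c lam | F c. finite F \<and> (\<forall>lam\<in>F. c lam \<in> Lg \<alpha> lam)}"

definition Ldeg :: "('r \<Rightarrow> 'l \<Rightarrow> 'v::ab_group_add set) \<Rightarrow> 'l \<Rightarrow> 'v set" where
  "Ldeg Lg lam = {\<Sum>\<alpha>\<in>F. c \<alpha> | F c. finite F \<and> (\<forall>\<alpha>\<in>F. c \<alpha> \<in> Lg \<alpha> lam)}"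

definition graded_lie_algebra ::
  "('k::field \<Rightarrow> 'v::ab_group_add \<Rightarrow> 'v) \<Rightarrow> ('v \<Rightarrow> 'v \<Rightarrow> 'v) \<Rightarrow> 'r::real_vector set \<Rightarrow>
   ('r \<Rightarrow> 'l::ab_group_add \<Rightarrow> 'v set) \<Rightarrow> bool" where
  "graded_lie_algebra sc br Q Lg \<longleftrightarrow> lie_algebra sc br \<and>
     (\<forall>\<alpha> lam. module.subspace sc (Lg \<alpha> lam)) \<and>
     (\<forall>\<alpha> lam. \<alpha> \<notin> Q \<longrightarrow> Lg \<alpha> lam = {0}) \<and>
     (\<forall>x. \<exists>!c. (\<forall>\<alpha> lam. c \<alpha> lam \<in> Lg \<alpha> lam) \<and> finite {(\<alpha>, lam). c \<alpha> lam \<noteq> 0} \<and>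
          x = (\<Sum>p\<in>{(\<alpha>, lam). c \<alpha> lam \<noteq> 0}. case_prod c p)) \<and>
     (\<forall>\<alpha> lam \<beta> \<mu>. \<forall>x\<in>Lg \<alpha> lam. \<forall>y\<in>Lg \<beta> \<mu>. br x y \<in> Lg (\<alpha> + \<beta>) (lam + \<mu>))"

definition lie_torus ::
  "('k::field \<Rightarrow> 'v::ab_group_add \<Rightarrow> 'v) \<Rightarrow> ('v \<Rightarrow> 'v \<Rightarrow> 'v) \<Rightarrow> 'r::real_vector set \<Rightarrow>
   ('r \<Rightarrow> 'l::ab_group_add \<Rightarrow> 'v set) \<Rightarrow> bool" where
  "lie_torus sc br \<Delta> Lg \<longleftrightarrow>
     finite_root_system \<Delta> \<and> fg_free_abelian TYPE('l) \<and>
     graded_lie_algebra sc br (zspan \<Delta>) Lg \<and>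
     \<comment> \<open>LT1\<close>
     {\<alpha>. Lroot Lg \<alpha> \<noteq> {0}} = \<Delta> \<and>
     \<comment> \<open>LT2 (i)\<close>
     (\<forall>\<alpha>\<in>ind_roots \<Delta>. Lg \<alpha> 0 \<noteq> {0}) \<and>
     \<comment> \<open>LT2 (ii)\<close>
     (\<forall>\<alpha>\<in>\<Delta> - {0}. \<forall>lam. Lg \<alpha> lam \<noteq> {0} \<longrightarrow>
        (\<exists>e f. e \<in> Lg \<alpha> lam \<and> f \<in> Lg (- \<alpha>) (- lam) \<and>
           Lg \<alpha> lam = range (\<lambda>a. sc a e) \<and> Lg (- \<alpha>) (- lam) = range (\<lambda>a. sc a f) \<and>
           (\<forall>\<beta>\<in>zspan \<Delta>. \<forall>x\<in>Lroot Lg \<beta>.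
              br (br e f) x = sc (of_int (pairing \<Delta> \<beta> \<alpha>)) x))) \<and>
     \<comment> \<open>LT3\<close>
     gen_subalg sc br (\<Union>\<alpha>\<in>\<Delta> - {0}. Lroot Lg \<alpha>) = UNIV \<and>
     \<comment> \<open>LT4\<close>
     gen_subgroup {lam. Ldeg Lg lam \<noteq> {0}} = UNIV"

definition is_isotopy ::
  "('k::field \<Rightarrow> 'v::ab_group_add \<Rightarrow> 'v) \<Rightarrow> ('v \<Rightarrow> 'v \<Rightarrow> 'v) \<Rightarrow> 'r::real_vector set \<Rightarrow>
   ('r \<Rightarrow> 'l::ab_group_add \<Rightarrow> 'v set) \<Rightarrow>
   ('k \<Rightarrow> 'w::ab_group_add \<Rightarrow> 'w) \<Rightarrow> ('w \<Rightarrow> 'w \<Rightarrow> 'w) \<Rightarrow> 'r2::real_vector set \<Rightarrow>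
   ('r2 \<Rightarrow> 'l2::ab_group_add \<Rightarrow> 'w set) \<Rightarrow> ('v \<Rightarrow> 'w) \<Rightarrow> bool" where
  "is_isotopy sc br \<Delta> Lg sc' br' \<Delta>' Lg' \<phi> \<longleftrightarrow>
     alg_iso sc br sc' br' \<phi> \<and>
     (\<exists>(\<phi>r :: 'r \<Rightarrow> 'r2) (\<phi>e :: 'l \<Rightarrow> 'l2) (\<phi>s :: 'r \<Rightarrow> 'l2).
        (\<forall>\<alpha>\<in>zspan \<Delta>. \<forall>\<beta>\<in>zspan \<Delta>. \<phi>r (\<alpha> + \<beta>) = \<phi>r \<alpha> + \<phi>r \<beta>) \<and>
        bij_betw \<phi>r (zspan \<Delta>) (zspan \<Delta>') \<and>
        (\<forall>lam \<mu>. \<phi>e (lam + \<mu>) = \<phi>e lam + \<phi>e \<mu>) \<and> bij \<phi>e \<and>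
        (\<forall>\<alpha>\<in>zspan \<Delta>. \<forall>\<beta>\<in>zspan \<Delta>. \<phi>s (\<alpha> + \<beta>) = \<phi>s \<alpha> + \<phi>s \<beta>) \<and>
        (\<forall>\<alpha>\<in>zspan \<Delta>. \<forall>lam. \<phi> ` Lg \<alpha> lam = Lg' (\<phi>r \<alpha>) (\<phi>e lam + \<phi>s \<alpha>)))"

end

theory Submission
  imports Defs
begin

text \<open>
  Only the implication from right to left needs work. Every element of \<open>L_0^0\<close> acts on each root
  space by a scalar which is additive in the root, and these scalars separate the roots; so
  \<open>\<phi>\<close> maps root spaces to root spaces. If \<open>e \<in> L_\<alpha>^\<lambda>\<close> and \<open>f \<in> L_{-\<alpha>}^{-\<lambda>}\<close> span an \<open>sl_2\<close>, then
  \<open>[\<phi> e, \<phi> f]\<close> has degree zero; since brackets of nonzero elements of opposite homogeneous root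
  spaces do not vanish, comparing leading terms shows that \<open>\<phi> e\<close> is homogeneous. Consider the
  subgroup of \<open>(Q \<times> \<Lambda>) \<times> (Q' \<times> \<Lambda>')\<close> generated by all pairs of corresponding degrees. By \<open>sl_2\<close>-theory
  the generating set is stable under the reflections in its elements. Reflections of degree zero
  show that the dependence on the root is linear (average over the coroots), and products of two
  reflections in the same root are translations, which, by irreducibility, determine the dependence
  on \<open>\<Lambda>\<close> up to torsion. So the subgroup is the graph of an isomorphism of the form required of an
  isotopy, and it describes \<open>\<phi>\<close> on all degrees because the nonzero root spaces generate.
\<close>

section \<open>Generated subgroups\<close>

text \<open>The obstacle is that the degree shift caused by \<open>\<phi>\<close> on the nonzero
  root spaces is known only through reflections. No base of the root system is chosen, so nothing
  extends it additively to \<open>Q\<close> at once, and a value reached in two ways might disagree.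
  A generated subgroup avoids prescribing values: additivity is built in, and the danger that
  remains is an element with source zero and target nonzero. Averaging removes this danger. If
  \<open>f\<close> on the roots satisfies f(s_\<alpha> \<beta>) = f(\<beta>) - <\<beta>,
  \<alpha>^vee> f(\<alpha>), then the sum of <v, \<alpha>^vee> f(\<alpha>) over all roots is linear
  in v, and at a root \<gamma> it equals \<open>casimir \<gamma> / 2\<close> times f(\<gamma>). By
  irreducibility the factor does not depend on \<gamma>. Degree zero is guaranteed only over
  indivisible roots, so the averaging takes place there and divisible roots are recovered by one
  more reflection. Embedding the degree groups in the reals serves twice: it orders them for the
  leading terms, and it allows cancelling the Casimir factor and the integers collected along chains
  of linked roots.\<close>

lemma gen_subgroup_superset: "S \<subseteq> gen_subgroup S"
  by (auto simp: gen_subgroup_def)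

lemma gen_subgroup_zero: "0 \<in> gen_subgroup S"
  by (auto simp: gen_subgroup_def)

lemma gen_subgroup_add: "x \<in> gen_subgroup S \<Longrightarrow> y \<in> gen_subgroup S \<Longrightarrow> x + y \<in> gen_subgroup S"
  by (auto simp: gen_subgroup_def)

lemma gen_subgroup_uminus: "x \<in> gen_subgroup S \<Longrightarrow> - x \<in> gen_subgroup S"
  by (auto simp: gen_subgroup_def)

lemma gen_subgroup_diff:
  "x \<in> gen_subgroup S \<Longrightarrow> y \<in> gen_subgroup S \<Longrightarrow> x - y \<in> gen_subgroup S"
  using gen_subgroup_add[of x S "- y"] gen_subgroup_uminus[of y S] by simp

lemma gen_subgroup_induct [consumes 1, case_names base zero add uminus]:
  assumes "x \<in> gen_subgroup S"
    and "\<And>x. x \<in> S \<Longrightarrow> P x" and "P 0"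
    and "\<And>x y. P x \<Longrightarrow> P y \<Longrightarrow> P (x + y)" and "\<And>x. P x \<Longrightarrow> P (- x)"
  shows "P x"
proof -
  have "x \<in> Collect P"
    using assms(1) unfolding gen_subgroup_def
    by (rule InterD) (use assms(2-5) in auto)
  then show ?thesis by simp
qed

lemma gen_subgroup_least:
  assumes "S \<subseteq> gen_subgroup S'"
  shows "gen_subgroup S \<subseteq> gen_subgroup S'"
proof
  fix x assume "x \<in> gen_subgroup S"
  then show "x \<in> gen_subgroup S'"
    by (induction rule: gen_subgroup_induct)
       (use assms in \<open>auto intro: gen_subgroup_zero gen_subgroup_add gen_subgroup_uminus\<close>)
qed

lemma gen_subgroup_of_nat_scaleR:
  fixes x :: "'a::real_vector"
  shows "x \<in> gen_subgroup S \<Longrightarrow> real n *\<^sub>R x \<in> gen_subgroup S"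
  by (induction n) (auto simp: algebra_simps gen_subgroup_zero gen_subgroup_add)

lemma gen_subgroup_of_int_scaleR:
  fixes x :: "'a::real_vector"
  assumes "x \<in> gen_subgroup S"
  shows "real_of_int n *\<^sub>R x \<in> gen_subgroup S"
proof (cases "n \<ge> 0")
  case True
  then show ?thesis using gen_subgroup_of_nat_scaleR[OF assms, of "nat n"] by simp
next
  case False
  then have "real_of_int n *\<^sub>R x = - (real (nat (- n)) *\<^sub>R x)" by simp
  then show ?thesis using gen_subgroup_uminus gen_subgroup_of_nat_scaleR[OF assms] by metis
qed

text \<open>Makes \<open>gen_subgroup_induct\<close> available for statements about
  \<open>Q\<close>.\<close>

lemma zspan_eq_gen_subgroup: "zspan S = gen_subgroup S"
proof
  show "zspan S \<subseteq> gen_subgroup S"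
  proof
    fix x assume "x \<in> zspan S"
    then obtain F c where F: "finite F" "F \<subseteq> S" "x = (\<Sum>a\<in>F. real_of_int (c a) *\<^sub>R a)"
      by (auto simp: zspan_def)
    have "(\<Sum>a\<in>F. real_of_int (c a) *\<^sub>R a) \<in> gen_subgroup S"
      using F(1,2)
    proof (induction F rule: finite_induct)
      case (insert a F)
      then have "a \<in> gen_subgroup S" using gen_subgroup_superset by blast
      with insert show ?case by (simp add: gen_subgroup_add gen_subgroup_of_int_scaleR)
    qed (simp add: gen_subgroup_zero)
    then show "x \<in> gen_subgroup S" using F(3) by simp
  qed
  show "gen_subgroup S \<subseteq> zspan S"
  proof
    fix x assume "x \<in> gen_subgroup S"
    then show "x \<in> zspan S"
    proof (induction rule: gen_subgroup_induct)
      case (base x)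
      then show ?case unfolding zspan_def
        by (intro CollectI exI[of _ "{x}"] exI[of _ "\<lambda>_. 1"]) simp
    next
      case zero
      then show ?case unfolding zspan_def
        by (intro CollectI exI[of _ "{}"]) simp
    next
      case (add x y)
      then obtain F c G d where F: "finite F" "F \<subseteq> S" "x = (\<Sum>a\<in>F. real_of_int (c a) *\<^sub>R a)"
        and G: "finite G" "G \<subseteq> S" "y = (\<Sum>a\<in>G. real_of_int (d a) *\<^sub>R a)"
        by (auto simp: zspan_def)
      define c' d' where "c' a = (if a \<in> F then c a else 0)"
        and "d' a = (if a \<in> G then d a else 0)" for a
      have "x = (\<Sum>a\<in>F \<union> G. real_of_int (c' a) *\<^sub>R a)"
        unfolding F(3) by (rule sum.mono_neutral_cong_left) (auto simp: F G c'_def)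
      moreover have "y = (\<Sum>a\<in>F \<union> G. real_of_int (d' a) *\<^sub>R a)"
        unfolding G(3) by (rule sum.mono_neutral_cong_left) (auto simp: F G d'_def)
      ultimately have "x + y = (\<Sum>a\<in>F \<union> G. real_of_int (c' a + d' a) *\<^sub>R a)"
        by (simp add: sum.distrib scaleR_add_left)
      then show ?case using F G unfolding zspan_def
        by (intro CollectI exI[of _ "F \<union> G"] exI[of _ "\<lambda>a. c' a + d' a"]) simp
    next
      case (uminus x)
      then obtain F c where F: "finite F" "F \<subseteq> S" "x = (\<Sum>a\<in>F. real_of_int (c a) *\<^sub>R a)"
        by (auto simp: zspan_def)
      then show ?case unfolding zspan_def
        by (intro CollectI exI[of _ F] exI[of _ "\<lambda>a. - c a"]) (simp add: sum_negf)
    qed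
  qed
qed

section \<open>Root systems\<close>

text \<open>The coroots are a parameter, so that the same linear forms serve for all nonzero roots
  and for the indivisible ones. They are defined on the ambient space, but the axioms determine them
  only on the span of \<open>R\<close>.\<close>

locale root_sys =
  fixes R :: "'r::real_vector set" and cr :: "'r \<Rightarrow> 'r \<Rightarrow> real"
  assumes finR: "finite R"
    and zero_notin: "0 \<notin> R"
    and lin: "\<alpha> \<in> R \<Longrightarrow> linear (cr \<alpha>)"
    and cr_self: "\<alpha> \<in> R \<Longrightarrow> cr \<alpha> \<alpha> = 2"
    and cr_refl: "\<alpha> \<in> R \<Longrightarrow> \<beta> \<in> R \<Longrightarrow> \<beta> - cr \<alpha> \<beta> *\<^sub>R \<alpha> \<in> R"
    and cr_Ints: "\<alpha> \<in> R \<Longrightarrow> \<beta> \<in> R \<Longrightarrow> cr \<alpha> \<beta> \<in> \<int>"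
begin

definition reflect :: "'r \<Rightarrow> 'r \<Rightarrow> 'r" where
  "reflect \<alpha> v = v - cr \<alpha> v *\<^sub>R \<alpha>"

lemma reflect_in: "\<alpha> \<in> R \<Longrightarrow> \<beta> \<in> R \<Longrightarrow> reflect \<alpha> \<beta> \<in> R"
  by (simp add: reflect_def cr_refl)

lemma cr_add: "\<alpha> \<in> R \<Longrightarrow> cr \<alpha> (x + y) = cr \<alpha> x + cr \<alpha> y"
  by (rule linear_add[OF lin])

lemma cr_diff: "\<alpha> \<in> R \<Longrightarrow> cr \<alpha> (x - y) = cr \<alpha> x - cr \<alpha> y"
  by (rule linear_diff[OF lin])

lemma cr_neg: "\<alpha> \<in> R \<Longrightarrow> cr \<alpha> (- y) = - cr \<alpha> y"
  by (rule linear_neg[OF lin])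

lemma cr_scale: "\<alpha> \<in> R \<Longrightarrow> cr \<alpha> (r *\<^sub>R y) = r * cr \<alpha> y"
  using linear_scale[OF lin] by fastforce

lemma cr_0: "\<alpha> \<in> R \<Longrightarrow> cr \<alpha> 0 = 0"
  by (rule linear_0[OF lin])

lemmas cr_simps = cr_add cr_diff cr_neg cr_scale cr_0 cr_self

lemma reflect_reflect: "\<alpha> \<in> R \<Longrightarrow> reflect \<alpha> (reflect \<alpha> v) = v"
  by (simp add: reflect_def cr_simps)

lemma reflect_self: "\<alpha> \<in> R \<Longrightarrow> reflect \<alpha> \<alpha> = - \<alpha>"
  by (simp add: reflect_def cr_simps scaleR_2)

lemma uminus_in: "\<alpha> \<in> R \<Longrightarrow> - \<alpha> \<in> R"
  using reflect_in[of \<alpha> \<alpha>] by (simp add: reflect_self)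

lemma reflect_bij: "\<alpha> \<in> R \<Longrightarrow> bij_betw (reflect \<alpha>) R R"
  by (rule bij_betwI[where g = "reflect \<alpha>"]) (auto simp: reflect_in reflect_reflect)

lemma reflect_diff: "\<alpha> \<in> R \<Longrightarrow> reflect \<alpha> (x - y) = reflect \<alpha> x - reflect \<alpha> y"
  by (simp add: reflect_def cr_simps algebra_simps)

lemma reflect_scale: "\<alpha> \<in> R \<Longrightarrow> reflect \<alpha> (r *\<^sub>R x) = r *\<^sub>R reflect \<alpha> x"
  by (simp add: reflect_def cr_simps algebra_simps)

text \<open>Two reflections in the same root compose to a transvection, which must have finite order.\<close>

lemma coroot_unique:
  assumes \<alpha>: "\<alpha> \<in> R" and d: "linear d" "d \<alpha> = 2"
    and dR: "\<And>\<beta>. \<beta> \<in> R \<Longrightarrow> \<beta> - d \<beta> *\<^sub>R \<alpha> \<in> R" and \<beta>: "\<beta> \<in> R"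
  shows "d \<beta> = cr \<alpha> \<beta>"
proof (rule ccontr)
  define k where "k = d \<beta> - cr \<alpha> \<beta>"
  assume "d \<beta> \<noteq> cr \<alpha> \<beta>"
  then have k: "k \<noteq> 0" by (simp add: k_def)
  have mem: "\<beta> + (real n * k) *\<^sub>R \<alpha> \<in> R" for n
  proof (induction n)
    case 0
    then show ?case using \<beta> by simp
  next
    case (Suc n)
    let ?v = "\<beta> + (real n * k) *\<^sub>R \<alpha>"
    have "reflect \<alpha> (?v - d ?v *\<^sub>R \<alpha>) \<in> R" using dR[OF Suc] reflect_in[OF \<alpha>] by blast
    moreover have "reflect \<alpha> (w - t *\<^sub>R \<alpha>) = w + (t - cr \<alpha> w) *\<^sub>R \<alpha>" for w t
    proof -
      have "reflect \<alpha> (w - t *\<^sub>R \<alpha>) = w - t *\<^sub>R \<alpha> - (cr \<alpha> w - t * 2) *\<^sub>R \<alpha>"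
        using \<alpha> by (simp only: reflect_def cr_diff cr_scale cr_self)
      also have "\<dots> = w + (t - cr \<alpha> w) *\<^sub>R \<alpha>"
        by (simp add: algebra_simps flip: scaleR_add_left)
      finally show ?thesis .
    qed
    moreover have "d ?v - cr \<alpha> ?v = k"
      using \<alpha> d by (simp add: cr_simps linear_add linear_scale k_def)
    moreover have "?v + k *\<^sub>R \<alpha> = \<beta> + (real (Suc n) * k) *\<^sub>R \<alpha>"
      by (simp add: algebra_simps)
    ultimately show ?case by simp
  qed
  then have "finite (range (\<lambda>n. \<beta> + (real n * k) *\<^sub>R \<alpha>))"
    by (intro finite_subset[OF _ finR]) auto
  moreover have "inj (\<lambda>n. \<beta> + (real n * k) *\<^sub>R \<alpha>)"
    using k \<alpha> zero_notin by (auto simp: inj_on_def)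
  ultimately show False using finite_imageD infinite_UNIV_nat by blast
qed

text \<open>Conjugating the reflection in \<alpha> by the one in \<gamma> gives a reflection in
  \<open>reflect \<gamma> \<alpha>\<close> that preserves \<open>R\<close>, so
  \<open>coroot_unique\<close> identifies its linear form. This equivariance is used whenever a sum
  over \<open>R\<close> is reindexed by a reflection.\<close>

lemma cr_reflect_left:
  assumes "\<alpha> \<in> R" "\<gamma> \<in> R" "x \<in> R"
  shows "cr (reflect \<gamma> \<alpha>) x = cr \<alpha> (reflect \<gamma> x)"
proof -
  have "linear (\<lambda>x. cr \<alpha> (reflect \<gamma> x))"
    using assms by (intro linearI) (auto simp: reflect_def cr_simps algebra_simps)
  moreover have "\<beta> - cr \<alpha> (reflect \<gamma> \<beta>) *\<^sub>R reflect \<gamma> \<alpha> \<in> R" if "\<beta> \<in> R" for \<beta>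
  proof -
    have "\<beta> - cr \<alpha> (reflect \<gamma> \<beta>) *\<^sub>R reflect \<gamma> \<alpha> = reflect \<gamma> (reflect \<alpha> (reflect \<gamma> \<beta>))"
      using assms by (simp add: reflect_def[of \<alpha>] reflect_diff reflect_scale reflect_reflect)
    then show ?thesis using that assms by (simp add: reflect_in)
  qed
  ultimately show ?thesis
    using coroot_unique[of "reflect \<gamma> \<alpha>" "\<lambda>x. cr \<alpha> (reflect \<gamma> x)" x] assms
    by (simp add: reflect_in reflect_reflect cr_self)
qed

text \<open>The form B(x, y), the sum of \<open>cr \<gamma> x * cr \<gamma> y\<close> over \<gamma>
  in \<open>R\<close>, is invariant under reflections. Invariance under the reflection in \<alpha>,
  which negates \<alpha>, is the classical relation 2 B(\<beta>, \<alpha>) = <\<beta>, \<alpha>^vee>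
  B(\<alpha>, \<alpha>).\<close>

lemma cr_sign_aux:
  assumes "\<alpha> \<in> R" "\<beta> \<in> R"
  shows "2 * (\<Sum>\<gamma>\<in>R. cr \<gamma> \<beta> * cr \<gamma> \<alpha>) = cr \<alpha> \<beta> * (\<Sum>\<gamma>\<in>R. (cr \<gamma> \<alpha>)\<^sup>2)"
proof -
  have "(\<Sum>\<gamma>\<in>R. cr \<gamma> \<beta> * cr \<gamma> \<alpha>) = (\<Sum>\<gamma>\<in>R. cr (reflect \<alpha> \<gamma>) \<beta> * cr (reflect \<alpha> \<gamma>) \<alpha>)"
    by (rule sum.reindex_bij_betw[OF reflect_bij[OF assms(1)], symmetric])
  also have "\<dots> = (\<Sum>\<gamma>\<in>R. cr \<gamma> (reflect \<alpha> \<beta>) * cr \<gamma> (reflect \<alpha> \<alpha>))"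
    by (intro sum.cong) (auto simp: cr_reflect_left assms)
  also have "\<dots> = (\<Sum>\<gamma>\<in>R. cr \<alpha> \<beta> * (cr \<gamma> \<alpha>)\<^sup>2 - cr \<gamma> \<beta> * cr \<gamma> \<alpha>)"
    by (intro sum.cong)
       (auto simp: reflect_self assms cr_neg reflect_def cr_simps algebra_simps power2_eq_square)
  finally show ?thesis by (simp add: sum_subtractf sum_distrib_left)
qed

lemma sum_cr_squares_pos:
  assumes "\<alpha> \<in> R"
  shows "(\<Sum>\<gamma>\<in>R. (cr \<gamma> \<alpha>)\<^sup>2) > 0"
  by (rule sum_pos2[OF finR assms]) (auto simp: cr_self assms)

lemma cr_symm:
  assumes "\<alpha> \<in> R" "\<beta> \<in> R"
  shows "cr \<alpha> \<beta> * (\<Sum>\<gamma>\<in>R. (cr \<gamma> \<alpha>)\<^sup>2) = cr \<beta> \<alpha> * (\<Sum>\<gamma>\<in>R. (cr \<gamma> \<beta>)\<^sup>2)"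
  using cr_sign_aux[OF assms] cr_sign_aux[OF assms(2,1)] by (simp add: mult.commute)

text \<open>By \<open>cr_symm\<close> the two factors agree up to positive squared lengths, hence
  have the same sign.\<close>

lemma cr_mult_nonneg:
  assumes "\<alpha> \<in> R" "\<beta> \<in> R"
  shows "cr \<alpha> \<beta> * cr \<beta> \<alpha> \<ge> 0"
proof -
  define p q where "p = (\<Sum>\<gamma>\<in>R. (cr \<gamma> \<alpha>)\<^sup>2)" and "q = (\<Sum>\<gamma>\<in>R. (cr \<gamma> \<beta>)\<^sup>2)"
  have pq: "p > 0" "q > 0" and eq: "cr \<alpha> \<beta> * p = cr \<beta> \<alpha> * q"
    unfolding p_def q_def using sum_cr_squares_pos assms cr_symm by simp_all
  have "(cr \<alpha> \<beta> * cr \<beta> \<alpha>) * q = (cr \<alpha> \<beta>)\<^sup>2 * p"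
    using eq by (simp add: power2_eq_square mult.assoc)
  then have "(cr \<alpha> \<beta> * cr \<beta> \<alpha>) * q \<ge> 0" using pq by simp
  then show ?thesis using pq by (simp add: zero_le_mult_iff)
qed

lemma cr_eq_0_commute:
  assumes "\<alpha> \<in> R" "\<beta> \<in> R" "cr \<alpha> \<beta> = 0"
  shows "cr \<beta> \<alpha> = 0"
  using cr_symm[OF assms(1,2)] sum_cr_squares_pos[OF assms(1)] sum_cr_squares_pos[OF assms(2)]
    assms(3) by simp

text \<open>The eigenvalue at \<gamma> of the operator sending v to twice the sum of
  \<open>cr \<alpha> v *\<^sub>R \<alpha>\<close> over the roots (see \<open>averaged_id\<close>).
  The factor \<open>cr \<gamma> \<alpha>\<close> appears when that sum is reindexed by the
  reflection in \<gamma>.\<close>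

definition casimir :: "'r \<Rightarrow> real" where
  "casimir \<gamma> = (\<Sum>\<alpha>\<in>R. cr \<alpha> \<gamma> * cr \<gamma> \<alpha>)"

lemma casimir_pos:
  assumes "\<gamma> \<in> R"
  shows "casimir \<gamma> > 0"
  unfolding casimir_def
  by (rule sum_pos2[OF finR assms]) (auto simp: cr_self assms cr_mult_nonneg)

lemma casimir_reflect:
  assumes "\<alpha> \<in> R" "\<gamma> \<in> R"
  shows "casimir (reflect \<alpha> \<gamma>) = casimir \<gamma>"
proof -
  have "casimir (reflect \<alpha> \<gamma>) = (\<Sum>\<beta>\<in>R. cr (reflect \<alpha> \<beta>) \<gamma> * cr \<gamma> (reflect \<alpha> \<beta>))"
    unfolding casimir_def by (intro sum.cong) (auto simp: assms cr_reflect_left)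
  also have "\<dots> = casimir \<gamma>"
    unfolding casimir_def by (rule sum.reindex_bij_betw[OF reflect_bij[OF assms(1)]])
  finally show ?thesis .
qed

text \<open>Evaluate the sum F at -\<gamma>, the reflection of \<gamma> in itself. Reindexing by
  that reflection and applying the hypothesis to \<open>f (reflect \<gamma> \<alpha>)\<close> turns
  -F(\<gamma>) into F(\<gamma>) minus \<open>casimir \<gamma> *\<^sub>R f \<gamma>\<close>. So
  \<open>f\<close> agrees on the roots with a linear map, up to the Casimir factor.\<close>

lemma averaged_linear:
  fixes f :: "'r \<Rightarrow> 'b::real_vector"
  assumes f: "\<And>\<alpha> \<beta>. \<alpha> \<in> R \<Longrightarrow> \<beta> \<in> R \<Longrightarrow> f (reflect \<alpha> \<beta>) = f \<beta> - cr \<alpha> \<beta> *\<^sub>R f \<alpha>"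
    and \<gamma>: "\<gamma> \<in> R"
  shows "2 *\<^sub>R (\<Sum>\<alpha>\<in>R. cr \<alpha> \<gamma> *\<^sub>R f \<alpha>) = casimir \<gamma> *\<^sub>R f \<gamma>"
proof -
  let ?F = "\<lambda>v. \<Sum>\<alpha>\<in>R. cr \<alpha> v *\<^sub>R f \<alpha>"
  have "- ?F \<gamma> = (\<Sum>\<alpha>\<in>R. cr \<alpha> (reflect \<gamma> \<gamma>) *\<^sub>R f \<alpha>)"
    by (simp add: reflect_self \<gamma> cr_neg sum_negf)
  also have "\<dots> = (\<Sum>\<alpha>\<in>R. cr (reflect \<gamma> \<alpha>) \<gamma> *\<^sub>R f \<alpha>)"
    by (intro sum.cong) (auto simp: cr_reflect_left \<gamma>)
  also have "\<dots> = (\<Sum>\<alpha>\<in>R. cr (reflect \<gamma> (reflect \<gamma> \<alpha>)) \<gamma> *\<^sub>R f (reflect \<gamma> \<alpha>))"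
    by (rule sum.reindex_bij_betw[OF reflect_bij[OF \<gamma>], symmetric])
  also have "\<dots> = (\<Sum>\<alpha>\<in>R. cr \<alpha> \<gamma> *\<^sub>R f \<alpha> - (cr \<alpha> \<gamma> * cr \<gamma> \<alpha>) *\<^sub>R f \<gamma>)"
    by (intro sum.cong) (auto simp: reflect_reflect \<gamma> f algebra_simps)
  also have "\<dots> = ?F \<gamma> - casimir \<gamma> *\<^sub>R f \<gamma>"
    by (simp add: sum_subtractf casimir_def scaleR_sum_left)
  finally show ?thesis by (simp add: scaleR_2 algebra_simps)
qed

lemma linear_averaged:
  fixes f :: "'r \<Rightarrow> 'b::real_vector"
  shows "linear (\<lambda>v. \<Sum>\<alpha>\<in>R. cr \<alpha> v *\<^sub>R f \<alpha>)"
  by (intro linear_compose_sum ballI linearI) (simp_all add: cr_add cr_scale scaleR_add_left)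

lemma averaged_id:
  assumes "\<gamma> \<in> R"
  shows "2 *\<^sub>R (\<Sum>\<alpha>\<in>R. cr \<alpha> \<gamma> *\<^sub>R \<alpha>) = casimir \<gamma> *\<^sub>R \<gamma>"
  by (rule averaged_linear[where f = "\<lambda>x. x", OF _ assms]) (auto simp: reflect_def)

text \<open>The linear operator E of which \<open>casimir\<close> lists the eigenvalues is applied
  to \<open>reflect \<alpha> \<beta>\<close>, a root with the same Casimir value as \<beta>.
  Comparing the coefficients of \<alpha> in the two expressions for the result gives the
  claim.\<close>

lemma casimir_eq:
  assumes \<alpha>: "\<alpha> \<in> R" and \<beta>: "\<beta> \<in> R" and ne: "cr \<alpha> \<beta> \<noteq> 0"
  shows "casimir \<alpha> = casimir \<beta>"
proof -
  let ?E = "\<lambda>v. 2 *\<^sub>R (\<Sum>\<gamma>\<in>R. cr \<gamma> v *\<^sub>R \<gamma>)"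
  have "casimir \<beta> *\<^sub>R reflect \<alpha> \<beta> = ?E (reflect \<alpha> \<beta>)"
    using averaged_id[OF reflect_in[OF \<alpha> \<beta>]] by (simp add: casimir_reflect \<alpha> \<beta>)
  also have "(\<Sum>\<gamma>\<in>R. cr \<gamma> (reflect \<alpha> \<beta>) *\<^sub>R \<gamma>)
      = (\<Sum>\<gamma>\<in>R. cr \<gamma> \<beta> *\<^sub>R \<gamma> - cr \<alpha> \<beta> *\<^sub>R (cr \<gamma> \<alpha> *\<^sub>R \<gamma>))"
    by (intro sum.cong) (auto simp: reflect_def cr_simps algebra_simps)
  also have "2 *\<^sub>R \<dots> = ?E \<beta> - cr \<alpha> \<beta> *\<^sub>R ?E \<alpha>"
    unfolding sum_subtractf scaleR_sum_right[symmetric] scaleR_diff_right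
    by (simp only: scaleR_left_commute)
  also have "\<dots> = casimir \<beta> *\<^sub>R \<beta> - cr \<alpha> \<beta> *\<^sub>R casimir \<alpha> *\<^sub>R \<alpha>"
    by (simp only: averaged_id \<alpha> \<beta>)
  finally have "(cr \<alpha> \<beta> * casimir \<beta>) *\<^sub>R \<alpha> = (cr \<alpha> \<beta> * casimir \<alpha>) *\<^sub>R \<alpha>"
    by (simp add: reflect_def scaleR_diff_right mult.commute)
  moreover have "\<alpha> \<noteq> 0" using \<alpha> zero_notin by metis
  ultimately show ?thesis using ne by simp
qed

end

section \<open>Irreducibility as connectedness of the non-orthogonality relation\<close>

locale irr_root_sys = root_sys R cr
  for R :: "'r::real_vector set" and cr :: "'r \<Rightarrow> 'r \<Rightarrow> real" +
  assumes R_nonempty: "R \<noteq> {}"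
    and irr: "\<not> (\<exists>V1 V2. subspace V1 \<and> subspace V2 \<and> V1 \<noteq> {0} \<and> V2 \<noteq> {0} \<and> V1 \<inter> V2 = {0} \<and>
            {x + y | x y. x \<in> V1 \<and> y \<in> V2} = span R \<and> R \<subseteq> V1 \<union> V2)"
begin

definition link :: "('r \<times> 'r) set" where
  "link = {(\<alpha>, \<beta>). \<alpha> \<in> R \<and> \<beta> \<in> R \<and> cr \<alpha> \<beta> \<noteq> 0}"

lemma casimir_link:
  assumes "(\<alpha>, \<beta>) \<in> link\<^sup>*"
  shows "casimir \<alpha> = casimir \<beta>"
  using assms by (induction rule: rtrancl_induct) (auto simp: link_def casimir_eq)

text \<open>The roots reachable from \<alpha> and the remaining ones are mutually orthogonal, so
  their spans would decompose the system. The spans meet only in 0: a common vector is killed by all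
  coroots, hence by the averaging operator, which on the span of \<open>C\<close> is multiplication
  by the positive number \<open>casimir \<alpha>\<close>.\<close>

lemma link_connected:
  assumes \<alpha>: "\<alpha> \<in> R" and \<beta>: "\<beta> \<in> R"
  shows "(\<alpha>, \<beta>) \<in> link\<^sup>*"
proof (rule ccontr)
  assume nlink: "(\<alpha>, \<beta>) \<notin> link\<^sup>*"
  define C where "C = {\<gamma> \<in> R. (\<alpha>, \<gamma>) \<in> link\<^sup>*}"
  define D where "D = R - C"
  have CR: "C \<subseteq> R" and DR: "D \<subseteq> R" and RCD: "R = C \<union> D" by (auto simp: C_def D_def)
  have mem: "\<alpha> \<in> C" "\<beta> \<in> D" using \<alpha> \<beta> nlink by (auto simp: C_def D_def)
  have CD: "cr \<gamma> \<delta> = 0" if "\<gamma> \<in> C" "\<delta> \<in> D" for \<gamma> \<delta>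
  proof (rule ccontr)
    assume "cr \<gamma> \<delta> \<noteq> 0"
    then have "(\<gamma>, \<delta>) \<in> link" "(\<alpha>, \<gamma>) \<in> link\<^sup>*"
      using that by (auto simp: link_def C_def D_def)
    then have "(\<alpha>, \<delta>) \<in> link\<^sup>*" by (rule rtrancl_into_rtrancl[rotated])
    then have "\<delta> \<in> C" using that by (simp add: C_def D_def)
    then show False using that by (simp add: D_def)
  qed
  have DC: "cr \<delta> \<gamma> = 0" if "\<gamma> \<in> C" "\<delta> \<in> D" for \<gamma> \<delta>
    by (rule cr_eq_0_commute[OF _ _ CD[OF that]]) (use that CR DR in auto)
  have vanish: "cr \<gamma> x = 0" if "\<gamma> \<in> R" "x \<in> span S" "\<And>\<delta>. \<delta> \<in> S \<Longrightarrow> cr \<gamma> \<delta> = 0" for \<gamma> x S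
    by (rule linear_eq_0_on_span[OF lin[OF that(1)] that(3,2)])
  have scalar: "2 *\<^sub>R (\<Sum>\<gamma>\<in>R. cr \<gamma> x *\<^sub>R \<gamma>) = casimir \<alpha> *\<^sub>R x" if "x \<in> span C" for x
  proof (rule linear_eq_on_span[OF _ _ _ that])
    show "linear (\<lambda>x. 2 *\<^sub>R (\<Sum>\<gamma>\<in>R. cr \<gamma> x *\<^sub>R \<gamma>))"
      by (intro linear_compose_scale_right linear_averaged)
    show "linear (\<lambda>x. casimir \<alpha> *\<^sub>R x)" by (intro linearI) (auto simp: algebra_simps)
    show "2 *\<^sub>R (\<Sum>\<gamma>\<in>R. cr \<gamma> x *\<^sub>R \<gamma>) = casimir \<alpha> *\<^sub>R x" if "x \<in> C" for x
      using that averaged_id[of x] casimir_link[of \<alpha> x] by (auto simp: C_def)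
  qed
  have "x = 0" if x: "x \<in> span C" "x \<in> span D" for x
  proof -
    have "cr \<gamma> x = 0" if "\<gamma> \<in> R" for \<gamma>
    proof (cases "\<gamma> \<in> C")
      case True
      then show ?thesis using vanish[OF that x(2)] CD by blast
    next
      case False
      then show ?thesis using vanish[OF that x(1)] DC that by (auto simp: D_def)
    qed
    then show ?thesis using scalar[OF x(1)] casimir_pos[OF \<alpha>] by simp
  qed
  then have "span C \<inter> span D = {0}" by (auto simp: span_zero)
  moreover have "span C \<noteq> {0}" "span D \<noteq> {0}"
    using span_base[OF mem(1)] span_base[OF mem(2)] \<alpha> \<beta> zero_notin
    by (metis singletonD)+
  moreover have "{x + y | x y. x \<in> span C \<and> y \<in> span D} = span R"
    unfolding RCD span_Un ..
  moreover have "R \<subseteq> span C \<union> span D"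
    unfolding RCD using span_superset[of C] span_superset[of D] by auto
  ultimately have "\<exists>V1 V2. subspace V1 \<and> subspace V2 \<and> V1 \<noteq> {0} \<and> V2 \<noteq> {0} \<and> V1 \<inter> V2 = {0} \<and>
            {x + y | x y. x \<in> V1 \<and> y \<in> V2} = span R \<and> R \<subseteq> V1 \<union> V2"
    by (intro exI[of _ "span C"] exI[of _ "span D"] conjI subspace_span)
  with irr show False ..
qed

lemma connected_induct:
  assumes "\<alpha> \<in> R" "\<beta> \<in> R" "P \<alpha>"
    and step: "\<And>\<gamma> \<delta>. \<gamma> \<in> R \<Longrightarrow> \<delta> \<in> R \<Longrightarrow> cr \<gamma> \<delta> \<noteq> 0 \<Longrightarrow> P \<gamma> \<Longrightarrow> P \<delta>"
  shows "P \<beta>"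
  using link_connected[OF assms(1,2)]
  by (induction rule: rtrancl_induct) (use assms(3) step in \<open>auto simp: link_def\<close>)

lemma casimir_const:
  assumes "\<alpha> \<in> R" "\<beta> \<in> R"
  shows "casimir \<alpha> = casimir \<beta>"
  by (rule casimir_link[OF link_connected[OF assms]])

text \<open>On the whole span the averaging operator is a positive scalar, while its value at x is
  assembled from the numbers \<open>cr \<alpha> x\<close>.\<close>

lemma cr_nondegenerate:
  assumes x: "x \<in> span R" and zero: "\<And>\<alpha>. \<alpha> \<in> R \<Longrightarrow> cr \<alpha> x = 0"
  shows "x = 0"
proof -
  obtain \<alpha> where \<alpha>: "\<alpha> \<in> R" using R_nonempty by blast
  have "2 *\<^sub>R (\<Sum>\<gamma>\<in>R. cr \<gamma> x *\<^sub>R \<gamma>) = casimir \<alpha> *\<^sub>R x"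
  proof (rule linear_eq_on_span[OF _ _ _ x])
    show "linear (\<lambda>x. 2 *\<^sub>R (\<Sum>\<gamma>\<in>R. cr \<gamma> x *\<^sub>R \<gamma>))"
      by (intro linear_compose_scale_right linear_averaged)
    show "linear (\<lambda>x. casimir \<alpha> *\<^sub>R x)" by (intro linearI) (auto simp: algebra_simps)
    show "2 *\<^sub>R (\<Sum>\<gamma>\<in>R. cr \<gamma> x *\<^sub>R \<gamma>) = casimir \<alpha> *\<^sub>R x" if "x \<in> R" for x
      using that averaged_id[of x] casimir_const[OF \<alpha> that] by auto
  qed
  then show ?thesis using zero casimir_pos[OF \<alpha>] by simp
qed

end

section \<open>Graphs stable under reflections\<close>

text \<open>The two real numbers stand for the degrees of a root space and of its image, embedded in
  the reals. \<open>T_fun\<close> compares points over one root only; that additive relations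
  between different roots are respected as well is the content of
  \<open>graph_functional\<close>.\<close>

locale graph_over_roots = irr_root_sys +
  fixes T :: "('a \<times> real \<times> real) set"
  assumes T_root: "(\<alpha>, a, b) \<in> T \<Longrightarrow> \<alpha> \<in> R"
    and T_refl: "(\<alpha>, a, b) \<in> T \<Longrightarrow> (\<beta>, x, y) \<in> T \<Longrightarrow>
       (reflect \<alpha> \<beta>, x - cr \<alpha> \<beta> * a, y - cr \<alpha> \<beta> * b) \<in> T"
    and T_zero: "\<alpha> \<in> R \<Longrightarrow> \<exists>b. (\<alpha>, 0, b) \<in> T"
    and T_fun: "(\<alpha>, a, b) \<in> T \<Longrightarrow> (\<alpha>, a, b') \<in> T \<Longrightarrow> b = b'"
begin

definition degree_zero :: "'a \<Rightarrow> real" where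
  "degree_zero \<alpha> = (THE b. (\<alpha>, 0, b) \<in> T)"

lemma degree_zero_T: "\<alpha> \<in> R \<Longrightarrow> (\<alpha>, 0, degree_zero \<alpha>) \<in> T"
  unfolding degree_zero_def using T_zero T_fun by (metis theI)

lemma degree_zero_unique: "(\<alpha>, 0, b) \<in> T \<Longrightarrow> degree_zero \<alpha> = b"
  using T_fun T_root degree_zero_T by blast

lemma degree_zero_reflect: "\<alpha> \<in> R \<Longrightarrow> \<beta> \<in> R \<Longrightarrow> degree_zero (reflect \<alpha> \<beta>) = degree_zero \<beta> - cr \<alpha> \<beta> *\<^sub>R degree_zero \<alpha>"
  using T_refl[OF degree_zero_T degree_zero_T] by (auto intro: degree_zero_unique)

text \<open>Both signs are required so that the translations of the fibre over \<beta> form a group,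
  although \<open>T\<close> is merely a set.\<close>

definition shifts :: "'a \<Rightarrow> (real \<times> real) set" where
  "shifts \<beta> = {(u, v). \<forall>x y. (\<beta>, x, y) \<in> T \<longrightarrow> (\<beta>, x + u, y + v) \<in> T \<and> (\<beta>, x - u, y - v) \<in> T}"

lemma trans_translate: "(u, v) \<in> shifts \<beta> \<Longrightarrow> (\<beta>, x, y) \<in> T \<Longrightarrow> (\<beta>, x + u, y + v) \<in> T"
  by (simp add: shifts_def)

lemma trans_zero: "(0, 0) \<in> shifts \<beta>"
  by (simp add: shifts_def)

lemma trans_uminus: "(u, v) \<in> shifts \<beta> \<Longrightarrow> (- u, - v) \<in> shifts \<beta>"
  by (auto simp: shifts_def)

lemma trans_add:
  assumes "(u, v) \<in> shifts \<beta>" "(u', v') \<in> shifts \<beta>"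
  shows "(u + u', v + v') \<in> shifts \<beta>"
proof -
  have "(\<beta>, x + (u + u'), y + (v + v')) \<in> T" "(\<beta>, x - (u + u'), y - (v + v')) \<in> T"
    if "(\<beta>, x, y) \<in> T" for x y
  proof -
    have "(\<beta>, x + u, y + v) \<in> T" "(\<beta>, x - u, y - v) \<in> T"
      using assms(1) that by (auto simp: shifts_def)
    then have "(\<beta>, x + u + u', y + v + v') \<in> T" "(\<beta>, x - u - u', y - v - v') \<in> T"
      using assms(2) by (auto simp: shifts_def)
    then show "(\<beta>, x + (u + u'), y + (v + v')) \<in> T" "(\<beta>, x - (u + u'), y - (v + v')) \<in> T"
      by (simp_all add: add.assoc diff_diff_eq)
  qed
  then show ?thesis by (auto simp: shifts_def)
qed

lemma trans_of_nat: "(u, v) \<in> shifts \<beta> \<Longrightarrow> (real n * u, real n * v) \<in> shifts \<beta>"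
  by (induction n) (auto simp: trans_zero trans_add distrib_right)

lemma trans_of_Ints:
  assumes "(u, v) \<in> shifts \<beta>" "r \<in> \<int>"
  shows "(r * u, r * v) \<in> shifts \<beta>"
proof -
  obtain n where n: "r = real_of_int n" using assms(2) by (auto elim: Ints_cases)
  show ?thesis
  proof (cases "n \<ge> 0")
    case True
    then show ?thesis using trans_of_nat[OF assms(1), of "nat n"] n by simp
  next
    case False
    then show ?thesis using trans_uminus[OF trans_of_nat[OF assms(1), of "nat (- n)"]] n by simp
  qed
qed

text \<open>Such a translation moves the degree-zero point within the same source degree, where the
  fibre has only one point.\<close>

lemma trans_fun:
  assumes "(0, v) \<in> shifts \<beta>" "\<beta> \<in> R"
  shows "v = 0"
proof -
  have "(\<beta>, 0 + 0, degree_zero \<beta> + v) \<in> T" by (rule trans_translate[OF assms(1) degree_zero_T[OF assms(2)]])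
  then have "degree_zero \<beta> = degree_zero \<beta> + v" by (intro degree_zero_unique) simp
  then show ?thesis by simp
qed

text \<open>The composite of the reflections in \<open>(\<gamma>, a, b)\<close> and \<open>(\<gamma>, 0, degree_zero \<gamma>)\<close> is a translation.\<close>

lemma trans_link:
  assumes T: "(\<gamma>, a, b) \<in> T" and \<beta>: "\<beta> \<in> R"
  shows "(cr \<gamma> \<beta> * a, cr \<gamma> \<beta> * (b - degree_zero \<gamma>)) \<in> shifts \<beta>"
proof -
  have \<gamma>: "\<gamma> \<in> R" using T_root[OF T] .
  have cr: "cr \<gamma> (reflect \<gamma> \<beta>) = - cr \<gamma> \<beta>" using \<gamma> by (simp add: reflect_def cr_simps)
  have "(\<beta>, x + cr \<gamma> \<beta> * a, y + cr \<gamma> \<beta> * (b - degree_zero \<gamma>)) \<in> T"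
    "(\<beta>, x - cr \<gamma> \<beta> * a, y - cr \<gamma> \<beta> * (b - degree_zero \<gamma>)) \<in> T" if xy: "(\<beta>, x, y) \<in> T" for x y
    using T_refl[OF T T_refl[OF degree_zero_T[OF \<gamma>] xy]] T_refl[OF degree_zero_T[OF \<gamma>] T_refl[OF T xy]]
    by (simp_all add: reflect_reflect \<gamma> cr algebra_simps)
  then show ?thesis by (auto simp: shifts_def)
qed

text \<open>Brings the deviations from the degree-zero points of all roots into one group, the
  translations over the fixed root \<alpha>. The multiplier m is 2 at \<alpha> itself and picks up a
  nonzero factor \<open>cr \<delta> \<beta>\<close> at each link on the way to \<gamma>.\<close>

lemma trans_common:
  assumes \<alpha>: "\<alpha> \<in> R" and T: "(\<gamma>, a, b) \<in> T"
  shows "\<exists>m\<in>\<int>. m \<noteq> 0 \<and> (m * a, m * (b - degree_zero \<gamma>)) \<in> shifts \<alpha>"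
proof -
  let ?P = "\<lambda>\<gamma>. \<forall>a b. (\<gamma>, a, b) \<in> T \<longrightarrow> (\<exists>m\<in>\<int>. m \<noteq> 0 \<and> (m * a, m * (b - degree_zero \<gamma>)) \<in> shifts \<alpha>)"
  have "?P \<gamma>"
  proof (rule connected_induct[of \<alpha> \<gamma> ?P])
    show "\<gamma> \<in> R" using T_root[OF T] .
    show "\<forall>a b. (\<alpha>, a, b) \<in> T \<longrightarrow> (\<exists>m\<in>\<int>. m \<noteq> 0 \<and> (m * a, m * (b - degree_zero \<alpha>)) \<in> shifts \<alpha>)"
      using trans_link[OF _ \<alpha>] cr_self[OF \<alpha>]
      by (metis Ints_numeral zero_neq_numeral)
    fix \<beta> \<delta>
    assume \<beta>: "\<beta> \<in> R" and \<delta>: "\<delta> \<in> R" and ne: "cr \<beta> \<delta> \<noteq> 0"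
      and IH: "\<forall>a b. (\<beta>, a, b) \<in> T \<longrightarrow> (\<exists>m\<in>\<int>. m \<noteq> 0 \<and> (m * a, m * (b - degree_zero \<beta>)) \<in> shifts \<alpha>)"
    have ne': "cr \<delta> \<beta> \<noteq> 0" using cr_eq_0_commute[OF \<delta> \<beta>] ne by blast
    show "\<forall>a b. (\<delta>, a, b) \<in> T \<longrightarrow> (\<exists>m\<in>\<int>. m \<noteq> 0 \<and> (m * a, m * (b - degree_zero \<delta>)) \<in> shifts \<alpha>)"
    proof (intro allI impI)
      fix a b assume ab: "(\<delta>, a, b) \<in> T"
      \<comment> \<open>A new point over \<beta>, obtained by translating the degree-zero point; its
        deviation is \<open>cr \<delta> \<beta>\<close> times the one over \<delta>, so the
        induction hypothesis applies to it.\<close>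
      have "(\<beta>, 0 + cr \<delta> \<beta> * a, degree_zero \<beta> + cr \<delta> \<beta> * (b - degree_zero \<delta>)) \<in> T"
        by (rule trans_translate[OF trans_link[OF ab \<beta>] degree_zero_T[OF \<beta>]])
      with IH obtain m where m: "m \<in> \<int>" "m \<noteq> 0"
        "(m * (0 + cr \<delta> \<beta> * a), m * (degree_zero \<beta> + cr \<delta> \<beta> * (b - degree_zero \<delta>) - degree_zero \<beta>)) \<in> shifts \<alpha>"
        by blast
      show "\<exists>m\<in>\<int>. m \<noteq> 0 \<and> (m * a, m * (b - degree_zero \<delta>)) \<in> shifts \<alpha>"
        using m ne' cr_Ints[OF \<delta> \<beta>]
        by (intro bexI[of _ "m * cr \<delta> \<beta>"]) (auto simp: mult.assoc)
    qed
  qed (rule \<alpha>)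
  then show ?thesis using T by blast
qed

lemma casimir_Ints: "\<alpha> \<in> R \<Longrightarrow> casimir \<alpha> \<in> \<int>"
  unfolding casimir_def by (intro Ints_sum Ints_mult cr_Ints)

text \<open>Up to the factor \<open>?c\<close>, the map \<open>2 * ?F\<close> is the linear
  extension of \<open>degree_zero\<close>. For every element (v, x, y) of the subgroup, x together
  with the deviation of y from this linear prediction is, up to an integer, a translation over
  \<alpha>. At (0, 0, y) this is a translation of source degree 0, so y vanishes.\<close>

theorem graph_functional:
  assumes "(0, 0, y) \<in> gen_subgroup T"
  shows "y = 0"
proof -
  obtain \<alpha> where \<alpha>: "\<alpha> \<in> R" using R_nonempty by blast
  let ?c = "casimir \<alpha>"
  let ?F = "\<lambda>v. \<Sum>\<gamma>\<in>R. cr \<gamma> v *\<^sub>R degree_zero \<gamma>"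
  \<comment> \<open>Everything is multiplied by \<open>?c\<close> instead of divided by it, since
    translations are closed under integer multiples only; \<open>N\<close> varies with the element,
    and sums use the product of two such integers.\<close>
  define P where "P = (\<lambda>(v, x, y). \<exists>N\<in>\<int>. N \<noteq> 0 \<and> (N * (?c * x), N * (?c * y - 2 * ?F v)) \<in> shifts \<alpha>)"
  have "P t" if "t \<in> gen_subgroup T" for t
    using that
  proof (induction rule: gen_subgroup_induct)
    case (base t)
    obtain \<gamma> a b where t: "t = (\<gamma>, a, b)" by (cases t) auto
    have T: "(\<gamma>, a, b) \<in> T" using base t by simp
    obtain m where m: "m \<in> \<int>" "m \<noteq> 0" "(m * a, m * (b - degree_zero \<gamma>)) \<in> shifts \<alpha>"
      using trans_common[OF \<alpha> T] by blast
    have \<gamma>: "\<gamma> \<in> R" using T_root[OF T] .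
    have "2 * ?F \<gamma> = ?c * degree_zero \<gamma>"
      using averaged_linear[of degree_zero \<gamma>, OF degree_zero_reflect \<gamma>] casimir_const[OF \<alpha> \<gamma>] by simp
    then have "(m * (?c * a), m * (?c * b - 2 * ?F \<gamma>)) \<in> shifts \<alpha>"
      using trans_of_Ints[OF m(3) casimir_Ints[OF \<alpha>]] by (simp add: algebra_simps)
    then show ?case using m unfolding P_def t by blast
  next
    case zero
    show ?case unfolding P_def zero_prod_def
      by (auto simp: cr_0 trans_zero intro!: bexI[of _ 1])
  next
    case (add s t)
    obtain v x y w x' y' where st: "s = (v, x, y)" "t = (w, x', y')" by (cases s, cases t) auto
    obtain M N where M: "M \<in> \<int>" "M \<noteq> 0" "(M * (?c * x), M * (?c * y - 2 * ?F v)) \<in> shifts \<alpha>"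
      and N: "N \<in> \<int>" "N \<noteq> 0" "(N * (?c * x'), N * (?c * y' - 2 * ?F w)) \<in> shifts \<alpha>"
      using add by (auto simp: P_def st)
    have "(N * (M * (?c * x)) + M * (N * (?c * x')),
      N * (M * (?c * y - 2 * ?F v)) + M * (N * (?c * y' - 2 * ?F w))) \<in> shifts \<alpha>"
      by (intro trans_add trans_of_Ints M N)
    moreover have "?F (v + w) = ?F v + ?F w"
      by (rule linear_add[OF linear_averaged])
    ultimately have "((M * N) * (?c * (x + x')), (M * N) * (?c * (y + y') - 2 * ?F (v + w))) \<in> shifts \<alpha>"
      by (simp add: algebra_simps)
    then show ?case using M N unfolding P_def st
      by (auto intro!: bexI[of _ "M * N"])
  next
    case (uminus t)
    obtain v x y where t: "t = (v, x, y)" by (cases t) auto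
    obtain M where M: "M \<in> \<int>" "M \<noteq> 0" "(M * (?c * x), M * (?c * y - 2 * ?F v)) \<in> shifts \<alpha>"
      using uminus by (auto simp: P_def t)
    have "?F (- v) = - ?F v"
      by (rule linear_neg[OF linear_averaged])
    then have "(M * (?c * - x), M * (?c * (- y) - 2 * ?F (- v))) \<in> shifts \<alpha>"
      using trans_uminus[OF M(3)] by (simp add: algebra_simps)
    then show ?case using M unfolding P_def t
      by (auto intro!: bexI[of _ M])
  qed
  from this[OF assms] obtain N where N: "N \<in> \<int>" "N \<noteq> 0"
    "(N * (?c * 0), N * (?c * y - 2 * ?F 0)) \<in> shifts \<alpha>"
    unfolding P_def by blast
  have "?F 0 = 0" by (intro sum.neutral) (auto simp: cr_0)
  then have "(0, N * (?c * y)) \<in> shifts \<alpha>" using N(3) by simp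
  then have "N * (?c * y) = 0" using trans_fun \<alpha> by blast
  then show ?thesis using N casimir_pos[OF \<alpha>] by simp
qed

end


section \<open>Free abelian groups\<close>

lemma zsc_real: "zsc n (x::real) = of_int n * x"
  by (simp add: zsc_def)

lemma additive_sum:
  fixes p :: "'a::ab_group_add \<Rightarrow> 'b::ab_group_add"
  assumes "\<And>x y. p (x + y) = p x + p y"
  shows "p (\<Sum>i\<in>A. f i) = (\<Sum>i\<in>A. p (f i))"
proof -
  have "p 0 = 0" using assms[of 0 0] by simp
  then show ?thesis by (induction A rule: infinite_finite_induct) (auto simp: assms)
qed

lemma zsc_add: "zsc (m + n) x = zsc m x + zsc n x"
proof -
  have nat: "(\<Sum>i<k + l. x) = (\<Sum>i<k. x) + (\<Sum>i<l. x)" for k l :: nat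
    by (induction l) (auto simp: algebra_simps)
  have diff: "zsc (int a - int b) x = (\<Sum>i<a. x) - (\<Sum>i<b. x)" for a b
  proof (cases "b \<le> a")
    case True
    then obtain d where "a = b + d" using le_Suc_ex by blast
    then show ?thesis by (simp add: zsc_def nat)
  next
    case False
    then obtain d where "b = a + Suc d" using less_imp_Suc_add[of a b] by auto
    then show ?thesis using nat[of a "Suc d"] by (simp add: zsc_def nat_add_distrib)
  qed
  obtain a b c d where "m = int a - int b" "n = int c - int d" by (meson int_diff_cases)
  moreover from this have "m + n = int (a + c) - int (b + d)" by simp
  ultimately show ?thesis by (simp only: diff nat) simp
qed

text \<open>The countably many nonzero integer vectors give countably many polynomials, so some real
  number is a root of none of them; evaluating there embeds the group into the reals.\<close>

lemma fg_free_abelian_embeds_real: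
  assumes "fg_free_abelian TYPE('l::ab_group_add)"
  obtains p :: "'l::ab_group_add \<Rightarrow> real" where "inj p" "\<And>x y. p (x + y) = p x + p y"
proof -
  obtain n :: nat and b :: "nat \<Rightarrow> 'l" where
    b: "\<forall>x. \<exists>!c::nat \<Rightarrow> int. (\<forall>i\<ge>n. c i = 0) \<and> x = (\<Sum>i<n. zsc (c i) (b i))"
    using assms unfolding fg_free_abelian_def by blast
  define co where "co x = (THE c::nat \<Rightarrow> int. (\<forall>i\<ge>n. c i = 0) \<and> x = (\<Sum>i<n. zsc (c i) (b i)))" for x
  have co: "\<forall>i\<ge>n. co x i = 0" "x = (\<Sum>i<n. zsc (co x i) (b i))" for x
    using theI'[OF b[rule_format, of x]] unfolding co_def by blast+
  have co_eqI: "c = co x" if "\<forall>i\<ge>n. c i = 0" "x = (\<Sum>i<n. zsc (c i) (b i))" for c x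
    using b[rule_format, of x] that co by blast
  have co_add: "co (x + y) i = co x i + co y i" for x y i
  proof -
    have "x + y = (\<Sum>i<n. zsc (co x i) (b i)) + (\<Sum>i<n. zsc (co y i) (b i))"
      using co(2) by metis
    also have "\<dots> = (\<Sum>i<n. zsc (co x i + co y i) (b i))"
      by (simp add: zsc_add sum.distrib)
    finally have "(\<lambda>i. co x i + co y i) = co (x + y)"
      by (intro co_eqI) (use co(1) in auto)
    then show ?thesis by metis
  qed
  define pol :: "'l \<Rightarrow> real poly" where "pol x = (\<Sum>i<n. monom (of_int (co x i)) i)" for x
  have coeff_pol: "coeff (pol x) i = of_int (co x i)" for x i
    using co(1)[of x] by (auto simp: pol_def coeff_sum if_distrib sum.delta cong: if_cong)
  have pol_add: "pol (x + y) = pol x + pol y" for x y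
    by (rule poly_eqI) (simp add: coeff_pol co_add)
  have pol_0: "x = 0" if "pol x = 0" for x
  proof -
    have "co x i = 0" for i using that coeff_pol[of x i] by simp
    then have "x = (\<Sum>i<n. zsc 0 (b i))" using co(2)[of x] by simp
    then show ?thesis by (simp add: zsc_def)
  qed
  have inj_map: "inj (\<lambda>x. map (co x) [0..<n])"
  proof (rule injI)
    fix x y assume "map (co x) [0..<n] = map (co y) [0..<n]"
    then have "co x i = co y i" if "i < n" for i using that by (auto simp: list_eq_iff_nth_eq)
    then show "x = y" using co(2)[of x] co(2)[of y] by simp
  qed
  have "countable (UNIV :: 'l set)"
    by (rule countable_image_inj_on[OF countableI_type inj_map])
  then have "countable (\<Union>x\<in>{x. pol x \<noteq> 0}. {r. poly (pol x) r = 0})"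
    by (intro countable_UN) (auto intro: countable_subset poly_roots_finite countable_finite)
  then have "(\<Union>x\<in>{x. pol x \<noteq> 0}. {r. poly (pol x) r = 0}) \<noteq> UNIV"
    using uncountable_UNIV_real by metis
  then obtain r where r: "\<And>x. pol x \<noteq> 0 \<Longrightarrow> poly (pol x) r \<noteq> 0"
    by auto
  show thesis
  proof (rule that[of "\<lambda>x. poly (pol x) r"])
    show add: "poly (pol (x + y)) r = poly (pol x) r + poly (pol y) r" for x y
      by (simp add: pol_add)
    show "inj (\<lambda>x. poly (pol x) r)"
    proof (rule injI)
      fix x y assume "poly (pol x) r = poly (pol y) r"
      then have "poly (pol (x - y)) r = 0" using add[of "x - y" y] by simp
      then have "x - y = 0" using r pol_0 by blast
      then show "x = y" by simp
    qed
  qed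
qed

lemma zsc_zero [simp]: "zsc 0 x = 0"
  by (simp add: zsc_def)

lemma zsc_one [simp]: "zsc 1 x = x"
  by (simp add: zsc_def)

lemma zsc_uminus_left: "zsc (- n) x = - zsc n x"
  using zsc_add[of n "- n" x] by (simp add: eq_neg_iff_add_eq_0 add.commute)

lemma additive_zsc:
  fixes p :: "'a::ab_group_add \<Rightarrow> 'b::ab_group_add"
  assumes "\<And>x y. p (x + y) = p x + p y"
  shows "p (zsc n x) = zsc n (p x)"
proof -
  have "p 0 = 0" using assms[of 0 0] by simp
  then have "p (- x) = - p x" for x using assms[of x "- x"] by (simp add: eq_neg_iff_add_eq_0 add.commute)
  then show ?thesis unfolding zsc_def by (simp add: additive_sum[of p, OF assms])
qed

lemma zsc_uminus_right: "zsc n (- x) = - zsc n x"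
  by (rule additive_zsc[of uminus, symmetric]) simp

lemma zsc_real_vector: "zsc n (x::'a::real_vector) = real_of_int n *\<^sub>R x"
  by (simp add: zsc_def scaleR_conv_of_real sum_constant_scaleR)

section \<open>Actions of a three-dimensional simple Lie algebra\<close>

locale sl2_action = module sc
  for sc :: "'k::field_char_0 \<Rightarrow> 'v::ab_group_add \<Rightarrow> 'v" +
  fixes E F H :: "'v \<Rightarrow> 'v"
  assumes E_add: "E (x + y) = E x + E y" and E_sc: "E (sc a x) = sc a (E x)"
    and F_add: "F (x + y) = F x + F y" and F_sc: "F (sc a x) = sc a (F x)"
    and EF: "H x = E (F x) - F (E x)"
    and HE: "H (E x) = E (H x) + sc 2 (E x)"
    and HF: "H (F x) = F (H x) - sc 2 (F x)"
begin

lemma E_0: "E 0 = 0" using E_add[of 0 0] by simp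
lemma F_0: "F 0 = 0" using F_add[of 0 0] by simp
lemma E_diff: "E (x - y) = E x - E y" using E_add[of "x - y" y] by simp

lemma H_Epow:
  assumes "H x = sc w x"
  shows "H ((E ^^ k) x) = sc (w + 2 * of_nat k) ((E ^^ k) x)"
  by (induction k) (auto simp: assms HE E_sc algebra_simps simp flip: scale_left_distrib)

text \<open>The commutation rule F E^(k+1) = E^(k+1) F - (k+1) E^k (H + k), evaluated on a vector of
  weight w.\<close>

lemma F_Epow:
  assumes "H x = sc w x"
  shows "F ((E ^^ Suc k) x) = (E ^^ Suc k) (F x) - sc (of_nat (Suc k) * (w + of_nat k)) ((E ^^ k) x)"
proof (induction k)
  case 0
  then show ?case using EF[of x] assms by (simp add: algebra_simps)
next
  case (Suc k)
  let ?y = "(E ^^ Suc k) x"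
  have "F (E ?y) = E (F ?y) - H ?y" using EF[of ?y] by simp
  also have "\<dots> = (E ^^ Suc (Suc k)) (F x)
      - (sc (of_nat (Suc k) * (w + of_nat k)) ?y + sc (w + 2 * of_nat (Suc k)) ?y)"
    unfolding Suc.IH E_diff E_sc H_Epow[OF assms] by simp
  also have "sc (of_nat (Suc k) * (w + of_nat k)) ?y + sc (w + 2 * of_nat (Suc k)) ?y
      = sc (of_nat (Suc (Suc k)) * (w + of_nat (Suc k))) ?y"
    unfolding scale_left_distrib[symmetric] by (simp add: algebra_simps)
  finally show ?case by simp
qed

lemma Epow_0: "(E ^^ k) 0 = 0"
  by (induction k) (auto simp: E_0)

text \<open>Induction on the nilpotency order of \<open>F\<close> at \<open>x\<close>: the vector \<open>F x\<close> satisfies the hypotheses with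
  \<open>n + 2\<close>, so it vanishes and \<open>x\<close> is a lowest weight vector.\<close>

lemma Epow_injective:
  assumes "(F ^^ m) x = 0" and "H x = sc (- of_nat n) x" and "(E ^^ n) x = 0"
  shows "x = 0"
  using assms
proof (induction m arbitrary: n x)
  case 0
  then show ?case by simp
next
  case (Suc m)
  note wt = Suc.prems(2)
  have E1: "(E ^^ Suc n) x = 0" "(E ^^ Suc (Suc n)) x = 0" using Suc.prems(3) E_0 by simp_all
  have "F x = 0"
  proof (rule Suc.IH)
    show "(F ^^ m) (F x) = 0" using Suc.prems(1) by (simp add: funpow_swap1)
    show "H (F x) = sc (- of_nat (Suc (Suc n))) (F x)"
      unfolding HF Suc.prems(2) F_sc scale_left_diff_distrib[symmetric] by (simp add: algebra_simps)
    show "(E ^^ Suc (Suc n)) (F x) = 0"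
      using F_Epow[OF Suc.prems(2), of "Suc n"] unfolding E1 F_0 by simp
  qed
  \<comment> \<open>With \<open>F x = 0\<close> the commutation rule gives F E^(k+1) x = (k+1)(n-k)
    E^k x. For k < n the coefficient is nonzero in characteristic 0, so the powers of
    \<open>E\<close> can be stripped off one at a time.\<close>
  have "(E ^^ k) x = 0 \<longrightarrow> x = 0" if "k \<le> n" for k
    using that
  proof (induction k)
    case (Suc k)
    have "(E ^^ k) x = 0" if "(E ^^ Suc k) x = 0"
    proof -
      have "sc (of_nat (Suc k) * (- of_nat n + of_nat k)) ((E ^^ k) x) = 0"
        using F_Epow[OF wt, of k, unfolded that \<open>F x = 0\<close> F_0 Epow_0] by simp
      moreover have "of_nat (Suc k) * (- of_nat n + of_nat k) \<noteq> (0::'k)"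
      proof -
        have "of_nat k \<noteq> (of_nat n :: 'k)" using Suc.prems(1) by simp
        then show ?thesis by (simp del: of_nat_Suc)
      qed
      ultimately show ?thesis
        by (metis (no_types, lifting) scale_one scale_scale left_inverse scale_zero_right)
    qed
    then show ?case using Suc by auto
  qed simp
  then show ?case using Suc.prems(3) by blast
qed

end


section \<open>Lie tori\<close>

locale torus =
  fixes sc :: "'k::field_char_0 \<Rightarrow> 'v::ab_group_add \<Rightarrow> 'v"
    and br :: "'v \<Rightarrow> 'v \<Rightarrow> 'v"
    and \<Delta> :: "'r::real_vector set"
    and Lg :: "'r \<Rightarrow> 'l::ab_group_add \<Rightarrow> 'v set"
  assumes lie_torus: "lie_torus sc br \<Delta> Lg"
begin

lemma fin_root_system: "finite_root_system \<Delta>"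
  and fg_free: "fg_free_abelian TYPE('l)"
  and graded: "graded_lie_algebra sc br (zspan \<Delta>) Lg"
  and supp_eq: "{\<alpha>. Lroot Lg \<alpha> \<noteq> {0}} = \<Delta>"
  and ind_degree_0: "\<forall>\<alpha>\<in>ind_roots \<Delta>. Lg \<alpha> 0 \<noteq> {0}"
  and generated: "gen_subalg sc br (\<Union>\<alpha>\<in>\<Delta> - {0}. Lroot Lg \<alpha>) = UNIV"
  and degrees_generate: "gen_subgroup {lam. Ldeg Lg lam \<noteq> {0}} = UNIV"
  using lie_torus unfolding lie_torus_def by - (elim conjE, assumption)+

lemma lie_algebra: "lie_algebra sc br"
  using graded unfolding graded_lie_algebra_def by (elim conjE)

sublocale M: module sc
  using lie_algebra by (simp add: lie_algebra_def)

lemma br_add_left: "br (x + y) z = br x z + br y z"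
  and br_add_right: "br x (y + z) = br x y + br x z"
  and br_sc_left: "br (sc a x) y = sc a (br x y)"
  and br_sc_right: "br x (sc a y) = sc a (br x y)"
  and br_self: "br x x = 0"
  and br_jacobi: "br x (br y z) + br y (br z x) + br z (br x y) = 0"
  using lie_algebra unfolding lie_algebra_def by blast+

lemma br_swap: "br x y = - br y x"
proof -
  have "br x y + br y x = 0"
    using br_self[of "x + y"] unfolding br_add_left br_add_right by (simp add: br_self add.commute)
  then show ?thesis by (simp add: eq_neg_iff_add_eq_0)
qed

lemma br_0_left [simp]: "br 0 x = 0"
  using br_add_left[of 0 0 x] by simp

lemma br_0_right [simp]: "br x 0 = 0"
  using br_add_right[of x 0 0] by simp

lemma br_neg_right: "br x (- y) = - br x y"
  using br_add_right[of x y "- y"] by (simp add: eq_neg_iff_add_eq_0 add.commute)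

lemma br_neg_left: "br (- x) y = - br x y"
  using br_add_left[of x "- x" y] by (simp add: eq_neg_iff_add_eq_0 add.commute)

lemma br_br_left: "br (br x y) z = br x (br y z) - br y (br x z)"
  using br_jacobi[of x y z] br_swap[of "br x y" z] br_swap[of z x]
  by (simp add: br_neg_right algebra_simps)

lemma br_sum_left: "br (\<Sum>i\<in>A. f i) y = (\<Sum>i\<in>A. br (f i) y)"
  by (rule additive_sum) (rule br_add_left)

lemma br_sum_right: "br x (\<Sum>i\<in>A. f i) = (\<Sum>i\<in>A. br x (f i))"
  by (rule additive_sum) (rule br_add_right)

lemma Lg_subspace: "M.subspace (Lg \<alpha> lam)"
proof -
  have "\<forall>\<alpha> lam. M.subspace (Lg \<alpha> lam)"
    using graded unfolding graded_lie_algebra_def by (elim conjE)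
  then show ?thesis by simp
qed

lemma br_Lg:
  assumes "x \<in> Lg \<alpha> lam" "y \<in> Lg \<beta> \<mu>"
  shows "br x y \<in> Lg (\<alpha> + \<beta>) (lam + \<mu>)"
proof -
  have "\<forall>\<alpha> lam \<beta> \<mu>. \<forall>x\<in>Lg \<alpha> lam. \<forall>y\<in>Lg \<beta> \<mu>. br x y \<in> Lg (\<alpha> + \<beta>) (lam + \<mu>)"
    using graded unfolding graded_lie_algebra_def by (elim conjE)
  then show ?thesis using assms by simp
qed

lemmas Lg_0 [simp] = M.subspace_0[OF Lg_subspace]
lemmas Lg_add = M.subspace_add[OF Lg_subspace]
lemmas Lg_scale = M.subspace_scale[OF Lg_subspace]
lemmas Lg_sum = M.subspace_sum[OF Lg_subspace]

section \<open>Homogeneous components\<close>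

definition hcomp :: "'v \<Rightarrow> 'r \<Rightarrow> 'l \<Rightarrow> 'v" where
  "hcomp x = (THE c. (\<forall>\<alpha> lam. c \<alpha> lam \<in> Lg \<alpha> lam) \<and> finite {(\<alpha>, lam). c \<alpha> lam \<noteq> 0} \<and>
          x = (\<Sum>p\<in>{(\<alpha>, lam). c \<alpha> lam \<noteq> 0}. case_prod c p))"

lemma hcomp_ex1: "\<exists>!c. (\<forall>\<alpha> lam. c \<alpha> lam \<in> Lg \<alpha> lam) \<and> finite {(\<alpha>, lam). c \<alpha> lam \<noteq> 0} \<and>
          x = (\<Sum>p\<in>{(\<alpha>, lam). c \<alpha> lam \<noteq> 0}. case_prod c p)"
proof -
  have "\<forall>x. \<exists>!c. (\<forall>\<alpha> lam. c \<alpha> lam \<in> Lg \<alpha> lam) \<and> finite {(\<alpha>, lam). c \<alpha> lam \<noteq> 0} \<and>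
          x = (\<Sum>p\<in>{(\<alpha>, lam). c \<alpha> lam \<noteq> 0}. case_prod c p)"
    using graded unfolding graded_lie_algebra_def by (elim conjE)
  then show ?thesis by (rule spec)
qed

definition supp :: "'v \<Rightarrow> ('r \<times> 'l) set" where
  "supp x = {(\<alpha>, lam). hcomp x \<alpha> lam \<noteq> 0}"

lemma hcomp_in: "hcomp x \<alpha> lam \<in> Lg \<alpha> lam"
  and finite_supp: "finite (supp x)"
  and sum_hcomp: "(\<Sum>p\<in>supp x. case_prod (hcomp x) p) = x"
  using theI'[OF hcomp_ex1[of x]] unfolding supp_def hcomp_def[symmetric] by auto

lemma hcomp_eqI:
  assumes "\<And>\<alpha> lam. c \<alpha> lam \<in> Lg \<alpha> lam" and "finite F"
    and "\<And>\<alpha> lam. (\<alpha>, lam) \<notin> F \<Longrightarrow> c \<alpha> lam = 0" and "x = (\<Sum>p\<in>F. case_prod c p)"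
  shows "hcomp x = c"
proof -
  have sub: "{(\<alpha>, lam). c \<alpha> lam \<noteq> 0} \<subseteq> F" using assms(3) by auto
  have "x = (\<Sum>p\<in>{(\<alpha>, lam). c \<alpha> lam \<noteq> 0}. case_prod c p)"
    unfolding assms(4) by (rule sum.mono_neutral_right[OF assms(2) sub]) auto
  then show ?thesis unfolding hcomp_def
    using assms(1) finite_subset[OF sub assms(2)] by (intro the1_equality hcomp_ex1 conjI) auto
qed

lemma sum_hcomp_superset:
  assumes "finite F" "supp x \<subseteq> F"
  shows "x = (\<Sum>p\<in>F. case_prod (hcomp x) p)"
proof -
  have "x = (\<Sum>p\<in>supp x. case_prod (hcomp x) p)" by (rule sum_hcomp[symmetric])
  also have "\<dots> = (\<Sum>p\<in>F. case_prod (hcomp x) p)"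
    by (rule sum.mono_neutral_left[OF assms]) (auto simp: supp_def)
  finally show ?thesis .
qed

lemma hcomp_Lg:
  assumes "x \<in> Lg \<alpha> lam"
  shows "hcomp x = (\<lambda>\<beta> \<mu>. if \<beta> = \<alpha> \<and> \<mu> = lam then x else 0)"
  by (rule hcomp_eqI[where F = "{(\<alpha>, lam)}"]) (use assms in auto)

lemma hcomp_add: "hcomp (x + y) \<alpha> lam = hcomp x \<alpha> lam + hcomp y \<alpha> lam"
proof -
  have "hcomp (x + y) = (\<lambda>\<alpha> lam. hcomp x \<alpha> lam + hcomp y \<alpha> lam)"
  proof (rule hcomp_eqI[where F = "supp x \<union> supp y"])
    show "x + y = (\<Sum>p\<in>supp x \<union> supp y. case p of (\<alpha>, lam) \<Rightarrow> hcomp x \<alpha> lam + hcomp y \<alpha> lam)"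
    proof -
      have "x + y = (\<Sum>p\<in>supp x \<union> supp y. case_prod (hcomp x) p)
          + (\<Sum>p\<in>supp x \<union> supp y. case_prod (hcomp y) p)"
        by (intro arg_cong2[where f = plus] sum_hcomp_superset) (auto simp: finite_supp)
      then show ?thesis by (simp add: case_prod_unfold sum.distrib)
    qed
    show "finite (supp x \<union> supp y)" by (simp add: finite_supp)
  qed (auto simp: hcomp_in Lg_add supp_def)
  then show ?thesis by simp
qed

lemma hcomp_sc: "hcomp (sc a x) \<alpha> lam = sc a (hcomp x \<alpha> lam)"
proof -
  have "hcomp (sc a x) = (\<lambda>\<alpha> lam. sc a (hcomp x \<alpha> lam))"
  proof (rule hcomp_eqI[where F = "supp x"])
    have "sc a x = sc a (\<Sum>p\<in>supp x. case_prod (hcomp x) p)" by (simp only: sum_hcomp)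
    also have "\<dots> = (\<Sum>p\<in>supp x. case p of (\<alpha>, lam) \<Rightarrow> sc a (hcomp x \<alpha> lam))"
      by (simp add: M.scale_sum_right case_prod_unfold)
    finally show "sc a x = (\<Sum>p\<in>supp x. case p of (\<alpha>, lam) \<Rightarrow> sc a (hcomp x \<alpha> lam))" .
    show "finite (supp x)" by (rule finite_supp)
  qed (auto simp: hcomp_in Lg_scale supp_def)
  then show ?thesis by simp
qed

lemma hcomp_sum: "hcomp (\<Sum>i\<in>A. f i) \<alpha> lam = (\<Sum>i\<in>A. hcomp (f i) \<alpha> lam)"
  by (rule additive_sum[of "\<lambda>x. hcomp x \<alpha> lam"]) (rule hcomp_add)

lemma hcomp_0 [simp]: "hcomp 0 \<alpha> lam = 0"
  using hcomp_add[of 0 0 \<alpha> lam] by simp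

lemma hcomp_all_0:
  assumes "\<And>\<alpha> lam. hcomp x \<alpha> lam = 0"
  shows "x = 0"
  using sum_hcomp[of x] assms by (simp add: case_prod_unfold)

lemma Lg_disjoint:
  assumes "x \<in> Lg \<alpha> lam" "x \<in> Lg \<beta> \<mu>" "x \<noteq> 0"
  shows "\<alpha> = \<beta> \<and> lam = \<mu>"
  using hcomp_Lg[OF assms(1)] hcomp_Lg[OF assms(2)] assms(3) by (metis (full_types))

lemma hcomp_br: "hcomp (br x y) \<gamma> \<nu> = (\<Sum>p\<in>supp x. \<Sum>q\<in>supp y.
    if fst p + fst q = \<gamma> \<and> snd p + snd q = \<nu>
    then br (case_prod (hcomp x) p) (case_prod (hcomp y) q) else 0)"
proof -
  have "br x y = br (\<Sum>p\<in>supp x. case_prod (hcomp x) p) (\<Sum>q\<in>supp y. case_prod (hcomp y) q)"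
    by (simp only: sum_hcomp)
  also have "\<dots> = (\<Sum>p\<in>supp x. \<Sum>q\<in>supp y. br (case_prod (hcomp x) p) (case_prod (hcomp y) q))"
    by (simp only: br_sum_left br_sum_right) (rule sum.swap)
  finally have "hcomp (br x y) \<gamma> \<nu> =
      (\<Sum>p\<in>supp x. \<Sum>q\<in>supp y. hcomp (br (case_prod (hcomp x) p) (case_prod (hcomp y) q)) \<gamma> \<nu>)"
    by (simp only: hcomp_sum)
  also have "\<dots> = (\<Sum>p\<in>supp x. \<Sum>q\<in>supp y.
      if fst p + fst q = \<gamma> \<and> snd p + snd q = \<nu>
      then br (case_prod (hcomp x) p) (case_prod (hcomp y) q) else 0)"
  proof (intro sum.cong refl)
    fix p q
    show "hcomp (br (case_prod (hcomp x) p) (case_prod (hcomp y) q)) \<gamma> \<nu> =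
      (if fst p + fst q = \<gamma> \<and> snd p + snd q = \<nu>
       then br (case_prod (hcomp x) p) (case_prod (hcomp y) q) else 0)"
      unfolding case_prod_unfold
        hcomp_Lg[OF br_Lg[OF hcomp_in[of x "fst p" "snd p"] hcomp_in[of y "fst q" "snd q"]]]
      by (intro if_cong) auto
  qed
  finally show ?thesis .
qed

lemma Lroot_iff: "x \<in> Lroot Lg \<alpha> \<longleftrightarrow> (\<forall>\<beta> \<mu>. \<beta> \<noteq> \<alpha> \<longrightarrow> hcomp x \<beta> \<mu> = 0)"
proof
  assume "x \<in> Lroot Lg \<alpha>"
  then obtain F c where F: "finite F" "\<forall>lam\<in>F. c lam \<in> Lg \<alpha> lam" "x = (\<Sum>lam\<in>F. c lam)"
    unfolding Lroot_def by blast
  have "hcomp x \<beta> \<mu> = 0" if "\<beta> \<noteq> \<alpha>" for \<beta> \<mu>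
    unfolding F(3) hcomp_sum
  proof (rule sum.neutral, rule ballI)
    fix lam assume "lam \<in> F"
    then show "hcomp (c lam) \<beta> \<mu> = 0" using hcomp_Lg[of "c lam" \<alpha> lam] F(2) that by simp
  qed
  then show "\<forall>\<beta> \<mu>. \<beta> \<noteq> \<alpha> \<longrightarrow> hcomp x \<beta> \<mu> = 0" by blast
next
  assume *: "\<forall>\<beta> \<mu>. \<beta> \<noteq> \<alpha> \<longrightarrow> hcomp x \<beta> \<mu> = 0"
  let ?F = "snd ` supp x"
  have fin: "finite ?F" by (simp add: finite_supp)
  have "supp x \<subseteq> Pair \<alpha> ` ?F"
    using * by (force simp: supp_def)
  then have "x = (\<Sum>p\<in>Pair \<alpha> ` ?F. case_prod (hcomp x) p)"
    by (intro sum_hcomp_superset) (simp add: fin)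
  also have "\<dots> = (\<Sum>lam\<in>?F. hcomp x \<alpha> lam)"
    by (subst sum.reindex) (auto simp: inj_on_def)
  finally show "x \<in> Lroot Lg \<alpha>"
    unfolding Lroot_def
    by (intro CollectI exI[of _ ?F] exI[of _ "hcomp x \<alpha>"]) (simp add: fin hcomp_in)
qed

lemma Lg_Lroot: "x \<in> Lg \<alpha> lam \<Longrightarrow> x \<in> Lroot Lg \<alpha>"
  by (simp add: Lroot_iff hcomp_Lg)

lemma Lg_nonzero_root: "x \<in> Lg \<alpha> lam \<Longrightarrow> x \<noteq> 0 \<Longrightarrow> \<alpha> \<in> \<Delta>"
  unfolding supp_eq[symmetric] using Lg_Lroot[of x \<alpha> lam] by auto

lemma root_Lg_nonzero:
  assumes "\<alpha> \<in> \<Delta>"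
  obtains lam x where "x \<in> Lg \<alpha> lam" "x \<noteq> 0"
proof -
  have "0 \<in> Lroot Lg \<alpha>" by (simp add: Lroot_iff)
  moreover have "Lroot Lg \<alpha> \<noteq> {0}" using assms unfolding supp_eq[symmetric] by simp
  ultimately obtain x where x: "x \<in> Lroot Lg \<alpha>" "x \<noteq> 0" by blast
  then obtain \<beta> lam where "hcomp x \<beta> lam \<noteq> 0" using hcomp_all_0 by blast
  moreover from this x have "\<beta> = \<alpha>" unfolding Lroot_iff by blast
  ultimately show thesis using that[OF hcomp_in] by blast
qed


section \<open>The root system of a Lie torus and its indivisible roots\<close>

lemma coroot_ok:
  assumes "\<alpha> \<in> \<Delta> - {0}"
  shows "coroot_ok (\<Delta> - {0}) \<alpha> (coroot \<Delta> \<alpha>)"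
proof -
  have "\<forall>\<alpha>\<in>\<Delta> - {0}. \<exists>c. coroot_ok (\<Delta> - {0}) \<alpha> c"
    using fin_root_system
    unfolding finite_root_system_def irreducible_root_system_def is_root_system_def
    by (elim conjE)
  from this assms have "\<exists>c. coroot_ok (\<Delta> - {0}) \<alpha> c" by (rule bspec)
  then show ?thesis unfolding coroot_def by (rule someI_ex)
qed

sublocale D: root_sys "\<Delta> - {0}" "coroot \<Delta>"
proof (rule root_sys.intro)
  show "finite (\<Delta> - {0})" using fin_root_system by (simp add: finite_root_system_def)
  fix \<alpha> assume "\<alpha> \<in> \<Delta> - {0}"
  from coroot_ok[OF this] have ok: "linear (coroot \<Delta> \<alpha>)" "coroot \<Delta> \<alpha> \<alpha> = 2"
    "(\<lambda>\<beta>. \<beta> - coroot \<Delta> \<alpha> \<beta> *\<^sub>R \<alpha>) ` (\<Delta> - {0}) = \<Delta> - {0}"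
    "\<forall>\<beta>\<in>\<Delta> - {0}. coroot \<Delta> \<alpha> \<beta> \<in> \<int>"
    unfolding coroot_ok_def by blast+
  then show "linear (coroot \<Delta> \<alpha>)" "coroot \<Delta> \<alpha> \<alpha> = 2" by blast+
  fix \<beta> assume "\<beta> \<in> \<Delta> - {0}"
  then show "\<beta> - coroot \<Delta> \<alpha> \<beta> *\<^sub>R \<alpha> \<in> \<Delta> - {0}" "coroot \<Delta> \<alpha> \<beta> \<in> \<int>"
    using ok(3,4) by blast+
qed simp

lemma ind_roots_reflect:
  assumes "\<alpha> \<in> \<Delta> - {0}" "\<beta> \<in> ind_roots \<Delta>"
  shows "D.reflect \<alpha> \<beta> \<in> ind_roots \<Delta>"
proof -
  have \<beta>: "\<beta> \<in> \<Delta> - {0}" using assms by (simp add: ind_roots_def)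
  have "D.reflect \<alpha> \<beta> \<noteq> 2 *\<^sub>R \<gamma>" if \<gamma>: "\<gamma> \<in> \<Delta> - {0}" for \<gamma>
  proof
    assume "D.reflect \<alpha> \<beta> = 2 *\<^sub>R \<gamma>"
    then have "\<beta> = 2 *\<^sub>R D.reflect \<alpha> \<gamma>"
      using D.reflect_reflect[OF assms(1), of \<beta>] by (simp add: D.reflect_scale[OF assms(1)])
    then show False using assms(2) D.reflect_in[OF assms(1) \<gamma>] by (auto simp: ind_roots_def)
  qed
  then show ?thesis using D.reflect_in[OF assms(1) \<beta>] by (auto simp: ind_roots_def)
qed

text \<open>Halving once is enough: \<alpha> = 4\<gamma> would give 4 <\<gamma>, \<alpha>^vee> = 2,
  against integrality.\<close>

lemma not_ind_root:
  assumes "\<alpha> \<in> \<Delta> - {0}" "\<alpha> \<notin> ind_roots \<Delta>"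
  obtains \<beta> where "\<beta> \<in> ind_roots \<Delta>" "\<alpha> = 2 *\<^sub>R \<beta>"
proof -
  obtain \<beta> where \<beta>: "\<beta> \<in> \<Delta> - {0}" "\<alpha> = 2 *\<^sub>R \<beta>" using assms by (auto simp: ind_roots_def)
  have "\<beta> \<noteq> 2 *\<^sub>R \<gamma>" if \<gamma>: "\<gamma> \<in> \<Delta> - {0}" for \<gamma>
  proof
    assume "\<beta> = 2 *\<^sub>R \<gamma>"
    then have "\<alpha> = 4 *\<^sub>R \<gamma>" using \<beta> by simp
    then have "4 * coroot \<Delta> \<alpha> \<gamma> = 2"
      using D.cr_self[OF assms(1)] D.cr_scale[OF assms(1), of 4 \<gamma>] by simp
    moreover obtain n :: int where "coroot \<Delta> \<alpha> \<gamma> = of_int n"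
      using D.cr_Ints[OF assms(1) \<gamma>] by (auto elim: Ints_cases)
    ultimately have "real_of_int (4 * n) = real_of_int 2" by simp
    then have "4 * n = 2" by (simp only: of_int_eq_iff)
    then show False by presburger
  qed
  then show thesis using that \<beta> by (auto simp: ind_roots_def)
qed

lemma span_ind_roots: "span (ind_roots \<Delta>) = span (\<Delta> - {0})"
proof (rule span_eq[THEN iffD2], intro conjI subsetI)
  fix \<alpha> assume "\<alpha> \<in> ind_roots \<Delta>"
  then show "\<alpha> \<in> span (\<Delta> - {0})" by (auto simp: ind_roots_def intro: span_base)
next
  fix \<alpha> assume \<alpha>: "\<alpha> \<in> \<Delta> - {0}"
  show "\<alpha> \<in> span (ind_roots \<Delta>)"
  proof (cases "\<alpha> \<in> ind_roots \<Delta>")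
    case False
    then obtain \<beta> where "\<beta> \<in> ind_roots \<Delta>" "\<alpha> = 2 *\<^sub>R \<beta>" using not_ind_root[OF \<alpha>] by metis
    then show ?thesis by (auto intro: span_scale span_base)
  qed (rule span_base)
qed

text \<open>A subspace containing \<beta> contains 2\<beta>, so a decomposition for the indivisible
  roots would be one for all roots. The passage to indivisible roots is made because (LT2)(i)
  supplies degree-zero vectors for them only.\<close>

lemma irr_ind: "irr_root_sys (ind_roots \<Delta>) (coroot \<Delta>)"
proof (intro irr_root_sys.intro root_sys.intro irr_root_sys_axioms.intro)
  have sub: "ind_roots \<Delta> \<subseteq> \<Delta> - {0}" by (auto simp: ind_roots_def)
  show "finite (ind_roots \<Delta>)" using D.finR sub finite_subset by blast
  show "0 \<notin> ind_roots \<Delta>" using sub by blast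
  show "\<beta> - coroot \<Delta> \<alpha> \<beta> *\<^sub>R \<alpha> \<in> ind_roots \<Delta>"
    if "\<alpha> \<in> ind_roots \<Delta>" "\<beta> \<in> ind_roots \<Delta>" for \<alpha> \<beta>
    using ind_roots_reflect[of \<alpha> \<beta>] that sub by (auto simp: D.reflect_def)
  have irr: "irreducible_root_system (\<Delta> - {0})"
    using fin_root_system by (simp add: finite_root_system_def)
  then have "\<Delta> - {0} \<noteq> {}" by (simp add: irreducible_root_system_def)
  then show "ind_roots \<Delta> \<noteq> {}" using not_ind_root by blast
  have incl: "\<Delta> - {0} \<subseteq> V1 \<union> V2"
    if V: "subspace V1" "subspace V2" "ind_roots \<Delta> \<subseteq> V1 \<union> V2" for V1 V2
  proof
    fix \<alpha> assume \<alpha>: "\<alpha> \<in> \<Delta> - {0}"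
    show "\<alpha> \<in> V1 \<union> V2"
    proof (cases "\<alpha> \<in> ind_roots \<Delta>")
      case False
      then obtain \<beta> where \<beta>: "\<beta> \<in> ind_roots \<Delta>" "\<alpha> = 2 *\<^sub>R \<beta>"
        using not_ind_root[OF \<alpha>] by metis
      then have "\<beta> \<in> V1 \<or> \<beta> \<in> V2" using V(3) by blast
      then show ?thesis
        unfolding \<beta>(2) using subspace_scale[OF V(1)] subspace_scale[OF V(2)] by auto
    qed (use V(3) in blast)
  qed
  have nex: "\<not> (\<exists>V1 V2. subspace V1 \<and> subspace V2 \<and> V1 \<noteq> {0} \<and> V2 \<noteq> {0} \<and> V1 \<inter> V2 = {0} \<and>
            {x + y | x y. x \<in> V1 \<and> y \<in> V2} = span (\<Delta> - {0}) \<and> \<Delta> - {0} \<subseteq> V1 \<union> V2)"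
    using irr unfolding irreducible_root_system_def by (elim conjE)
  show "\<not> (\<exists>V1 V2. subspace V1 \<and> subspace V2 \<and> V1 \<noteq> {0} \<and> V2 \<noteq> {0} \<and> V1 \<inter> V2 = {0} \<and>
            {x + y | x y. x \<in> V1 \<and> y \<in> V2} = span (ind_roots \<Delta>) \<and> ind_roots \<Delta> \<subseteq> V1 \<union> V2)"
  proof (rule notI, elim exE conjE)
    fix V1 V2
    assume "subspace V1" "subspace V2" "V1 \<noteq> {0}" "V2 \<noteq> {0}" "V1 \<inter> V2 = {0}"
      "{x + y | x y. x \<in> V1 \<and> y \<in> V2} = span (ind_roots \<Delta>)" "ind_roots \<Delta> \<subseteq> V1 \<union> V2"
    then have "subspace V1 \<and> subspace V2 \<and> V1 \<noteq> {0} \<and> V2 \<noteq> {0} \<and> V1 \<inter> V2 = {0} \<and>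
            {x + y | x y. x \<in> V1 \<and> y \<in> V2} = span (\<Delta> - {0}) \<and> \<Delta> - {0} \<subseteq> V1 \<union> V2"
      by (intro conjI incl) (assumption | simp only: span_ind_roots)+
    then show False by (rule nex[THEN notE, OF exI, OF exI])
  qed
qed (auto simp: ind_roots_def D.lin D.cr_self D.cr_Ints)

sublocale I: irr_root_sys "ind_roots \<Delta>" "coroot \<Delta>"
  by (rule irr_ind)

lemma zspan_0: "0 \<in> zspan \<Delta>"
  and zspan_add: "x \<in> zspan \<Delta> \<Longrightarrow> y \<in> zspan \<Delta> \<Longrightarrow> x + y \<in> zspan \<Delta>"
  and zspan_uminus: "x \<in> zspan \<Delta> \<Longrightarrow> - x \<in> zspan \<Delta>"
  and zspan_base: "x \<in> \<Delta> \<Longrightarrow> x \<in> zspan \<Delta>"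
  unfolding zspan_eq_gen_subgroup
  using gen_subgroup_superset[of \<Delta>]
  by (auto intro: gen_subgroup_zero gen_subgroup_add gen_subgroup_uminus)

lemma zspan_eq_ind: "zspan \<Delta> = gen_subgroup (ind_roots \<Delta>)"
proof
  show "zspan \<Delta> \<subseteq> gen_subgroup (ind_roots \<Delta>)"
    unfolding zspan_eq_gen_subgroup
  proof (rule gen_subgroup_least, rule subsetI)
    fix \<alpha> assume \<alpha>: "\<alpha> \<in> \<Delta>"
    show "\<alpha> \<in> gen_subgroup (ind_roots \<Delta>)"
    proof (cases "\<alpha> \<in> ind_roots \<Delta> \<or> \<alpha> = 0")
      case True
      then show ?thesis using gen_subgroup_superset gen_subgroup_zero by blast
    next
      case False
      then obtain \<beta> where "\<beta> \<in> ind_roots \<Delta>" "\<alpha> = 2 *\<^sub>R \<beta>" using not_ind_root[of \<alpha>] \<alpha> by auto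
      then show ?thesis unfolding scaleR_2
        using gen_subgroup_superset gen_subgroup_add by (metis subsetD)
    qed
  qed
  show "gen_subgroup (ind_roots \<Delta>) \<subseteq> zspan \<Delta>"
    unfolding zspan_eq_gen_subgroup using gen_subgroup_superset[of \<Delta>]
    by (intro gen_subgroup_least) (auto simp: ind_roots_def)
qed

lemma coroot_zspan_Ints:
  assumes \<alpha>: "\<alpha> \<in> \<Delta> - {0}" and "\<beta> \<in> zspan \<Delta>"
  shows "coroot \<Delta> \<alpha> \<beta> \<in> \<int>"
  using assms(2) unfolding zspan_eq_ind
  by (induction rule: gen_subgroup_induct)
     (use \<alpha> D.cr_Ints[OF \<alpha>] in \<open>auto simp: D.cr_simps ind_roots_def\<close>)

text \<open>On \<open>Q\<close> the floor in \<open>pairing\<close> loses nothing.\<close>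

lemma pairing_eq:
  assumes "\<alpha> \<in> \<Delta> - {0}" "\<beta> \<in> zspan \<Delta>"
  shows "real_of_int (pairing \<Delta> \<beta> \<alpha>) = coroot \<Delta> \<alpha> \<beta>"
  using coroot_zspan_Ints[OF assms] by (auto simp: pairing_def elim: Ints_cases)

lemma pairing_add:
  assumes "\<alpha> \<in> \<Delta> - {0}" "\<beta> \<in> zspan \<Delta>" "\<gamma> \<in> zspan \<Delta>"
  shows "pairing \<Delta> (\<beta> + \<gamma>) \<alpha> = pairing \<Delta> \<beta> \<alpha> + pairing \<Delta> \<gamma> \<alpha>"
proof -
  have "real_of_int (pairing \<Delta> (\<beta> + \<gamma>) \<alpha>) = real_of_int (pairing \<Delta> \<beta> \<alpha> + pairing \<Delta> \<gamma> \<alpha>)"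
    using assms by (simp add: pairing_eq zspan_add D.cr_add)
  then show ?thesis by (simp only: of_int_eq_iff)
qed

lemma pairing_self: "\<alpha> \<in> \<Delta> - {0} \<Longrightarrow> pairing \<Delta> \<alpha> \<alpha> = 2"
  by (simp add: pairing_def D.cr_self)

lemma pairing_uminus_self: "\<alpha> \<in> \<Delta> - {0} \<Longrightarrow> pairing \<Delta> (- \<alpha>) \<alpha> = - 2"
  by (simp add: pairing_def D.cr_self D.cr_neg)

lemma coroot_uminus:
  assumes "\<alpha> \<in> \<Delta> - {0}" "\<beta> \<in> \<Delta> - {0}"
  shows "coroot \<Delta> (- \<alpha>) \<beta> = - coroot \<Delta> \<alpha> \<beta>"
  using D.cr_reflect_left[OF assms(1,1,2)] assms
  by (simp add: D.reflect_self D.reflect_def[of \<alpha> \<beta>] D.cr_simps)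

section \<open>Strings of roots and nonvanishing brackets\<close>

lemma sl2_triple:
  assumes "\<alpha> \<in> \<Delta> - {0}" "x \<in> Lg \<alpha> lam" "x \<noteq> 0"
  obtains e f where "e \<in> Lg \<alpha> lam" "f \<in> Lg (- \<alpha>) (- lam)"
    "Lg \<alpha> lam = range (\<lambda>a. sc a e)" "Lg (- \<alpha>) (- lam) = range (\<lambda>a. sc a f)"
    "\<And>\<beta> \<mu> y. y \<in> Lg \<beta> \<mu> \<Longrightarrow> br (br e f) y = sc (of_int (pairing \<Delta> \<beta> \<alpha>)) y"
proof -
  have "Lg \<alpha> lam \<noteq> {0}" using assms(2,3) by blast
  moreover have "\<forall>\<alpha>\<in>\<Delta> - {0}. \<forall>lam. Lg \<alpha> lam \<noteq> {0} \<longrightarrow>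
        (\<exists>e f. e \<in> Lg \<alpha> lam \<and> f \<in> Lg (- \<alpha>) (- lam) \<and>
           Lg \<alpha> lam = range (\<lambda>a. sc a e) \<and> Lg (- \<alpha>) (- lam) = range (\<lambda>a. sc a f) \<and>
           (\<forall>\<beta>\<in>zspan \<Delta>. \<forall>x\<in>Lroot Lg \<beta>.
              br (br e f) x = sc (of_int (pairing \<Delta> \<beta> \<alpha>)) x))"
    using lie_torus unfolding lie_torus_def by (elim conjE)
  ultimately obtain e f where ef: "e \<in> Lg \<alpha> lam" "f \<in> Lg (- \<alpha>) (- lam)"
    "Lg \<alpha> lam = range (\<lambda>a. sc a e)" "Lg (- \<alpha>) (- lam) = range (\<lambda>a. sc a f)"
    "\<forall>\<beta>\<in>zspan \<Delta>. \<forall>x\<in>Lroot Lg \<beta>. br (br e f) x = sc (of_int (pairing \<Delta> \<beta> \<alpha>)) x"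
    using assms(1) by blast
  have "br (br e f) y = sc (of_int (pairing \<Delta> \<beta> \<alpha>)) y" if y: "y \<in> Lg \<beta> \<mu>" for \<beta> \<mu> y
  proof (cases "y = 0")
    case False
    then have "\<beta> \<in> zspan \<Delta>" using Lg_nonzero_root[OF y] zspan_base by blast
    then show ?thesis using ef(5) Lg_Lroot[OF y] by blast
  qed simp
  with ef(1-4) show thesis by (rule that)
qed

lemma zsc_of_nat_Suc: "zsc (int (Suc n)) x = x + zsc (int n) x"
  using zsc_add[of 1 "int n" x] by simp

lemma br_pow_Lg:
  assumes "e \<in> Lg \<alpha> lam" "x \<in> Lg \<beta> \<mu>"
  shows "(br e ^^ n) x \<in> Lg (zsc (int n) \<alpha> + \<beta>) (zsc (int n) lam + \<mu>)"
proof (induction n)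
  case (Suc n)
  then show ?case using br_Lg[OF assms(1) Suc] unfolding zsc_of_nat_Suc by (simp add: add.assoc)
qed (use assms in simp)

text \<open>Otherwise the points \<beta> + m \<alpha> would be infinitely many distinct
  roots.\<close>

lemma br_pow_nilpotent:
  assumes "\<alpha> \<noteq> 0" "e \<in> Lg \<alpha> lam" "x \<in> Lg \<beta> \<mu>"
  shows "\<exists>m. (br e ^^ m) x = 0"
proof (rule ccontr)
  assume "\<nexists>m. (br e ^^ m) x = 0"
  then have "zsc (int m) \<alpha> + \<beta> \<in> \<Delta>" for m
    using Lg_nonzero_root[OF br_pow_Lg[OF assms(2,3)]] by blast
  then have "finite (range (\<lambda>m. zsc (int m) \<alpha> + \<beta>))"
    using fin_root_system by (auto simp: finite_root_system_def intro: finite_subset)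
  moreover have "inj (\<lambda>m. zsc (int m) \<alpha> + \<beta>)"
    using assms(1) by (auto simp: inj_on_def zsc_real_vector)
  ultimately show False using finite_imageD infinite_UNIV_nat by blast
qed

text \<open>On vectors of weight -n the n-th power of \<open>br e\<close> is injective, and z is a
  nonzero multiple of e. This realises reflections inside the algebra: the n-fold bracket with z
  moves x from root \<beta> to its reflection in \<alpha> and adds n times the degree of z.\<close>

lemma br_pow_nonzero:
  assumes \<alpha>: "\<alpha> \<in> \<Delta> - {0}" and z: "z \<in> Lg \<alpha> lam" "z \<noteq> 0"
    and x: "x \<in> Lg \<beta> \<mu>" "x \<noteq> 0" and n: "pairing \<Delta> \<beta> \<alpha> = - int n"
  shows "(br z ^^ n) x \<noteq> 0"
proof -
  obtain e f where e: "e \<in> Lg \<alpha> lam" "Lg \<alpha> lam = range (\<lambda>a. sc a e)"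
    and f: "f \<in> Lg (- \<alpha>) (- lam)"
    and h: "\<And>\<beta> \<mu> y. y \<in> Lg \<beta> \<mu> \<Longrightarrow> br (br e f) y = sc (of_int (pairing \<Delta> \<beta> \<alpha>)) y"
    using sl2_triple[OF \<alpha> z] by metis
  interpret S: sl2_action sc "br e" "br f" "br (br e f)"
  proof
    show "br (br e f) y = br e (br f y) - br f (br e y)" for y by (rule br_br_left)
    show "br (br e f) (br e y) = br e (br (br e f) y) + sc 2 (br e y)" for y
      using br_br_left[of "br e f" e y] h[OF e(1)]
      by (simp add: pairing_self[OF \<alpha>] br_sc_left algebra_simps)
    show "br (br e f) (br f y) = br f (br (br e f) y) - sc 2 (br f y)" for y
      using br_br_left[of "br e f" f y] h[OF f]
      by (simp add: pairing_uminus_self[OF \<alpha>] br_sc_left br_neg_left algebra_simps)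
  qed (rule br_add_right br_sc_right)+
  obtain m where m: "(br f ^^ m) x = 0" using br_pow_nilpotent[OF _ f x(1)] \<alpha> by auto
  have "br (br e f) x = sc (- of_nat n) x" using h[OF x(1)] n by simp
  then have ne: "(br e ^^ n) x \<noteq> 0" using S.Epow_injective[OF m] x(2) by blast
  obtain a where a: "z = sc a e" using e(2) z(1) by blast
  then have "a \<noteq> 0" using z(2) by auto
  have "(br z ^^ k) x = sc (a ^ k) ((br e ^^ k) x)" for k
    by (induction k) (auto simp: a br_sc_left br_sc_right)
  then have "sc (inverse (a ^ n)) ((br z ^^ n) x) = (br e ^^ n) x"
    using \<open>a \<noteq> 0\<close> by simp
  then show ?thesis using ne by auto
qed

text \<open>Here the weight of y is -2, so even the double bracket [x, [x, y]] is nonzero.\<close>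

lemma br_opposite_nonzero:
  assumes "\<alpha> \<in> \<Delta> - {0}" "x \<in> Lg \<alpha> lam" "x \<noteq> 0" "y \<in> Lg (- \<alpha>) \<mu>" "y \<noteq> 0"
  shows "br x y \<noteq> 0"
  using br_pow_nonzero[OF assms, of 2] pairing_uminus_self[OF assms(1)]
  by (auto simp: numeral_2_eq_2)


section \<open>The zero root space and the weights of its degree-zero part\<close>

lemma lie_induct [consumes 0, case_names root zero add br sc]:
  assumes "\<And>\<alpha> x. \<alpha> \<in> \<Delta> - {0} \<Longrightarrow> x \<in> Lroot Lg \<alpha> \<Longrightarrow> P x" and "P 0"
    and "\<And>x y. P x \<Longrightarrow> P y \<Longrightarrow> P (x + y)" and "\<And>x y. P x \<Longrightarrow> P y \<Longrightarrow> P (br x y)"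
    and "\<And>a x. P x \<Longrightarrow> P (sc a x)"
  shows "P x"
proof -
  have "x \<in> gen_subalg sc br (\<Union>\<alpha>\<in>\<Delta> - {0}. Lroot Lg \<alpha>)" by (simp add: generated)
  then have "x \<in> Collect P"
    unfolding gen_subalg_def by (rule InterD) (use assms in auto)
  then show ?thesis by simp
qed

text \<open>A spanning description of the zero root space in degree \<open>lam\<close>; that it
  contains all of \<open>Lg 0 lam\<close> follows from \<open>hcomp_zero_part\<close>.\<close>

definition zero_part :: "'l \<Rightarrow> 'v set" where
  "zero_part lam = M.span {br a b | a b \<alpha> \<rho>. \<alpha> \<in> \<Delta> - {0} \<and> a \<in> Lg \<alpha> \<rho> \<and> b \<in> Lg (- \<alpha>) (lam - \<rho>)}"

lemma zero_part_base:
  assumes "\<alpha> \<in> \<Delta> - {0}" "a \<in> Lg \<alpha> \<rho>" "b \<in> Lg (- \<alpha>) (lam - \<rho>)"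
  shows "br a b \<in> zero_part lam"
  unfolding zero_part_def by (rule M.span_base) (use assms in blast)

text \<open>By Jacobi, [[a, c], b] = [a, [c, b]] - [c, [a, b]]. Since b has root 0, both terms are
  again brackets of vectors in opposite nonzero root spaces.\<close>

lemma zero_part_br:
  assumes "u \<in> zero_part \<rho>" and b: "b \<in> Lg 0 \<sigma>"
  shows "br u b \<in> zero_part (\<rho> + \<sigma>)"
proof -
  have "M.subspace {u. br u b \<in> zero_part (\<rho> + \<sigma>)}"
    unfolding zero_part_def
    by (intro M.subspaceI) (auto simp: br_add_left br_sc_left M.span_zero M.span_add M.span_scale)
  moreover have "br u b \<in> zero_part (\<rho> + \<sigma>)"
    if u: "u \<in> {br a b | a b \<alpha> r. \<alpha> \<in> \<Delta> - {0} \<and> a \<in> Lg \<alpha> r \<and> b \<in> Lg (- \<alpha>) (\<rho> - r)}" for u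
  proof -
    obtain a c \<alpha> r where *: "u = br a c" "\<alpha> \<in> \<Delta> - {0}" "a \<in> Lg \<alpha> r" "c \<in> Lg (- \<alpha>) (\<rho> - r)"
      using u by blast
    have "br c b \<in> Lg (- \<alpha>) (\<rho> + \<sigma> - r)"
      using br_Lg[OF *(4) b] by (simp add: algebra_simps)
    then have 1: "br a (br c b) \<in> zero_part (\<rho> + \<sigma>)" by (rule zero_part_base[OF *(2,3)])
    \<comment> \<open>In this term c is the leading factor, so the root is -\<alpha> and its degree
      is \<open>\<rho> - r\<close>.\<close>
    have "br a b \<in> Lg (- (- \<alpha>)) (\<rho> + \<sigma> - (\<rho> - r))"
      using br_Lg[OF *(3) b] by (simp add: algebra_simps)
    then have 2: "br c (br a b) \<in> zero_part (\<rho> + \<sigma>)"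
      by (rule zero_part_base[OF D.uminus_in[OF *(2)] *(4)])
    show ?thesis
      unfolding *(1) br_br_left using 1 2 unfolding zero_part_def by (rule M.span_diff)
  qed
  ultimately show ?thesis
    using assms(1)[unfolded zero_part_def] by (rule M.span_induct[rotated])
qed

text \<open>Induction along the generation by nonzero root spaces. In a bracket, a summand of root 0
  has factors of opposite roots; it is a generator if these are nonzero, and otherwise the induction
  hypothesis for the first factor and \<open>zero_part_br\<close> apply.\<close>

lemma hcomp_zero_part: "hcomp x 0 lam \<in> zero_part lam"
proof (induction x arbitrary: lam rule: lie_induct)
  case (root \<alpha> x)
  then have "hcomp x 0 lam = 0" by (auto simp: Lroot_iff)
  then show ?case by (simp add: zero_part_def M.span_zero)
next
  case (br x y)
  show ?case unfolding hcomp_br zero_part_def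
  proof (intro M.span_sum, unfold zero_part_def[symmetric])
    fix p q :: "'r \<times> 'l"
    let ?x = "case_prod (hcomp x) p" and ?y = "case_prod (hcomp y) q"
    have "br ?x ?y \<in> zero_part lam" if pq: "fst p + fst q = 0" "snd p + snd q = lam"
    proof -
      obtain \<beta> \<rho> where p: "p = (\<beta>, \<rho>)" by (cases p)
      then have q: "q = (- \<beta>, lam - \<rho>)"
        using pq by (cases q) (auto simp: eq_neg_iff_add_eq_0 add.commute)
      consider "hcomp x \<beta> \<rho> = 0" | "\<beta> = 0" | "\<beta> \<in> \<Delta> - {0}"
        using Lg_nonzero_root[OF hcomp_in[of x \<beta> \<rho>]] by blast
      then show ?thesis
      proof cases
        case 2
        then show ?thesis
          using zero_part_br[OF br(1)[of \<rho>] hcomp_in[of y 0 "lam - \<rho>"]] p q by simp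
      next
        case 3
        then show ?thesis using zero_part_base[OF 3 hcomp_in hcomp_in] p q by simp
      qed (simp add: p zero_part_def M.span_zero)
    qed
    then show "(if fst p + fst q = 0 \<and> snd p + snd q = lam then br ?x ?y else 0) \<in> zero_part lam"
      by (simp add: zero_part_def M.span_zero)
  qed
qed (auto simp: hcomp_add hcomp_sc zero_part_def M.span_zero M.span_add M.span_scale)

text \<open>\<open>\<xi>\<close> is evaluation at h when roots are read as linear forms on
  \<open>Lg 0 0\<close>. Its values outside \<open>Q\<close> are arbitrary.\<close>

definition diag :: "'v \<Rightarrow> ('r \<Rightarrow> 'k) \<Rightarrow> bool" where
  "diag h \<xi> \<longleftrightarrow> (\<forall>\<beta>\<in>zspan \<Delta>. \<forall>\<gamma>\<in>zspan \<Delta>. \<xi> (\<beta> + \<gamma>) = \<xi> \<beta> + \<xi> \<gamma>) \<and>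
     (\<forall>\<beta> \<mu>. \<forall>x\<in>Lg \<beta> \<mu>. br h x = sc (\<xi> \<beta>) x)"

lemma diag_Lg: "diag h \<xi> \<Longrightarrow> x \<in> Lg \<beta> \<mu> \<Longrightarrow> br h x = sc (\<xi> \<beta>) x"
  unfolding diag_def by (elim conjE) simp

lemma diag_add:
  "diag h \<xi> \<Longrightarrow> \<beta> \<in> zspan \<Delta> \<Longrightarrow> \<gamma> \<in> zspan \<Delta> \<Longrightarrow> \<xi> (\<beta> + \<gamma>) = \<xi> \<beta> + \<xi> \<gamma>"
  unfolding diag_def by (elim conjE) simp

lemma diag_0: "diag h \<xi> \<Longrightarrow> \<xi> 0 = 0"
  using diag_add[of h \<xi> 0 0] by (simp add: zspan_0)

lemma diag_uminus: "diag h \<xi> \<Longrightarrow> \<beta> \<in> zspan \<Delta> \<Longrightarrow> \<xi> (- \<beta>) = - \<xi> \<beta>"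
  using diag_add[of h \<xi> \<beta> "- \<beta>"] diag_0[of h \<xi>]
  by (simp add: zspan_uminus eq_neg_iff_add_eq_0 add.commute)

lemma sl2_diag:
  assumes \<alpha>: "\<alpha> \<in> \<Delta> - {0}"
    and h: "\<And>\<beta> \<mu> y. y \<in> Lg \<beta> \<mu> \<Longrightarrow> br h y = sc (of_int (pairing \<Delta> \<beta> \<alpha>)) y"
  shows "diag h (\<lambda>\<beta>. of_int (pairing \<Delta> \<beta> \<alpha>))"
  unfolding diag_def using h by (auto simp: pairing_add[OF \<alpha>])

text \<open>h is a combination of brackets of vectors in opposite degrees. These spaces are lines
  spanned by e and f, so each bracket is a multiple of some [e, f], which acts through a
  coroot.\<close>

lemma diag_exists:
  assumes "h \<in> Lg 0 0"
  shows "\<exists>\<xi>. diag h \<xi>"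
proof -
  have h0: "h \<in> zero_part 0" using hcomp_zero_part[of h 0] by (simp add: hcomp_Lg[OF assms])
  have sub: "M.subspace {h. \<exists>\<xi>. diag h \<xi>}"
  proof (rule M.subspaceI; clarify)
    show "\<exists>\<xi>. diag 0 \<xi>" by (rule exI[of _ "\<lambda>_. 0"]) (simp add: diag_def)
  next
    fix h1 h2 \<xi>1 \<xi>2 assume "diag h1 \<xi>1" "diag h2 \<xi>2"
    then have "diag (h1 + h2) (\<lambda>\<beta>. \<xi>1 \<beta> + \<xi>2 \<beta>)"
      unfolding diag_def by (simp add: br_add_left M.scale_left_distrib)
    then show "\<exists>\<xi>. diag (h1 + h2) \<xi>" by (intro exI)
  next
    fix h a \<xi> assume "diag h \<xi>"
    then have "diag (sc a h) (\<lambda>\<beta>. a * \<xi> \<beta>)"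
      unfolding diag_def by (simp add: br_sc_left distrib_left)
    then show "\<exists>\<xi>. diag (sc a h) \<xi>" by (intro exI)
  qed
  have gen: "\<exists>\<xi>. diag h \<xi>"
    if h: "h \<in> {br a b | a b \<alpha> \<rho>. \<alpha> \<in> \<Delta> - {0} \<and> a \<in> Lg \<alpha> \<rho> \<and> b \<in> Lg (- \<alpha>) (0 - \<rho>)}" for h
  proof -
    obtain a b \<alpha> \<rho> where hab: "h = br a b" and \<alpha>: "\<alpha> \<in> \<Delta> - {0}" and a: "a \<in> Lg \<alpha> \<rho>"
      and b: "b \<in> Lg (- \<alpha>) (- \<rho>)"
      using h unfolding diff_0 by blast
    show ?thesis
    proof (cases "a = 0")
      case True
      then show ?thesis unfolding hab by (intro exI[of _ "\<lambda>_. 0"]) (simp add: diag_def)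
    next
      case False
      obtain e f where e: "Lg \<alpha> \<rho> = range (\<lambda>a. sc a e)" and f: "Lg (- \<alpha>) (- \<rho>) = range (\<lambda>a. sc a f)"
        and ef: "\<And>\<beta> \<mu> y. y \<in> Lg \<beta> \<mu> \<Longrightarrow> br (br e f) y = sc (of_int (pairing \<Delta> \<beta> \<alpha>)) y"
        using sl2_triple[OF \<alpha> a False] by metis
      obtain s t where "a = sc s e" "b = sc t f" using a b e f by blast
      then have "h = sc (s * t) (br e f)" by (simp add: hab br_sc_left br_sc_right mult.commute)
      moreover have "diag (sc (s * t) (br e f)) (\<lambda>\<beta>. s * t * of_int (pairing \<Delta> \<beta> \<alpha>))"
        unfolding diag_def using ef by (auto simp: pairing_add[OF \<alpha>] br_sc_left algebra_simps)
      ultimately show ?thesis by blast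
    qed
  qed
  have "zero_part 0 \<subseteq> {h. \<exists>\<xi>. diag h \<xi>}"
    unfolding zero_part_def by (rule M.span_minimal[OF _ sub]) (rule subsetI, rule CollectI, rule gen)
  then show ?thesis using h0 by auto
qed

lemma coroot_diag:
  assumes "\<alpha> \<in> \<Delta> - {0}"
  shows "\<exists>h\<in>Lg 0 0. diag h (\<lambda>\<beta>. of_int (pairing \<Delta> \<beta> \<alpha>))"
proof -
  have "\<alpha> \<in> \<Delta>" using assms by simp
  then obtain lam x where x: "x \<in> Lg \<alpha> lam" "x \<noteq> 0" by (rule root_Lg_nonzero)
  obtain e f where "e \<in> Lg \<alpha> lam" "f \<in> Lg (- \<alpha>) (- lam)"
    and ef: "\<And>\<beta> \<mu> y. y \<in> Lg \<beta> \<mu> \<Longrightarrow> br (br e f) y = sc (of_int (pairing \<Delta> \<beta> \<alpha>)) y"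
    using sl2_triple[OF assms x] by metis
  then have "br e f \<in> Lg 0 0" using br_Lg[of e \<alpha> lam f "- \<alpha>" "- lam"] by simp
  moreover have "diag (br e f) (\<lambda>\<beta>. of_int (pairing \<Delta> \<beta> \<alpha>))"
    by (rule sl2_diag[OF assms]) (rule ef)
  ultimately show ?thesis by (rule bexI[rotated])
qed

text \<open>The elements [e, f] already suffice: their weights are the pairings with the coroots,
  which are nondegenerate on the span of the roots, and integers embed in \<open>'k\<close>.\<close>

lemma diag_separates:
  assumes "\<beta> \<in> zspan \<Delta>" and "\<And>h \<xi>. h \<in> Lg 0 0 \<Longrightarrow> diag h \<xi> \<Longrightarrow> \<xi> \<beta> = 0"
  shows "\<beta> = 0"
proof (rule I.cr_nondegenerate)
  show "\<beta> \<in> span (ind_roots \<Delta>)"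
    using assms(1) unfolding zspan_eq_ind
    by (induction rule: gen_subgroup_induct) (auto intro: span_base span_zero span_add span_neg)
next
  fix \<alpha> assume "\<alpha> \<in> ind_roots \<Delta>"
  then have \<alpha>: "\<alpha> \<in> \<Delta> - {0}" by (auto simp: ind_roots_def)
  then have "of_int (pairing \<Delta> \<beta> \<alpha>) = (0::'k)" using coroot_diag[OF \<alpha>] assms(2) by blast
  then show "coroot \<Delta> \<alpha> \<beta> = 0" using pairing_eq[OF \<alpha> assms(1)] by simp
qed

text \<open>The degrees of the nonzero root spaces already generate \<open>Q \<times> \<Lambda>\<close>: by (LT2)(i) they give
  all of \<open>Q \<times> 0\<close>, and every degree of the zero root space is a sum of two of them.\<close>

lemma degrees_generate_pairs:
  assumes S: "\<And>\<alpha> lam. \<alpha> \<in> \<Delta> - {0} \<Longrightarrow> Lg \<alpha> lam \<noteq> {0} \<Longrightarrow> (\<alpha>, lam) \<in> gen_subgroup S"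
    and "\<beta> \<in> zspan \<Delta>"
  shows "(\<beta>, lam) \<in> gen_subgroup S"
proof -
  have Q: "(\<gamma>, 0) \<in> gen_subgroup S" if "\<gamma> \<in> zspan \<Delta>" for \<gamma>
    using that unfolding zspan_eq_ind
  proof (induction rule: gen_subgroup_induct)
    case (base \<alpha>)
    then show ?case using S[of \<alpha> 0] ind_degree_0 by (auto simp: ind_roots_def)
  next
    case zero
    show ?case using gen_subgroup_zero[of S] by (simp add: zero_prod_def)
  next
    case (add x y)
    then show ?case using gen_subgroup_add[of "(x, 0)" S "(y, 0)"] by simp
  next
    case (uminus x)
    then show ?case using gen_subgroup_uminus[of "(x, 0)" S] by simp
  qed
  have L: "(0, \<mu>) \<in> gen_subgroup S" if \<alpha>: "\<alpha> \<in> \<Delta> - {0}" and x: "x \<in> Lg \<alpha> \<mu>" "x \<noteq> 0" for \<alpha> \<mu> x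
  proof -
    have "(\<alpha>, \<mu>) - (\<alpha>, 0) \<in> gen_subgroup S"
      by (rule gen_subgroup_diff[OF S[OF \<alpha>] Q[OF zspan_base]]) (use \<alpha> x in auto)
    then show ?thesis by simp
  qed
  have "(0, lam) \<in> gen_subgroup S"
  proof -
    have "lam \<in> gen_subgroup {lam. Ldeg Lg lam \<noteq> {0}}" by (simp add: degrees_generate)
    then show ?thesis
    proof (induction rule: gen_subgroup_induct)
      case (base \<mu>)
      have "\<exists>\<alpha> x. x \<in> Lg \<alpha> \<mu> \<and> x \<noteq> 0"
      proof (rule ccontr)
        assume "\<not> ?thesis"
        then have "\<And>\<alpha> x. x \<in> Lg \<alpha> \<mu> \<Longrightarrow> x = 0" by blast
        then have "Ldeg Lg \<mu> \<subseteq> {0}" unfolding Ldeg_def by (auto intro!: sum.neutral)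
        moreover have "0 \<in> Ldeg Lg \<mu>"
          unfolding Ldeg_def by (intro CollectI exI[of _ "{}"]) simp
        ultimately show False using base by auto
      qed
      then obtain \<alpha> x where x: "x \<in> Lg \<alpha> \<mu>" "x \<noteq> 0" by blast
      show ?case
      proof (cases "\<alpha> = 0")
        case False
        then show ?thesis using L[OF _ x] Lg_nonzero_root[OF x] by simp
      next
        case True
        have "x \<in> zero_part \<mu>" using hcomp_zero_part[of x \<mu>] x True by (simp add: hcomp_Lg)
        have "\<exists>\<gamma> \<rho>. \<gamma> \<in> \<Delta> - {0} \<and> (\<exists>a. a \<in> Lg \<gamma> \<rho> \<and> a \<noteq> 0) \<and> (\<exists>b. b \<in> Lg (- \<gamma>) (\<mu> - \<rho>) \<and> b \<noteq> 0)"
        proof (rule ccontr)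
          assume neg: "\<not> ?thesis"
          have "br a b = 0" if "\<gamma> \<in> \<Delta> - {0}" "a \<in> Lg \<gamma> \<rho>" "b \<in> Lg (- \<gamma>) (\<mu> - \<rho>)" for a b \<gamma> \<rho>
          proof -
            have "a = 0 \<or> b = 0" using neg that by blast
            then show ?thesis by auto
          qed
          then have "{br a b | a b \<alpha> \<rho>. \<alpha> \<in> \<Delta> - {0} \<and> a \<in> Lg \<alpha> \<rho> \<and> b \<in> Lg (- \<alpha>) (\<mu> - \<rho>)} \<subseteq> {0}"
            by blast
          then have "zero_part \<mu> \<subseteq> {0}"
            unfolding zero_part_def by (rule M.span_minimal[OF _ M.subspace_single_0])
          then show False using \<open>x \<in> zero_part \<mu>\<close> x(2) by blast
        qed
        then obtain \<gamma> \<rho> a b where *: "\<gamma> \<in> \<Delta> - {0}" "a \<in> Lg \<gamma> \<rho>" "a \<noteq> 0"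
          "b \<in> Lg (- \<gamma>) (\<mu> - \<rho>)" "b \<noteq> 0" by blast
        have "(0, \<rho>) + (0, \<mu> - \<rho>) \<in> gen_subgroup S"
          by (intro gen_subgroup_add L[OF *(1-3)] L[OF D.uminus_in[OF *(1)] *(4,5)])
        then show ?thesis by simp
      qed
    next
      case zero
      show ?case using gen_subgroup_zero[of S] by (simp add: zero_prod_def)
    next
      case (add x y)
      then show ?case using gen_subgroup_add[of "(0, x)" S "(0, y)"] by simp
    next
      case (uminus x)
      then show ?case using gen_subgroup_uminus[of "(0, x)" S] by simp
    qed
  qed
  then show ?thesis using gen_subgroup_add[OF Q[OF assms(2)], of "(0, lam)"] by simp
qed

end

lemma gen_subgroup_fst:
  assumes "x \<in> gen_subgroup (fst ` S)"
  shows "\<exists>y. (x, y) \<in> gen_subgroup S"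
  using assms
proof (induction rule: gen_subgroup_induct)
  case (base x)
  then show ?case using gen_subgroup_superset[of S] by force
next
  case zero
  show ?case using gen_subgroup_zero[of S] unfolding zero_prod_def by (rule exI)
next
  case (add x y)
  then obtain x' y' where "(x, x') \<in> gen_subgroup S" "(y, y') \<in> gen_subgroup S" by (elim exE)
  then have "(x + y, x' + y') \<in> gen_subgroup S" using gen_subgroup_add by force
  then show ?case by (rule exI)
next
  case (uminus x)
  then obtain x' where "(x, x') \<in> gen_subgroup S" by (elim exE)
  then have "(- x, - x') \<in> gen_subgroup S" using gen_subgroup_uminus by force
  then show ?case by (rule exI)
qed

context torus
begin

section \<open>Leading terms and homogeneity of root vectors\<close>

lemma sc_eq_0_D: "sc a x = 0 \<Longrightarrow> x \<noteq> 0 \<Longrightarrow> a = 0"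
  by (metis M.scale_one M.scale_scale M.scale_zero_right left_inverse)

lemma Lg_nonzeroE:
  assumes "Lg \<alpha> lam \<noteq> {0}"
  obtains x where "x \<in> Lg \<alpha> lam" "x \<noteq> 0"
  using assms Lg_0[of \<alpha> lam] by auto

lemma hcomp_diag:
  assumes "diag h \<xi>"
  shows "hcomp (br h y) \<beta> \<mu> = sc (\<xi> \<beta>) (hcomp y \<beta> \<mu>)"
proof -
  have "hcomp (br h y) = (\<lambda>\<beta> \<mu>. sc (\<xi> \<beta>) (hcomp y \<beta> \<mu>))"
  proof (rule hcomp_eqI[where F = "supp y"])
    have "br h y = br h (\<Sum>p\<in>supp y. case_prod (hcomp y) p)" by (simp only: sum_hcomp)
    also have "\<dots> = (\<Sum>p\<in>supp y. case p of (\<beta>, \<mu>) \<Rightarrow> sc (\<xi> \<beta>) (hcomp y \<beta> \<mu>))"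
      unfolding br_sum_right by (intro sum.cong) (auto simp: diag_Lg[OF assms hcomp_in])
    finally show "br h y = (\<Sum>p\<in>supp y. case p of (\<beta>, \<mu>) \<Rightarrow> sc (\<xi> \<beta>) (hcomp y \<beta> \<mu>))" .
    show "finite (supp y)" by (rule finite_supp)
  qed (auto simp: hcomp_in Lg_scale supp_def)
  then show ?thesis by simp
qed

lemma LgI:
  assumes "\<And>\<beta> \<mu>. hcomp y \<beta> \<mu> \<noteq> 0 \<Longrightarrow> \<beta> = \<alpha> \<and> \<mu> = lam"
  shows "y \<in> Lg \<alpha> lam"
proof -
  have "y = (\<Sum>p\<in>{(\<alpha>, lam)}. case_prod (hcomp y) p)"
    by (rule sum_hcomp_superset) (use assms in \<open>auto simp: supp_def\<close>)
  then have "y = hcomp y \<alpha> lam" by simp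
  then show ?thesis using hcomp_in by metis
qed

lemma one_dim:
  assumes "\<alpha> \<in> \<Delta> - {0}" "x \<in> Lg \<alpha> lam" "x \<noteq> 0" "y \<in> Lg \<alpha> lam"
  shows "\<exists>a. y = sc a x"
proof -
  obtain e where e: "Lg \<alpha> lam = range (\<lambda>a. sc a e)" using sl2_triple[OF assms(1-3)] by metis
  obtain s t where st: "x = sc s e" "y = sc t e" using assms(2,4) unfolding e by (elim imageE)
  have "s \<noteq> 0" using st(1) assms(3) by auto
  then have "y = sc (t / s) x" unfolding st by simp
  then show ?thesis by (rule exI)
qed

text \<open>Let \<mu> and \<nu> be the top degrees of y and z. Only the two top components
  contribute to [y, z] in degree \<mu> + \<nu>, and their bracket is nonzero by
  \<open>br_opposite_nonzero\<close>; as [y, z] has degree 0, the top degrees cancel.\<close>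

lemma leading_term:
  fixes p :: "'l \<Rightarrow> real"
  assumes p: "inj p" "\<And>x y. p (x + y) = p x + p y"
    and \<alpha>: "\<alpha> \<in> \<Delta> - {0}"
    and y: "y \<in> Lroot Lg \<alpha>" "y \<noteq> 0" and z: "z \<in> Lroot Lg (- \<alpha>)" "z \<noteq> 0"
    and yz: "br y z \<in> Lg 0 0"
  shows "\<exists>\<mu> \<nu>. \<mu> + \<nu> = 0 \<and> (\<forall>lam. hcomp y \<alpha> lam \<noteq> 0 \<longrightarrow> p lam \<le> p \<mu>) \<and> hcomp y \<alpha> \<mu> \<noteq> 0 \<and>
    (\<forall>lam. hcomp z (- \<alpha>) lam \<noteq> 0 \<longrightarrow> p lam \<le> p \<nu>) \<and> hcomp z (- \<alpha>) \<nu> \<noteq> 0"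
proof -
  have max: "\<exists>\<mu>. (\<forall>lam. hcomp w \<gamma> lam \<noteq> 0 \<longrightarrow> p lam \<le> p \<mu>) \<and> hcomp w \<gamma> \<mu> \<noteq> 0"
    if w: "w \<in> Lroot Lg \<gamma>" "w \<noteq> 0" for w \<gamma>
  proof -
    let ?M = "{lam. hcomp w \<gamma> lam \<noteq> 0}"
    have "?M \<subseteq> snd ` supp w" by (force simp: supp_def)
    then have fin: "finite ?M" using finite_supp finite_subset by (metis finite_imageI)
    obtain \<beta> \<mu> where "hcomp w \<beta> \<mu> \<noteq> 0" using hcomp_all_0[of w] w(2) by metis
    moreover have "\<beta> = \<gamma>" using calculation w(1) unfolding Lroot_iff by metis
    ultimately have ne: "?M \<noteq> {}" by blast
    have "Max (p ` ?M) \<in> p ` ?M" using fin ne by (intro Max_in) auto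
    then obtain \<nu> where \<nu>: "\<nu> \<in> ?M" "Max (p ` ?M) = p \<nu>" by (elim imageE)
    have "p lam \<le> p \<nu>" if "hcomp w \<gamma> lam \<noteq> 0" for lam
      unfolding \<nu>(2)[symmetric] using fin that by (intro Max_ge) auto
    then show ?thesis using \<nu>(1) by (intro exI[of _ \<nu>]) simp
  qed
  obtain \<mu> where \<mu>: "\<And>lam. hcomp y \<alpha> lam \<noteq> 0 \<Longrightarrow> p lam \<le> p \<mu>" "hcomp y \<alpha> \<mu> \<noteq> 0"
    using max[OF y] by metis
  obtain \<nu> where \<nu>: "\<And>lam. hcomp z (- \<alpha>) lam \<noteq> 0 \<Longrightarrow> p lam \<le> p \<nu>" "hcomp z (- \<alpha>) \<nu> \<noteq> 0"
    using max[OF z] by metis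
  let ?b = "br (hcomp y \<alpha> \<mu>) (hcomp z (- \<alpha>) \<nu>)"
  have summand: "(if fst r + fst s = 0 \<and> snd r + snd s = \<mu> + \<nu>
      then br (case_prod (hcomp y) r) (case_prod (hcomp z) s) else 0)
      = (if r = (\<alpha>, \<mu>) then if s = (- \<alpha>, \<nu>) then ?b else 0 else 0)"
    if r: "r \<in> supp y" and s: "s \<in> supp z" for r s
  proof -
    obtain \<mu>' where r': "r = (\<alpha>, \<mu>')" "hcomp y \<alpha> \<mu>' \<noteq> 0"
      using r y(1) unfolding supp_def Lroot_iff by (cases r) (metis (mono_tags, lifting) case_prodD mem_Collect_eq)
    obtain \<nu>' where s': "s = (- \<alpha>, \<nu>')" "hcomp z (- \<alpha>) \<nu>' \<noteq> 0"
      using s z(1) unfolding supp_def Lroot_iff by (cases s) (metis (mono_tags, lifting) case_prodD mem_Collect_eq)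
    have "\<mu>' = \<mu> \<and> \<nu>' = \<nu>" if "\<mu>' + \<nu>' = \<mu> + \<nu>"
    proof -
      have "p \<mu>' + p \<nu>' = p \<mu> + p \<nu>" using that p(2) by metis
      then have "p \<mu>' = p \<mu>" "p \<nu>' = p \<nu>" using \<mu>(1)[OF r'(2)] \<nu>(1)[OF s'(2)] by linarith+
      then show ?thesis using p(1) by (simp add: inj_eq)
    qed
    then show ?thesis by (auto simp: r' s')
  qed
  have mem: "(\<alpha>, \<mu>) \<in> supp y" "(- \<alpha>, \<nu>) \<in> supp z" using \<mu>(2) \<nu>(2) by (simp_all add: supp_def)
  have "hcomp (br y z) 0 (\<mu> + \<nu>) = (\<Sum>r\<in>supp y. \<Sum>s\<in>supp z.
      if r = (\<alpha>, \<mu>) then if s = (- \<alpha>, \<nu>) then ?b else 0 else 0)"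
    unfolding hcomp_br by (intro sum.cong refl summand)
  also have "\<dots> = (\<Sum>r\<in>supp y. if r = (\<alpha>, \<mu>) then ?b else 0)"
  proof (intro sum.cong refl)
    fix r
    show "(\<Sum>s\<in>supp z. if r = (\<alpha>, \<mu>) then if s = (- \<alpha>, \<nu>) then ?b else 0 else 0)
      = (if r = (\<alpha>, \<mu>) then ?b else 0)"
      using mem by (cases "r = (\<alpha>, \<mu>)") (simp_all add: finite_supp)
  qed
  also have "\<dots> = ?b" using mem by (simp add: finite_supp)
  also have "?b \<noteq> 0"
    by (rule br_opposite_nonzero[OF \<alpha> hcomp_in \<mu>(2) hcomp_in \<nu>(2)])
  finally have "\<mu> + \<nu> = 0" using hcomp_Lg[OF yz] by (metis (full_types))
  then show ?thesis using \<mu> \<nu> by (intro exI[of _ \<mu>] exI[of _ \<nu>]) simp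
qed

text \<open>Compare the leading terms for an ordering of the degrees and for the reverse ordering.\<close>

lemma homogeneous_of_bracket:
  assumes \<alpha>: "\<alpha> \<in> \<Delta> - {0}"
    and y: "y \<in> Lroot Lg \<alpha>" "y \<noteq> 0" and z: "z \<in> Lroot Lg (- \<alpha>)" "z \<noteq> 0"
    and yz: "br y z \<in> Lg 0 0"
  shows "\<exists>lam. y \<in> Lg \<alpha> lam"
proof -
  obtain p :: "'l \<Rightarrow> real" where p: "inj p" "\<And>x y. p (x + y) = p x + p y"
    using fg_free_abelian_embeds_real[OF fg_free] by metis
  have q: "inj (\<lambda>x. - p x)" "\<And>x y. - p (x + y) = - p x + - p y"
    using p by (auto simp: inj_def)
  have p0: "p 0 = 0" using p(2)[of 0 0] by simp
  obtain \<mu> \<nu> where 1: "\<mu> + \<nu> = 0" "\<forall>lam. hcomp y \<alpha> lam \<noteq> 0 \<longrightarrow> p lam \<le> p \<mu>" "hcomp y \<alpha> \<mu> \<noteq> 0"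
    "\<forall>lam. hcomp z (- \<alpha>) lam \<noteq> 0 \<longrightarrow> p lam \<le> p \<nu>" "hcomp z (- \<alpha>) \<nu> \<noteq> 0"
    using leading_term[OF p \<alpha> y z yz] by (elim exE conjE)
  obtain \<mu>' \<nu>' where 2: "\<mu>' + \<nu>' = 0" "\<forall>lam. hcomp y \<alpha> lam \<noteq> 0 \<longrightarrow> - p lam \<le> - p \<mu>'"
    "hcomp y \<alpha> \<mu>' \<noteq> 0" "\<forall>lam. hcomp z (- \<alpha>) lam \<noteq> 0 \<longrightarrow> - p lam \<le> - p \<nu>'" "hcomp z (- \<alpha>) \<nu>' \<noteq> 0"
    using leading_term[OF q \<alpha> y z yz] by (elim exE conjE)
  have "p \<mu> + p \<nu> = 0" "p \<mu>' + p \<nu>' = 0" using 1(1) 2(1) p(2) p0 by metis+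
  moreover have "p \<mu>' \<le> p \<mu>" "p \<nu>' \<le> p \<nu>" using 1(2,4) 2(3,5) by simp_all
  ultimately have eq: "p \<mu>' = p \<mu>" by linarith
  have "y \<in> Lg \<alpha> \<mu>"
  proof (rule LgI)
    fix \<beta> lam assume ne: "hcomp y \<beta> lam \<noteq> 0"
    then have \<beta>: "\<beta> = \<alpha>" using y(1) unfolding Lroot_iff by metis
    then have "p lam \<le> p \<mu>" "p \<mu>' \<le> p lam" using 1(2) 2(2) ne by auto
    then have "p lam = p \<mu>" using eq by linarith
    then show "\<beta> = \<alpha> \<and> lam = \<mu>" using \<beta> p(1) by (simp add: inj_eq)
  qed
  then show ?thesis by (rule exI)
qed

end

section \<open>Isomorphisms preserving the degree zero part of the zero root space\<close>

locale torus_iso =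
  A: torus sc br \<Delta> Lg + B: torus sc' br' \<Delta>' Lg'
  for sc :: "'k::field_char_0 \<Rightarrow> 'v::ab_group_add \<Rightarrow> 'v"
    and br :: "'v \<Rightarrow> 'v \<Rightarrow> 'v"
    and \<Delta> :: "'r::real_vector set"
    and Lg :: "'r \<Rightarrow> 'l::ab_group_add \<Rightarrow> 'v set"
    and sc' :: "'k \<Rightarrow> 'w::ab_group_add \<Rightarrow> 'w"
    and br' :: "'w \<Rightarrow> 'w \<Rightarrow> 'w"
    and \<Delta>' :: "'r2::real_vector set"
    and Lg' :: "'r2 \<Rightarrow> 'l2::ab_group_add \<Rightarrow> 'w set" +
  fixes \<phi> :: "'v \<Rightarrow> 'w"
  assumes iso: "alg_iso sc br sc' br' \<phi>"
    and image_Lg_0: "\<phi> ` Lg 0 0 = Lg' 0 0"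
begin

section \<open>Images of homogeneous root vectors\<close>

lemma phi_bij: "bij \<phi>"
  and phi_add: "\<phi> (x + y) = \<phi> x + \<phi> y"
  and phi_sc: "\<phi> (sc a x) = sc' a (\<phi> x)"
  and phi_br: "\<phi> (br x y) = br' (\<phi> x) (\<phi> y)"
  using iso by (simp_all add: alg_iso_def)

lemma phi_0 [simp]: "\<phi> 0 = 0"
  using phi_add[of 0 0] by simp

lemma phi_eq_0_iff [simp]: "\<phi> x = 0 \<longleftrightarrow> x = 0"
  using phi_bij phi_0 by (metis bij_def injD)

lemma phi_sum: "\<phi> (\<Sum>i\<in>S. f i) = (\<Sum>i\<in>S. \<phi> (f i))"
  by (rule additive_sum) (rule phi_add)

lemma phi_Lg_0: "h \<in> Lg 0 0 \<Longrightarrow> \<phi> h \<in> Lg' 0 0"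
  using image_Lg_0 by auto

lemma Lg'_0_cases:
  assumes "h' \<in> Lg' 0 0"
  obtains h where "h \<in> Lg 0 0" "h' = \<phi> h"
  using assms unfolding image_Lg_0[symmetric] by (elim imageE)

text \<open>The image of x is an eigenvector of \<open>\<phi> h\<close> with eigenvalue
  \<open>\<xi> \<alpha>\<close>, and so is each of its nonzero components, on which
  \<open>\<phi> h\<close> acts by \<open>\<xi>' \<beta>\<close>.\<close>

lemma weight_match:
  assumes x: "x \<in> Lg \<alpha> lam" and ne: "B.hcomp (\<phi> x) \<beta> \<mu> \<noteq> 0"
    and d: "A.diag h \<xi>" "B.diag (\<phi> h) \<xi>'"
  shows "\<xi>' \<beta> = \<xi> \<alpha>"
proof -
  have "br' (\<phi> h) (\<phi> x) = sc' (\<xi> \<alpha>) (\<phi> x)"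
    using A.diag_Lg[OF d(1) x] by (simp add: phi_sc flip: phi_br)
  then have "sc' (\<xi>' \<beta>) (B.hcomp (\<phi> x) \<beta> \<mu>) = sc' (\<xi> \<alpha>) (B.hcomp (\<phi> x) \<beta> \<mu>)"
    using B.hcomp_diag[OF d(2), of "\<phi> x" \<beta> \<mu>] by (simp add: B.hcomp_sc)
  then have "sc' (\<xi>' \<beta> - \<xi> \<alpha>) (B.hcomp (\<phi> x) \<beta> \<mu>) = 0"
    by (simp add: B.M.scale_left_diff_distrib)
  then have "\<xi>' \<beta> - \<xi> \<alpha> = 0" using ne by (rule B.sc_eq_0_D)
  then show ?thesis by simp
qed

lemma hcomp_zspan: "B.hcomp y \<beta> \<mu> \<noteq> 0 \<Longrightarrow> \<beta> \<in> zspan \<Delta>'"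
  by (rule B.zspan_base[OF B.Lg_nonzero_root[OF B.hcomp_in]])

text \<open>Two roots occurring in \<open>\<phi> x\<close> take equal values on the whole of
  \<open>Lg' 0 0\<close>, because every element of it is the image of some h; such roots coincide by
  \<open>diag_separates\<close>.\<close>

lemma image_root:
  assumes x: "x \<in> Lg \<alpha> lam" "x \<noteq> 0"
  obtains \<alpha>' \<mu> where "\<phi> x \<in> Lroot Lg' \<alpha>'" "B.hcomp (\<phi> x) \<alpha>' \<mu> \<noteq> 0"
proof -
  have "\<phi> x \<noteq> 0" using x by simp
  then obtain \<alpha>' \<mu> where ne: "B.hcomp (\<phi> x) \<alpha>' \<mu> \<noteq> 0" using B.hcomp_all_0 by metis
  have "\<beta> = \<alpha>'" if ne': "B.hcomp (\<phi> x) \<beta> \<nu> \<noteq> 0" for \<beta> \<nu>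
  proof -
    have z: "\<beta> \<in> zspan \<Delta>'" "- \<alpha>' \<in> zspan \<Delta>'" "\<alpha>' \<in> zspan \<Delta>'"
      using hcomp_zspan[OF ne] hcomp_zspan[OF ne'] B.zspan_uminus by simp_all
    have "\<beta> + - \<alpha>' = 0"
    proof (rule B.diag_separates)
      show "\<beta> + - \<alpha>' \<in> zspan \<Delta>'" by (rule B.zspan_add[OF z(1,2)])
      fix h' \<xi>' assume h': "h' \<in> Lg' 0 0" "B.diag h' \<xi>'"
      obtain h where h: "h \<in> Lg 0 0" "h' = \<phi> h" using Lg'_0_cases[OF h'(1)] .
      obtain \<xi> where \<xi>: "A.diag h \<xi>" using A.diag_exists[OF h(1)] by (elim exE)
      have "\<xi>' \<beta> = \<xi>' \<alpha>'"
        using weight_match[OF x(1) ne \<xi> h'(2)[unfolded h(2)]]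
          weight_match[OF x(1) ne' \<xi> h'(2)[unfolded h(2)]] by simp
      then show "\<xi>' (\<beta> + - \<alpha>') = 0"
        using B.diag_add[OF h'(2) z(1,2)] B.diag_uminus[OF h'(2) z(3)] by simp
    qed
    then show ?thesis by simp
  qed
  then have "\<phi> x \<in> Lroot Lg' \<alpha>'" unfolding B.Lroot_iff by metis
  then show thesis using ne by (rule that)
qed

text \<open>Choose f in the opposite degree. The roots of \<open>\<phi> x\<close> and
  \<open>\<phi> f\<close> have opposite weights, so they are opposite, and the bracket of the images
  lies in \<open>Lg' 0 0\<close>; \<open>homogeneous_of_bracket\<close> then applies.\<close>

lemma homogeneous_image:
  assumes \<alpha>: "\<alpha> \<in> \<Delta> - {0}" and x: "x \<in> Lg \<alpha> lam" "x \<noteq> 0"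
  obtains \<alpha>' lam' where "\<alpha>' \<in> \<Delta>' - {0}" "\<phi> x \<in> Lg' \<alpha>' lam'"
proof -
  obtain e f where e: "e \<in> Lg \<alpha> lam" "Lg \<alpha> lam = range (\<lambda>a. sc a e)"
    and f: "f \<in> Lg (- \<alpha>) (- lam)"
    and h: "\<And>\<beta> \<mu> y. y \<in> Lg \<beta> \<mu> \<Longrightarrow> br (br e f) y = sc (of_int (pairing \<Delta> \<beta> \<alpha>)) y"
    using A.sl2_triple[OF \<alpha> x] by metis
  have hx: "br (br e f) x = sc 2 x" using h[OF x(1)] A.pairing_self[OF \<alpha>] by simp
  have "sc 2 x \<noteq> 0" using A.sc_eq_0_D[of 2 x] x(2) by auto
  then have "br e f \<noteq> 0" using hx by auto
  then have f0: "f \<noteq> 0" by auto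
  obtain a where a: "x = sc a e" using e(2) x(1) by blast
  have xf: "br x f = sc a (br e f)" by (simp add: a A.br_sc_left)
  have "br x f \<in> Lg 0 0" using A.br_Lg[OF x(1) f] by simp
  then have xf0: "br' (\<phi> x) (\<phi> f) \<in> Lg' 0 0" using phi_Lg_0 phi_br by metis
  have ef0: "br e f \<in> Lg 0 0" using A.br_Lg[OF e(1) f] by simp
  obtain \<alpha>' \<mu> where \<alpha>': "\<phi> x \<in> Lroot Lg' \<alpha>'" "B.hcomp (\<phi> x) \<alpha>' \<mu> \<noteq> 0"
    by (rule image_root[OF x])
  obtain \<beta>' \<nu> where \<beta>': "\<phi> f \<in> Lroot Lg' \<beta>'" "B.hcomp (\<phi> f) \<beta>' \<nu> \<noteq> 0"
    by (rule image_root[OF f f0])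
  have z: "\<alpha>' \<in> zspan \<Delta>'" "\<beta>' \<in> zspan \<Delta>'" "\<alpha> \<in> zspan \<Delta>"
    using hcomp_zspan \<alpha>'(2) \<beta>'(2) \<alpha> A.zspan_base by simp_all
  have "\<beta>' + \<alpha>' = 0"
  proof (rule B.diag_separates)
    show "\<beta>' + \<alpha>' \<in> zspan \<Delta>'" by (rule B.zspan_add[OF z(2,1)])
    fix h' \<xi>' assume h': "h' \<in> Lg' 0 0" "B.diag h' \<xi>'"
    obtain h where h: "h \<in> Lg 0 0" "h' = \<phi> h" using Lg'_0_cases[OF h'(1)] .
    obtain \<xi> where \<xi>: "A.diag h \<xi>" using A.diag_exists[OF h(1)] by (elim exE)
    have "\<xi>' \<alpha>' = \<xi> \<alpha>" "\<xi>' \<beta>' = \<xi> (- \<alpha>)"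
      using weight_match[OF x(1) \<alpha>'(2) \<xi> h'(2)[unfolded h(2)]]
        weight_match[OF f \<beta>'(2) \<xi> h'(2)[unfolded h(2)]] by simp_all
    then show "\<xi>' (\<beta>' + \<alpha>') = 0"
      using B.diag_add[OF h'(2) z(2,1)] A.diag_uminus[OF \<xi> z(3)] by simp
  qed
  then have \<beta>'_eq: "\<beta>' = - \<alpha>'" by (simp add: eq_neg_iff_add_eq_0)
  have "\<alpha>' \<noteq> 0"
  proof
    \<comment> \<open>The image of [e, f] has weight 2 at \<alpha>', whereas every weight vanishes
      at 0.\<close>
    assume 0: "\<alpha>' = 0"
    obtain \<xi>' where \<xi>': "B.diag (\<phi> (br e f)) \<xi>'"
      using B.diag_exists[OF phi_Lg_0[OF ef0]] by (elim exE)
    have d: "A.diag (br e f) (\<lambda>\<beta>. of_int (pairing \<Delta> \<beta> \<alpha>))"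
      by (rule A.sl2_diag[OF \<alpha>]) (rule h)
    have "\<xi>' \<alpha>' = 2" using weight_match[OF x(1) \<alpha>'(2) d \<xi>'] A.pairing_self[OF \<alpha>] by simp
    then show False using B.diag_0[OF \<xi>'] 0 by simp
  qed
  moreover have "\<alpha>' \<in> \<Delta>'" by (rule B.Lg_nonzero_root[OF B.hcomp_in \<alpha>'(2)])
  ultimately have \<alpha>'_root: "\<alpha>' \<in> \<Delta>' - {0}" by simp
  obtain lam' where "\<phi> x \<in> Lg' \<alpha>' lam'"
    using B.homogeneous_of_bracket[OF \<alpha>'_root \<alpha>'(1) _ \<beta>'(1)[unfolded \<beta>'_eq] _ xf0] x(2) f0
    by auto
  then show thesis by (rule that[OF \<alpha>'_root])
qed


section \<open>The correspondence of degrees and the subgroup it generates\<close>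

definition TT :: "(('r \<times> 'l) \<times> ('r2 \<times> 'l2)) set" where
  "TT = {((\<alpha>, lam), (\<alpha>', lam')) | \<alpha> lam \<alpha>' lam'.
     \<alpha> \<in> \<Delta> - {0} \<and> Lg \<alpha> lam \<noteq> {0} \<and> \<phi> ` Lg \<alpha> lam \<subseteq> Lg' \<alpha>' lam'}"

definition GG :: "(('r \<times> 'l) \<times> ('r2 \<times> 'l2)) set" where
  "GG = gen_subgroup TT"

text \<open>Nonzero root spaces are at most one-dimensional in each degree, so one nonzero vector
  decides for the whole space.\<close>

lemma TT_I:
  assumes "\<alpha> \<in> \<Delta> - {0}" "x \<in> Lg \<alpha> lam" "x \<noteq> 0" "\<phi> x \<in> Lg' \<alpha>' lam'"
  shows "((\<alpha>, lam), (\<alpha>', lam')) \<in> TT"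
proof -
  have "\<phi> y \<in> Lg' \<alpha>' lam'" if y: "y \<in> Lg \<alpha> lam" for y
  proof -
    obtain a where "y = sc a x" using A.one_dim[OF assms(1-3) y] by (elim exE)
    then show ?thesis using assms(4) by (simp add: phi_sc B.Lg_scale)
  qed
  then have "\<phi> ` Lg \<alpha> lam \<subseteq> Lg' \<alpha>' lam'" by (rule image_subsetI)
  moreover have "Lg \<alpha> lam \<noteq> {0}" using assms(2,3) by auto
  ultimately show ?thesis unfolding TT_def using assms(1) by simp
qed

lemma TT_E:
  assumes "((\<alpha>, lam), (\<alpha>', lam')) \<in> TT"
  obtains x where "\<alpha> \<in> \<Delta> - {0}" "x \<in> Lg \<alpha> lam" "x \<noteq> 0" "\<phi> x \<in> Lg' \<alpha>' lam'" "\<alpha>' \<in> \<Delta>' - {0}"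
proof -
  have *: "\<alpha> \<in> \<Delta> - {0}" "Lg \<alpha> lam \<noteq> {0}" "\<phi> ` Lg \<alpha> lam \<subseteq> Lg' \<alpha>' lam'"
    using assms unfolding TT_def by simp_all
  obtain x where x: "x \<in> Lg \<alpha> lam" "x \<noteq> 0" by (rule A.Lg_nonzeroE[OF *(2)])
  have phi: "\<phi> x \<in> Lg' \<alpha>' lam'" "\<phi> x \<noteq> 0" using *(3) x by auto
  obtain \<beta> \<mu> where \<beta>: "\<beta> \<in> \<Delta>' - {0}" "\<phi> x \<in> Lg' \<beta> \<mu>" by (rule homogeneous_image[OF *(1) x])
  then have "\<alpha>' \<in> \<Delta>' - {0}" using B.Lg_disjoint[OF phi(1) \<beta>(2) phi(2)] by simp
  then show thesis by (rule that[OF *(1) x phi(1)])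
qed

lemma TT_image:
  "((\<alpha>, lam), (\<alpha>', lam')) \<in> TT \<Longrightarrow> x \<in> Lg \<alpha> lam \<Longrightarrow> \<phi> x \<in> Lg' \<alpha>' lam'"
  unfolding TT_def by auto

lemma TT_exists:
  assumes "\<alpha> \<in> \<Delta> - {0}" "x \<in> Lg \<alpha> lam" "x \<noteq> 0"
  obtains \<alpha>' lam' where "((\<alpha>, lam), (\<alpha>', lam')) \<in> TT"
  by (rule homogeneous_image[OF assms]) (rule that, rule TT_I[OF assms])

lemma TT_fun:
  assumes "(p, (\<alpha>', lam')) \<in> TT" "(p, (\<alpha>'', lam'')) \<in> TT"
  shows "\<alpha>' = \<alpha>'' \<and> lam' = lam''"
proof -
  obtain \<alpha> lam where p: "p = (\<alpha>, lam)" by (cases p)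
  obtain x where x: "x \<in> Lg \<alpha> lam" "x \<noteq> 0" "\<phi> x \<in> Lg' \<alpha>' lam'"
    using TT_E[OF assms(1)[unfolded p]] by metis
  show ?thesis
    by (rule B.Lg_disjoint[OF x(3) TT_image[OF assms(2)[unfolded p] x(1)]]) (use x in simp)
qed

text \<open>The images of e and f have a nonzero bracket. It is homogeneous of the sum of their
  degrees and also lies in \<open>Lg' 0 0\<close>, so that sum is zero.\<close>

lemma TT_minus:
  assumes "((\<alpha>, lam), (\<alpha>', lam')) \<in> TT"
  shows "((- \<alpha>, - lam), (- \<alpha>', - lam')) \<in> TT"
proof -
  obtain x where \<alpha>: "\<alpha> \<in> \<Delta> - {0}" and x: "x \<in> Lg \<alpha> lam" "x \<noteq> 0"
    using TT_E[OF assms] by metis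
  obtain e f where e: "e \<in> Lg \<alpha> lam" and f: "f \<in> Lg (- \<alpha>) (- lam)"
    and h: "\<And>\<beta> \<mu> y. y \<in> Lg \<beta> \<mu> \<Longrightarrow> br (br e f) y = sc (of_int (pairing \<Delta> \<beta> \<alpha>)) y"
    using A.sl2_triple[OF \<alpha> x] by metis
  have hx: "br (br e f) x = sc 2 x" using h[OF x(1)] A.pairing_self[OF \<alpha>] by simp
  have "sc 2 x \<noteq> 0" using A.sc_eq_0_D[of 2 x] x(2) by auto
  then have ef: "br e f \<noteq> 0" using hx by auto
  then have f0: "f \<noteq> 0" by auto
  obtain \<beta> \<mu> where \<beta>: "((- \<alpha>, - lam), (\<beta>, \<mu>)) \<in> TT"
    by (rule TT_exists[OF A.D.uminus_in[OF \<alpha>] f f0])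
  have "br' (\<phi> e) (\<phi> f) \<in> Lg' (\<alpha>' + \<beta>) (lam' + \<mu>)"
    by (intro B.br_Lg TT_image[OF assms e] TT_image[OF \<beta> f])
  moreover have "br e f \<in> Lg 0 0" using A.br_Lg[OF e f] by simp
  then have "br' (\<phi> e) (\<phi> f) \<in> Lg' 0 0" unfolding phi_br[symmetric] by (rule phi_Lg_0)
  moreover have "br' (\<phi> e) (\<phi> f) \<noteq> 0" using ef by (simp flip: phi_br)
  ultimately have "\<alpha>' + \<beta> = 0 \<and> lam' + \<mu> = 0" by (rule B.Lg_disjoint)
  then have "\<beta> = - \<alpha>'" "\<mu> = - lam'" by (metis add.inverse_unique)+
  then show ?thesis using \<beta> by simp
qed

lemma phi_br_pow: "\<phi> ((br z ^^ n) x) = (br' (\<phi> z) ^^ n) (\<phi> x)"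
  by (induction n) (simp_all add: phi_br)

text \<open>\<open>\<phi>\<close> carries the n-fold bracket of \<open>br_pow_nonzero\<close> to the
  n-fold bracket of the images. The target is written with the source integer n, because the
  pairings of the two root systems have not been compared.\<close>

lemma TT_reflect_aux:
  assumes a: "((\<alpha>, lam), (\<alpha>', lam')) \<in> TT" and b: "((\<beta>, \<mu>), (\<beta>', \<mu>')) \<in> TT"
    and n: "pairing \<Delta> \<beta> \<alpha> = - int n"
  shows "((A.D.reflect \<alpha> \<beta>, zsc (int n) lam + \<mu>), (zsc (int n) \<alpha>' + \<beta>', zsc (int n) lam' + \<mu>')) \<in> TT"
proof -
  obtain z where \<alpha>: "\<alpha> \<in> \<Delta> - {0}" and z: "z \<in> Lg \<alpha> lam" "z \<noteq> 0" "\<phi> z \<in> Lg' \<alpha>' lam'"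
    using TT_E[OF a] by metis
  obtain x where \<beta>: "\<beta> \<in> \<Delta> - {0}" and x: "x \<in> Lg \<beta> \<mu>" "x \<noteq> 0" "\<phi> x \<in> Lg' \<beta>' \<mu>'"
    using TT_E[OF b] by metis
  have "real_of_int (pairing \<Delta> \<beta> \<alpha>) = coroot \<Delta> \<alpha> \<beta>"
    using \<beta> by (intro A.pairing_eq[OF \<alpha>] A.zspan_base) simp
  then have "coroot \<Delta> \<alpha> \<beta> = - real n" using n by simp
  then have refl: "zsc (int n) \<alpha> + \<beta> = A.D.reflect \<alpha> \<beta>"
    by (simp add: A.D.reflect_def zsc_real_vector)
  have "(br z ^^ n) x \<in> Lg (A.D.reflect \<alpha> \<beta>) (zsc (int n) lam + \<mu>)"
    using A.br_pow_Lg[OF z(1) x(1), of n] unfolding refl .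
  moreover have "(br z ^^ n) x \<noteq> 0"
    by (rule A.br_pow_nonzero[OF \<alpha> z(1,2) x(1,2) n])
  moreover have "\<phi> ((br z ^^ n) x) \<in> Lg' (zsc (int n) \<alpha>' + \<beta>') (zsc (int n) lam' + \<mu>')"
    unfolding phi_br_pow by (rule B.br_pow_Lg[OF z(3) x(3)])
  ultimately show ?thesis by (rule TT_I[OF A.D.reflect_in[OF \<alpha> \<beta>]])
qed

text \<open>For a positive pairing, use the negated pair of \<open>TT_minus\<close>: it defines the
  same reflection and has a negative pairing with \<beta>.\<close>

lemma TT_reflect:
  assumes a: "((\<alpha>, lam), (\<alpha>', lam')) \<in> TT" and b: "((\<beta>, \<mu>), (\<beta>', \<mu>')) \<in> TT"
  defines "n \<equiv> pairing \<Delta> \<beta> \<alpha>"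
  shows "((A.D.reflect \<alpha> \<beta>, \<mu> - zsc n lam), (\<beta>' - zsc n \<alpha>', \<mu>' - zsc n lam')) \<in> TT"
proof -
  have \<alpha>: "\<alpha> \<in> \<Delta> - {0}" and \<beta>: "\<beta> \<in> \<Delta> - {0}" using TT_E[OF a] TT_E[OF b] by metis+
  show ?thesis
  proof (cases "n \<le> 0")
    case True
    then have "pairing \<Delta> \<beta> \<alpha> = - int (nat (- n))" by (simp add: n_def)
    from TT_reflect_aux[OF a b this] True show ?thesis
      by (simp add: zsc_uminus_left add.commute)
  next
    case False
    have z: "\<beta> \<in> zspan \<Delta>" using \<beta> A.zspan_base by simp
    have "real_of_int (pairing \<Delta> \<beta> (- \<alpha>)) = real_of_int (- n)"
      using A.pairing_eq[OF A.D.uminus_in[OF \<alpha>] z] A.pairing_eq[OF \<alpha> z] A.coroot_uminus[OF \<alpha> \<beta>]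
      by (simp add: n_def)
    then have "pairing \<Delta> \<beta> (- \<alpha>) = - int (nat n)" using False by linarith
    from TT_reflect_aux[OF TT_minus[OF a] b this] False
    have "((A.D.reflect (- \<alpha>) \<beta>, \<mu> - zsc n lam), (\<beta>' - zsc n \<alpha>', \<mu>' - zsc n lam')) \<in> TT"
      by (simp add: zsc_uminus_right)
    moreover have "A.D.reflect (- \<alpha>) \<beta> = A.D.reflect \<alpha> \<beta>"
      by (simp add: A.D.reflect_def A.coroot_uminus[OF \<alpha> \<beta>])
    ultimately show ?thesis by simp
  qed
qed

lemma TT_GG: "p \<in> TT \<Longrightarrow> p \<in> GG"
  unfolding GG_def using gen_subgroup_superset by (rule subsetD)

lemma GG_diff: "(p, p') \<in> GG \<Longrightarrow> (q, q') \<in> GG \<Longrightarrow> (p - q, p' - q') \<in> GG"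
  unfolding GG_def using gen_subgroup_diff[of "(p, p')" TT "(q, q')"] by simp

lemma GG_add: "(p, p') \<in> GG \<Longrightarrow> (q, q') \<in> GG \<Longrightarrow> (p + q, p' + q') \<in> GG"
  unfolding GG_def using gen_subgroup_add[of "(p, p')" TT "(q, q')"] by simp

text \<open>\<open>weight_match\<close> gives the relation on generators, and both weights are
  additive. This controls the root part of the target in terms of the root part of the
  source.\<close>

lemma GG_weights:
  assumes "((\<beta>, lam), (\<beta>', lam')) \<in> GG"
  shows "\<beta> \<in> zspan \<Delta>" "\<beta>' \<in> zspan \<Delta>'"
    and "A.diag h \<xi> \<Longrightarrow> B.diag (\<phi> h) \<xi>' \<Longrightarrow> \<xi>' \<beta>' = \<xi> \<beta>"
proof -
  define P where "P = (\<lambda>t :: ('r \<times> 'l) \<times> ('r2 \<times> 'l2). fst (fst t) \<in> zspan \<Delta> \<and> fst (snd t) \<in> zspan \<Delta>' \<and>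
    (\<forall>h \<xi> \<xi>'. A.diag h \<xi> \<longrightarrow> B.diag (\<phi> h) \<xi>' \<longrightarrow> \<xi>' (fst (snd t)) = \<xi> (fst (fst t))))"
  have "P t" if "t \<in> GG" for t
    using that unfolding GG_def
  proof (induction rule: gen_subgroup_induct)
    case (base t)
    obtain \<alpha> lam \<alpha>' lam' where t: "t = ((\<alpha>, lam), (\<alpha>', lam'))" by (metis surj_pair)
    obtain x where x: "\<alpha> \<in> \<Delta> - {0}" "x \<in> Lg \<alpha> lam" "x \<noteq> 0" "\<phi> x \<in> Lg' \<alpha>' lam'" "\<alpha>' \<in> \<Delta>' - {0}"
      using TT_E[OF base[unfolded t]] .
    have "B.hcomp (\<phi> x) \<alpha>' lam' \<noteq> 0" using x by (simp add: B.hcomp_Lg)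
    then show ?case unfolding P_def t using weight_match[OF x(2)] x(1,5)
      by (auto intro: A.zspan_base B.zspan_base)
  next
    case zero
    show ?case unfolding P_def by (auto simp: A.diag_0 B.diag_0 A.zspan_0 B.zspan_0)
  next
    case (add s t)
    then show ?case unfolding P_def
      by (auto simp: A.diag_add B.diag_add A.zspan_add B.zspan_add) metis
  next
    case (uminus t)
    then show ?case unfolding P_def
      by (auto simp: A.diag_uminus B.diag_uminus A.zspan_uminus B.zspan_uminus)
  qed
  from this[OF assms] show "\<beta> \<in> zspan \<Delta>" "\<beta>' \<in> zspan \<Delta>'"
    and "A.diag h \<xi> \<Longrightarrow> B.diag (\<phi> h) \<xi>' \<Longrightarrow> \<xi>' \<beta>' = \<xi> \<beta>"
    by (auto simp: P_def)
qed

text \<open>All weights of \<beta>' vanish, since every element of \<open>Lg' 0 0\<close> comes from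
  some h and the source root is 0.\<close>

lemma GG_root:
  assumes "((0, lam), (\<beta>', lam')) \<in> GG"
  shows "\<beta>' = 0"
proof (rule B.diag_separates)
  show "\<beta>' \<in> zspan \<Delta>'" by (rule GG_weights(2)[OF assms])
  fix h' \<xi>' assume h': "h' \<in> Lg' 0 0" "B.diag h' \<xi>'"
  obtain h where h: "h \<in> Lg 0 0" "h' = \<phi> h" using Lg'_0_cases[OF h'(1)] .
  obtain \<xi> where \<xi>: "A.diag h \<xi>" using A.diag_exists[OF h(1)] by (elim exE)
  show "\<xi>' \<beta>' = 0"
    using GG_weights(3)[OF assms \<xi> h'(2)[unfolded h(2)]] A.diag_0[OF \<xi>] by simp
qed

text \<open>Reduction to \<open>graph_functional\<close>: both degree groups are embedded in the
  reals and the target root is forgotten.\<close>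

lemma GG_degree:
  assumes "((0, 0), (0, lam')) \<in> GG"
  shows "lam' = 0"
proof -
  obtain p :: "'l \<Rightarrow> real" where p: "inj p" "\<And>x y. p (x + y) = p x + p y"
    using fg_free_abelian_embeds_real[OF A.fg_free] by metis
  obtain p' :: "'l2 \<Rightarrow> real" where p': "inj p'" "\<And>x y. p' (x + y) = p' x + p' y"
    using fg_free_abelian_embeds_real[OF B.fg_free] by metis
  have p0: "p 0 = 0" "p' 0 = 0" using p(2)[of 0 0] p'(2)[of 0 0] by simp_all
  have pd: "p (x - y) = p x - p y" "p' (x' - y') = p' x' - p' y'" for x y x' y'
    using p(2)[of "x - y" y] p'(2)[of "x' - y'" y'] by simp_all
  have pz: "p (zsc n x) = of_int n * p x" "p' (zsc n x') = of_int n * p' x'" for n x x'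
    using additive_zsc[of p, OF p(2)] additive_zsc[of p', OF p'(2)] by (simp_all add: zsc_real)
  have pm: "p (- x) = - p x" for x using pd(1)[of 0 x] p0 by simp
  \<comment> \<open>Indivisible roots only, since these are the roots over which source degree 0 is
    guaranteed to occur.\<close>
  define T where "T = {(\<alpha>, p lam, p' lam') | \<alpha> lam lam'. \<alpha> \<in> ind_roots \<Delta> \<and>
    (\<exists>\<alpha>'. ((\<alpha>, lam), (\<alpha>', lam')) \<in> TT)}"
  have T_I: "(\<alpha>, p lam, p' lam') \<in> T"
    if "\<alpha> \<in> ind_roots \<Delta>" "((\<alpha>, lam), (\<alpha>', lam')) \<in> TT" for \<alpha> lam \<alpha>' lam'
    unfolding T_def using that by auto
  have ind: "\<alpha> \<in> \<Delta> - {0}" if "\<alpha> \<in> ind_roots \<Delta>" for \<alpha> using that by (simp add: ind_roots_def)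
  interpret graph_over_roots "ind_roots \<Delta>" "coroot \<Delta>" T
  proof (intro graph_over_roots.intro A.irr_ind graph_over_roots_axioms.intro)
    show "\<alpha> \<in> ind_roots \<Delta>" if "(\<alpha>, a, b) \<in> T" for \<alpha> a b
      using that unfolding T_def by auto
  next
    fix \<alpha> a b \<beta> x y
    assume t: "(\<alpha>, a, b) \<in> T" "(\<beta>, x, y) \<in> T"
    obtain lam \<alpha>' lam' where 1: "a = p lam" "b = p' lam'" "\<alpha> \<in> ind_roots \<Delta>"
      "((\<alpha>, lam), (\<alpha>', lam')) \<in> TT" using t(1) unfolding T_def by auto
    obtain \<mu> \<beta>' \<mu>' where 2: "x = p \<mu>" "y = p' \<mu>'" "\<beta> \<in> ind_roots \<Delta>"
      "((\<beta>, \<mu>), (\<beta>', \<mu>')) \<in> TT" using t(2) unfolding T_def by auto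
    have cr: "real_of_int (pairing \<Delta> \<beta> \<alpha>) = coroot \<Delta> \<alpha> \<beta>"
      using ind[OF 2(3)] by (intro A.pairing_eq[OF ind[OF 1(3)]] A.zspan_base) simp
    show "(A.I.reflect \<alpha> \<beta>, x - coroot \<Delta> \<alpha> \<beta> * a, y - coroot \<Delta> \<alpha> \<beta> * b) \<in> T"
      using T_I[OF A.ind_roots_reflect[OF ind[OF 1(3)] 2(3)] TT_reflect[OF 1(4) 2(4)]]
      unfolding 1(1,2) 2(1,2) pd pz cr .
  next
    fix \<alpha> assume \<alpha>: "\<alpha> \<in> ind_roots \<Delta>"
    obtain x where x: "x \<in> Lg \<alpha> 0" "x \<noteq> 0"
        by (rule A.Lg_nonzeroE[OF bspec[OF A.ind_degree_0 \<alpha>]])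
    obtain \<alpha>' lam' where "((\<alpha>, 0), (\<alpha>', lam')) \<in> TT" by (rule TT_exists[OF ind[OF \<alpha>] x])
    then show "\<exists>b. (\<alpha>, 0, b) \<in> T" using T_I[OF \<alpha>] p0 by metis
  next
    fix \<alpha> a b b' assume t: "(\<alpha>, a, b) \<in> T" "(\<alpha>, a, b') \<in> T"
    obtain lam \<alpha>' lam' where 1: "a = p lam" "b = p' lam'" "((\<alpha>, lam), (\<alpha>', lam')) \<in> TT"
      using t(1) unfolding T_def by auto
    obtain \<mu> \<beta>' \<mu>' where 2: "a = p \<mu>" "b' = p' \<mu>'" "((\<alpha>, \<mu>), (\<beta>', \<mu>')) \<in> TT"
      using t(2) unfolding T_def by auto
    have "\<mu> = lam" using 1(1) 2(1) p(1) by (simp add: inj_eq)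
    then have "((\<alpha>, lam), (\<beta>', \<mu>')) \<in> TT" using 2(3) by simp
    then have "lam' = \<mu>'" using TT_fun[OF 1(3)] by simp
    then show "b = b'" using 1(2) 2(2) by simp
  qed
  have "(fst (fst t), p (snd (fst t)), p' (snd (snd t))) \<in> gen_subgroup T" if "t \<in> GG" for t
    using that unfolding GG_def
  proof (induction rule: gen_subgroup_induct)
    case (base t)
    obtain \<alpha> lam \<alpha>' lam' where t: "t = ((\<alpha>, lam), (\<alpha>', lam'))" by (metis surj_pair)
    have TT: "((\<alpha>, lam), (\<alpha>', lam')) \<in> TT" using base t by simp
    have \<alpha>: "\<alpha> \<in> \<Delta> - {0}" using TT_E[OF TT] by metis
    have "(\<alpha>, p lam, p' lam') \<in> gen_subgroup T"
    proof (cases "\<alpha> \<in> ind_roots \<Delta>")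
      case True
      then show ?thesis using T_I[OF _ TT] gen_subgroup_superset by (metis subsetD)
    next
      case False
      \<comment> \<open>The reflection in (2\<beta>, lam) sends (\<beta>, 0) to (-\<beta>, -lam),
        with target degree \<mu>' - lam'. The difference of these two points over indivisible roots
        is exactly (\<alpha>, lam) with target degree lam'.\<close>
      then obtain \<beta> where \<beta>: "\<beta> \<in> ind_roots \<Delta>" "\<alpha> = 2 *\<^sub>R \<beta>" by (rule A.not_ind_root[OF \<alpha>])
      obtain x where x: "x \<in> Lg \<beta> 0" "x \<noteq> 0"
        by (rule A.Lg_nonzeroE[OF bspec[OF A.ind_degree_0 \<beta>(1)]])
      obtain \<beta>' \<mu>' where b: "((\<beta>, 0), (\<beta>', \<mu>')) \<in> TT" by (rule TT_exists[OF ind[OF \<beta>(1)] x])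
      have "2 * coroot \<Delta> \<alpha> \<beta> = 2"
        using A.D.cr_self[OF \<alpha>] A.D.cr_scale[OF \<alpha>, of 2 \<beta>] \<beta>(2) by simp
      then have cr: "coroot \<Delta> \<alpha> \<beta> = 1" by simp
      then have pr: "pairing \<Delta> \<beta> \<alpha> = 1" by (simp add: pairing_def)
      have "A.D.reflect \<alpha> \<beta> = \<beta> - \<alpha>" by (simp add: A.D.reflect_def cr)
      then have "A.D.reflect \<alpha> \<beta> = - \<beta>" using \<beta>(2) by (simp add: scaleR_2)
      then have "((- \<beta>, - lam), (\<beta>' - \<alpha>', \<mu>' - lam')) \<in> TT"
        using TT_reflect[OF TT b] by (simp add: pr)
      then have "(- \<beta>, p (- lam), p' (\<mu>' - lam')) \<in> T"
        by (rule T_I[OF A.I.uminus_in[OF \<beta>(1)]])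
      moreover have "(\<beta>, p 0, p' \<mu>') \<in> T" by (rule T_I[OF \<beta>(1) b])
      ultimately have "(\<beta>, p 0, p' \<mu>') - (- \<beta>, p (- lam), p' (\<mu>' - lam')) \<in> gen_subgroup T"
        by (intro gen_subgroup_diff subsetD[OF gen_subgroup_superset])
      then show ?thesis by (simp add: p0 pd pm \<beta>(2) scaleR_2)
    qed
    then show ?case by (simp add: t)
  next
    case zero
    show ?case using gen_subgroup_zero[of T] by (simp add: p0 zero_prod_def)
  next
    case (add s t)
    then show ?case using gen_subgroup_add[OF add] by (simp add: p p')
  next
    case (uminus t)
    then show ?case using gen_subgroup_uminus[OF uminus] pm pd(2)[of 0] p0 by simp
  qed
  from this[OF assms] have "(0, 0, p' lam') \<in> gen_subgroup T" by (simp add: p0)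
  then have "p' lam' = p' 0" unfolding p0 by (rule graph_functional)
  then show ?thesis using p'(1) by (simp add: inj_eq)
qed

lemma GG_functional:
  assumes "(q, q') \<in> GG" "(q, q'') \<in> GG"
  shows "q' = q''"
proof -
  obtain a b c d where q: "q' = (a, b)" "q'' = (c, d)" by (metis surj_pair)
  have mem: "((0, 0), (a - c, b - d)) \<in> GG"
    using GG_diff[OF assms] by (simp add: q zero_prod_def)
  then have "a - c = 0" by (rule GG_root)
  moreover from mem this have "b - d = 0" using GG_degree by metis
  ultimately show ?thesis by (simp add: q)
qed

lemma GG_total:
  assumes "\<beta> \<in> zspan \<Delta>"
  obtains q where "((\<beta>, lam), q) \<in> GG"
proof -
  have "(\<beta>, lam) \<in> gen_subgroup (fst ` TT)"
  proof (rule A.degrees_generate_pairs[OF _ assms])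
    fix \<alpha> lam assume \<alpha>: "\<alpha> \<in> \<Delta> - {0}" "Lg \<alpha> lam \<noteq> {0}"
    obtain x where x: "x \<in> Lg \<alpha> lam" "x \<noteq> 0" by (rule A.Lg_nonzeroE[OF \<alpha>(2)])
    obtain \<alpha>' lam' where "((\<alpha>, lam), (\<alpha>', lam')) \<in> TT" by (rule TT_exists[OF \<alpha>(1) x])
    then have "(\<alpha>, lam) \<in> fst ` TT" by (metis fst_conv imageI)
    then show "(\<alpha>, lam) \<in> gen_subgroup (fst ` TT)" using gen_subgroup_superset by (metis subsetD)
  qed
  then have "\<exists>q. ((\<beta>, lam), q) \<in> GG" unfolding GG_def by (rule gen_subgroup_fst)
  then show thesis using that by (elim exE)
qed

text \<open>Formulated for components of arbitrary x because induction over generated elements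
  leaves the homogeneous ones. In a bracket, \<open>GG_total\<close> supplies target degrees for the
  two factors, and \<open>GG_functional\<close> identifies their sum with the prescribed
  one.\<close>

lemma GG_hcomp:
  assumes "((\<alpha>, lam), (\<alpha>', lam')) \<in> GG"
  shows "\<phi> (A.hcomp x \<alpha> lam) \<in> Lg' \<alpha>' lam'"
  using assms
proof (induction x arbitrary: \<alpha> lam \<alpha>' lam' rule: A.lie_induct)
  case (root \<gamma> x)
  show ?case
  proof (cases "A.hcomp x \<alpha> lam = 0")
    case False
    then have \<alpha>: "\<alpha> \<in> \<Delta> - {0}" using root(1,2) unfolding A.Lroot_iff by metis
    obtain \<beta>' \<mu>' where b: "((\<alpha>, lam), (\<beta>', \<mu>')) \<in> TT"
      by (rule TT_exists[OF \<alpha> A.hcomp_in False])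
    have "(\<alpha>', lam') = (\<beta>', \<mu>')" by (rule GG_functional[OF root(3) TT_GG[OF b]])
    then show ?thesis using TT_image[OF b A.hcomp_in] by simp
  qed simp
next
  case (br x y)
  show ?case unfolding A.hcomp_br phi_sum
  proof (intro B.Lg_sum)
    fix p q :: "'r \<times> 'l"
    obtain \<beta> \<mu> \<gamma> \<nu> where pq: "p = (\<beta>, \<mu>)" "q = (\<gamma>, \<nu>)" by (metis surj_pair)
    have "\<phi> (br (A.hcomp x \<beta> \<mu>) (A.hcomp y \<gamma> \<nu>)) \<in> Lg' \<alpha>' lam'" if s: "\<beta> + \<gamma> = \<alpha>" "\<mu> + \<nu> = lam"
    proof (cases "A.hcomp x \<beta> \<mu> = 0 \<or> A.hcomp y \<gamma> \<nu> = 0")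
      case True
      then show ?thesis by auto
    next
      case False
      then have z: "\<beta> \<in> zspan \<Delta>" "\<gamma> \<in> zspan \<Delta>"
        using A.Lg_nonzero_root[OF A.hcomp_in] A.zspan_base by metis+
      obtain b b' where b: "((\<beta>, \<mu>), (b, b')) \<in> GG" using GG_total[OF z(1)] by (metis surj_pair)
      obtain c c' where c: "((\<gamma>, \<nu>), (c, c')) \<in> GG" using GG_total[OF z(2)] by (metis surj_pair)
      have "((\<alpha>, lam), (b + c, b' + c')) \<in> GG" using GG_add[OF b c] s by simp
      then have "(\<alpha>', lam') = (b + c, b' + c')" by (rule GG_functional[OF br(3)])
      then show ?thesis using B.br_Lg[OF br(1)[OF b] br(2)[OF c]] by (simp add: phi_br)
    qed
    then show "\<phi> (if fst p + fst q = \<alpha> \<and> snd p + snd q = lam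
        then br (case_prod (A.hcomp x) p) (case_prod (A.hcomp y) q) else 0) \<in> Lg' \<alpha>' lam'"
      by (simp add: pq)
  qed
qed (simp_all add: A.hcomp_add A.hcomp_sc phi_add phi_sc B.Lg_add B.Lg_scale)

lemma GG_image:
  assumes "((\<alpha>, lam), (\<alpha>', lam')) \<in> GG"
  shows "\<phi> ` Lg \<alpha> lam \<subseteq> Lg' \<alpha>' lam'"
proof (rule image_subsetI)
  fix x assume "x \<in> Lg \<alpha> lam"
  then show "\<phi> x \<in> Lg' \<alpha>' lam'" using GG_hcomp[OF assms, of x] by (simp add: A.hcomp_Lg)
qed


section \<open>Exchanging the two tori\<close>

lemma inverse_iso: "torus_iso sc' br' \<Delta>' Lg' sc br \<Delta> Lg (inv \<phi>)"
proof (intro torus_iso.intro torus_iso_axioms.intro A.torus_axioms B.torus_axioms)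
  have f: "\<phi> (inv \<phi> y) = y" for y using phi_bij by (simp add: bij_is_surj surj_f_inv_f)
  have g: "inv \<phi> (\<phi> x) = x" for x using phi_bij by (simp add: bij_is_inj)
  have eq: "x = y" if "\<phi> x = \<phi> y" for x y using that phi_bij by (metis bij_def injD)
  show "alg_iso sc' br' sc br (inv \<phi>)"
    unfolding alg_iso_def
    by (intro conjI allI bij_imp_bij_inv[OF phi_bij] eq) (simp_all add: f phi_add phi_sc phi_br)
  show "inv \<phi> ` Lg' 0 0 = Lg 0 0"
    unfolding image_Lg_0[symmetric] by (simp add: image_image g)
qed

interpretation J: torus_iso sc' br' \<Delta>' Lg' sc br \<Delta> Lg "inv \<phi>"
  by (rule inverse_iso)

text \<open>A single nonzero vector and its image are witnesses in both directions. Through the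
  swap, every result on \<open>GG\<close> also yields its converse.\<close>

lemma TT_swap: "(p, q) \<in> TT \<longleftrightarrow> (q, p) \<in> J.TT"
proof -
  obtain \<alpha> lam \<alpha>' lam' where pq: "p = (\<alpha>, lam)" "q = (\<alpha>', lam')" by (metis surj_pair)
  show ?thesis
  proof
    assume "(p, q) \<in> TT"
    then obtain x where x: "\<alpha> \<in> \<Delta> - {0}" "x \<in> Lg \<alpha> lam" "x \<noteq> 0" "\<phi> x \<in> Lg' \<alpha>' lam'" "\<alpha>' \<in> \<Delta>' - {0}"
      unfolding pq by (rule TT_E)
    have "inv \<phi> (\<phi> x) \<in> Lg \<alpha> lam" using x(2) phi_bij by (simp add: bij_is_inj)
    then show "(q, p) \<in> J.TT" unfolding pq using x(3) by (intro J.TT_I[OF x(5,4)]) simp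
  next
    assume "(q, p) \<in> J.TT"
    then obtain y where y: "\<alpha>' \<in> \<Delta>' - {0}" "y \<in> Lg' \<alpha>' lam'" "y \<noteq> 0" "inv \<phi> y \<in> Lg \<alpha> lam"
      "\<alpha> \<in> \<Delta> - {0}"
      unfolding pq by (rule J.TT_E)
    have "\<phi> (inv \<phi> y) = y" using phi_bij by (simp add: bij_is_surj surj_f_inv_f)
    then show "(p, q) \<in> TT" unfolding pq using y(2,3) by (intro TT_I[OF y(5,4)]) (simp_all add: J.phi_eq_0_iff)
  qed
qed

lemma GG_swap: "(p, q) \<in> GG \<longleftrightarrow> (q, p) \<in> J.GG"
proof
  have "(snd t, fst t) \<in> J.GG" if "t \<in> GG" for t
    using that unfolding GG_def
  proof (induction rule: gen_subgroup_induct)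
    case (base t)
    then have "(snd t, fst t) \<in> J.TT" using TT_swap[of "fst t" "snd t"] by simp
    then show ?case by (rule J.TT_GG)
  next
    case zero
    show ?case using gen_subgroup_zero[of J.TT] by (simp add: J.GG_def zero_prod_def)
  next
    case (add s t)
    then show ?case using J.GG_add by simp
  next
    case (uminus t)
    then show ?case using gen_subgroup_uminus[of "(snd t, fst t)" J.TT] by (simp add: J.GG_def)
  qed
  from this[of "(p, q)"] show "(q, p) \<in> J.GG" if "(p, q) \<in> GG" using that by simp
  have "(snd t, fst t) \<in> GG" if "t \<in> J.GG" for t
    using that unfolding J.GG_def
  proof (induction rule: gen_subgroup_induct)
    case (base t)
    then have "(snd t, fst t) \<in> TT" using TT_swap[of "snd t" "fst t"] by simp
    then show ?case by (rule TT_GG)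
  next
    case zero
    show ?case using gen_subgroup_zero[of TT] by (simp add: GG_def zero_prod_def)
  next
    case (add s t)
    then show ?case using GG_add by simp
  next
    case (uminus t)
    then show ?case using gen_subgroup_uminus[of "(snd t, fst t)" TT] by (simp add: GG_def)
  qed
  from this[of "(q, p)"] show "(p, q) \<in> GG" if "(q, p) \<in> J.GG" using that by simp
qed

text \<open>\<open>TT\<close> records inclusions only; the reverse inclusion is
  \<open>GG_image\<close> for the inverse map.\<close>

lemma GG_image_eq:
  assumes "((\<alpha>, lam), (\<alpha>', lam')) \<in> GG"
  shows "\<phi> ` Lg \<alpha> lam = Lg' \<alpha>' lam'"
proof
  show "\<phi> ` Lg \<alpha> lam \<subseteq> Lg' \<alpha>' lam'" by (rule GG_image[OF assms])
  have sub: "inv \<phi> ` Lg' \<alpha>' lam' \<subseteq> Lg \<alpha> lam"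
    by (rule J.GG_image) (use assms GG_swap in simp)
  show "Lg' \<alpha>' lam' \<subseteq> \<phi> ` Lg \<alpha> lam"
  proof
    fix y assume "y \<in> Lg' \<alpha>' lam'"
    then have "inv \<phi> y \<in> Lg \<alpha> lam" using sub by auto
    moreover have "y = \<phi> (inv \<phi> y)" using phi_bij by (simp add: bij_is_surj surj_f_inv_f)
    ultimately show "y \<in> \<phi> ` Lg \<alpha> lam" by (rule rev_image_eqI)
  qed
qed

lemma GG_root_rev: "((\<beta>, lam), (0, lam')) \<in> GG \<Longrightarrow> \<beta> = 0"
  using J.GG_root GG_swap by metis

section \<open>Reading off the data of the isotopy\<close>

definition img :: "'r \<times> 'l \<Rightarrow> 'r2 \<times> 'l2" where
  "img p = (THE q. (p, q) \<in> GG)"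

lemma img_eq: "(p, q) \<in> GG \<Longrightarrow> img p = q"
  unfolding img_def using GG_functional by (intro the_equality)

lemma img_GG: "\<beta> \<in> zspan \<Delta> \<Longrightarrow> ((\<beta>, lam), img (\<beta>, lam)) \<in> GG"
  using GG_total img_eq by metis

lemma img_0: "fst (img (0, lam)) = 0"
proof -
  have "((0, lam), (fst (img (0, lam)), snd (img (0, lam)))) \<in> GG"
    using img_GG[OF A.zspan_0] by simp
  then show ?thesis by (rule GG_root)
qed

lemma img_0': "((0, lam), (0, snd (img (0, lam)))) \<in> GG"
  using img_GG[OF A.zspan_0, of lam] img_0[of lam] by (metis prod.collapse)

lemma img_add:
  assumes "\<beta> \<in> zspan \<Delta>" "\<gamma> \<in> zspan \<Delta>"
  shows "img (\<beta> + \<gamma>, lam + \<mu>) = img (\<beta>, lam) + img (\<gamma>, \<mu>)"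
  using GG_add[OF img_GG[OF assms(1), of lam] img_GG[OF assms(2), of \<mu>]] by (intro img_eq) simp

text \<open>By \<open>img_0\<close> the homomorphism \<open>img\<close> on the product of
  \<open>Q\<close> and the degree group is block triangular: (0, lam) has an image with root part 0.
  The diagonal blocks are the maps on roots and on degrees, and the remaining block is the
  shift.\<close>

lemma is_isotopy: "is_isotopy sc br \<Delta> Lg sc' br' \<Delta>' Lg' \<phi>"
  unfolding is_isotopy_def
proof (intro conjI exI ballI allI)
  let ?r = "\<lambda>\<beta>. fst (img (\<beta>, 0))" and ?e = "\<lambda>lam. snd (img (0, lam))"
    and ?s = "\<lambda>\<beta>. snd (img (\<beta>, 0))"
  show "alg_iso sc br sc' br' \<phi>" by (rule iso)
  show "?r (\<alpha> + \<beta>) = ?r \<alpha> + ?r \<beta>" "?s (\<alpha> + \<beta>) = ?s \<alpha> + ?s \<beta>"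
    if "\<alpha> \<in> zspan \<Delta>" "\<beta> \<in> zspan \<Delta>" for \<alpha> \<beta>
    using img_add[OF that, of 0 0] by simp_all
  show "?e (lam + \<mu>) = ?e lam + ?e \<mu>" for lam \<mu>
    using img_add[OF A.zspan_0 A.zspan_0, of lam \<mu>] by simp
  show "bij_betw ?r (zspan \<Delta>) (zspan \<Delta>')"
  proof (rule bij_betwI')
    fix \<beta> \<gamma> assume z: "\<beta> \<in> zspan \<Delta>" "\<gamma> \<in> zspan \<Delta>"
    have "\<beta> = \<gamma>" if eq: "?r \<beta> = ?r \<gamma>"
    proof -
      have "((\<beta> - \<gamma>, 0), (0, ?s \<beta> - ?s \<gamma>)) \<in> GG"
        using GG_diff[OF img_GG[OF z(1), of 0] img_GG[OF z(2), of 0]] eq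
        by (simp add: minus_prod_def)
      then have "\<beta> - \<gamma> = 0" by (rule GG_root_rev)
      then show ?thesis by simp
    qed
    then show "(?r \<beta> = ?r \<gamma>) = (\<beta> = \<gamma>)" by (intro iffI) simp_all
  next
    fix \<beta> assume "\<beta> \<in> zspan \<Delta>"
    then have "((\<beta>, 0), (?r \<beta>, ?s \<beta>)) \<in> GG" using img_GG by simp
    then show "?r \<beta> \<in> zspan \<Delta>'" by (rule GG_weights(2))
  next
    fix \<beta>' assume \<beta>': "\<beta>' \<in> zspan \<Delta>'"
    obtain \<beta> lam where "((\<beta>', 0), (\<beta>, lam)) \<in> J.GG" using J.GG_total[OF \<beta>'] by (metis surj_pair)
    then have b: "((\<beta>, lam), (\<beta>', 0)) \<in> GG" using GG_swap by simp
    \<comment> \<open>The source found for (\<beta>', 0) may have a nonzero degree; removing it by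
      subtracting (0, lam) leaves the root part of the target unchanged.\<close>
    have "img (\<beta>, 0) = (\<beta>', - ?e lam)"
      using GG_diff[OF b img_0'[of lam]] by (intro img_eq) simp
    then show "\<exists>\<beta>\<in>zspan \<Delta>. \<beta>' = ?r \<beta>" using GG_weights(1)[OF b] by (metis fst_conv)
  qed
  show "bij ?e"
  proof (rule bijI)
    show "inj ?e"
    proof (rule injI)
      fix lam \<mu> assume "?e lam = ?e \<mu>"
      then have "((0, lam - \<mu>), (0, 0)) \<in> GG"
        using GG_diff[OF img_0'[of lam] img_0'[of \<mu>]] by (simp add: zero_prod_def)
      then have "((0, 0), (0, lam - \<mu>)) \<in> J.GG" using GG_swap by simp
      then have "lam - \<mu> = 0" by (rule J.GG_degree)
      then show "lam = \<mu>" by simp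
    qed
    have "\<exists>lam. lam' = ?e lam" for lam'
    proof -
      obtain \<beta> lam where "((0, lam'), (\<beta>, lam)) \<in> J.GG"
        using J.GG_total[OF B.zspan_0] by (metis surj_pair)
      then have b: "((\<beta>, lam), (0, lam')) \<in> GG" using GG_swap by simp
      then have "\<beta> = 0" by (rule GG_root_rev)
      then have "img (0, lam) = (0, lam')" using b by (intro img_eq) simp
      then show ?thesis by (metis snd_conv)
    qed
    then show "surj ?e" unfolding surj_def by (rule allI)
  qed
  fix \<alpha> lam assume \<alpha>: "\<alpha> \<in> zspan \<Delta>"
  have "((\<alpha>, lam), (?r \<alpha>, ?e lam + ?s \<alpha>)) \<in> GG"
    using GG_add[OF img_0'[of lam] img_GG[OF \<alpha>, of 0]] by (simp add: plus_prod_def)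
  then show "\<phi> ` Lg \<alpha> lam = Lg' (?r \<alpha>) (?e lam + ?s \<alpha>)" by (rule GG_image_eq)
qed

end

theorem theorem7p2:
  fixes sc :: "'k::field_char_0 \<Rightarrow> 'v::ab_group_add \<Rightarrow> 'v"
    and br :: "'v \<Rightarrow> 'v \<Rightarrow> 'v"
    and \<Delta> :: "'r::real_vector set"
    and Lg :: "'r \<Rightarrow> 'l::ab_group_add \<Rightarrow> 'v set"
    and sc' :: "'k \<Rightarrow> 'w::ab_group_add \<Rightarrow> 'w"
    and br' :: "'w \<Rightarrow> 'w \<Rightarrow> 'w"
    and \<Delta>' :: "'r2::real_vector set"
    and Lg' :: "'r2 \<Rightarrow> 'l2::ab_group_add \<Rightarrow> 'w set"
    and \<phi> :: "'v \<Rightarrow> 'w"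
  assumes "lie_torus sc br \<Delta> Lg" and "centreless br"
    and "lie_torus sc' br' \<Delta>' Lg'" and "centreless br'"
    and "alg_iso sc br sc' br' \<phi>"
  shows "is_isotopy sc br \<Delta> Lg sc' br' \<Delta>' Lg' \<phi> \<longleftrightarrow> \<phi> ` Lg 0 0 = Lg' 0 0"
proof
  assume "is_isotopy sc br \<Delta> Lg sc' br' \<Delta>' Lg' \<phi>"
  then obtain \<phi>r :: "'r \<Rightarrow> 'r2" and \<phi>e :: "'l \<Rightarrow> 'l2" and \<phi>s :: "'r \<Rightarrow> 'l2" where
    r: "\<forall>\<alpha>\<in>zspan \<Delta>. \<forall>\<beta>\<in>zspan \<Delta>. \<phi>r (\<alpha> + \<beta>) = \<phi>r \<alpha> + \<phi>r \<beta>"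
    and e: "\<forall>lam \<mu>. \<phi>e (lam + \<mu>) = \<phi>e lam + \<phi>e \<mu>"
    and s: "\<forall>\<alpha>\<in>zspan \<Delta>. \<forall>\<beta>\<in>zspan \<Delta>. \<phi>s (\<alpha> + \<beta>) = \<phi>s \<alpha> + \<phi>s \<beta>"
    and L: "\<forall>\<alpha>\<in>zspan \<Delta>. \<forall>lam. \<phi> ` Lg \<alpha> lam = Lg' (\<phi>r \<alpha>) (\<phi>e lam + \<phi>s \<alpha>)"
    unfolding is_isotopy_def by (elim conjE exE)
  have z: "0 \<in> zspan \<Delta>" by (simp add: zspan_eq_gen_subgroup gen_subgroup_zero)
  have "\<phi>r (0 + 0) = \<phi>r 0 + \<phi>r 0" "\<phi>s (0 + 0) = \<phi>s 0 + \<phi>s 0" using r s z by blast+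
  moreover have "\<phi>e (0 + 0) = \<phi>e 0 + \<phi>e 0" using e by blast
  ultimately have "\<phi>r 0 = 0" "\<phi>s 0 = 0" "\<phi>e 0 = 0" by simp_all
  then show "\<phi> ` Lg 0 0 = Lg' 0 0" using L z by simp
next
  assume "\<phi> ` Lg 0 0 = Lg' 0 0"
  then interpret torus_iso sc br \<Delta> Lg sc' br' \<Delta>' Lg' \<phi>
    using assms by (intro torus_iso.intro torus.intro torus_iso_axioms.intro)
  show "is_isotopy sc br \<Delta> Lg sc' br' \<Delta>' Lg' \<phi>" by (rule is_isotopy)
qed

end
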